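(* In the setting described in the context, the matrix $G=B_C\widetilde A^{-1}B_C^T$ on $X=Q_\Gamma\oplus\Lambda$ is symmetric positive semi-definite: zero is an eigenvalue of multiplicity exactly one and all other eigenvalues are positive. A basis of its one-dimensional null space is the vector $$\left(1_{p_\Gamma},\ -B_{\Delta,D}\begin{bmatrix} B_{I\Delta}^T & B_{\Gamma\Delta}^T \end{bmatrix}\begin{bmatrix} 1_{p_I} \\ 1_{p_\Gamma} \end{bmatrix}\right)\in Q_\Gamma\oplus\Lambda ,$$ where $1_{p_I}\in Q_I$ and $1_{p_\Gamma}\in Q_\Gamma$ are the vectors with every entry equal to $1$.
   Context: Discretization. $\Omega$ is a bounded polygonal domain in $\mathbb R^2$, triangulated into shape-regular triangles of characteristic size $h$. The pressure space $Q\subset L^2(\Omega)$ consists of the continuous piecewise linear functions on this triangulation. The velocity space $\mathbf W\subset (H^1_0(\Omega))^2$ consists of the continuous piecewise linear vector fields on the refined triangulation obtained by splitting each triangle into four by joining its edge midpoints. Functions are identified with their vectors of nodal values. The matrices $A$ and $B$ represent $a(\mathbf u,\mathbf v)=\int_\Omega\nabla\mathbf u\cdot\nabla\mathbf v$ on $\mathbf W$ and $b(\mathbf u,q)=-\int_\Omega(\nabla\cdot\mathbf u)q$ on $\mathbf W\times Q$. $A$ is symmetric positive definite and $\mathrm{Ker}(B^T)$ is the space of constant pressures (the pair $\mathbf W\times Q$ is inf-sup stable). Decomposition. $\Omega$ is decomposed into $N$ non-overlapping polygonal subdomains $\Omega_i$, each a union of elements, with diameters of order $H$; nodes match across the interface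 $\Gamma=(\cup\partial\Omega_i)\setminus\partial\Omega$, which consists of subdomain edges and subdomain vertices. $\mathbf W=\mathbf W_I\oplus\mathbf W_\Gamma$ and $Q=Q_I\oplus Q_\Gamma$, where $\mathbf W_I=\bigoplus_i\mathbf W_I^{(i)}$, $Q_I=\bigoplus_iQ_I^{(i)}$ are subdomain-interior degrees of freedom and $\mathbf W_\Gamma$, $Q_\Gamma$ are the interface degrees of freedom, shared by neighboring subdomains. $\mathbf W_\Gamma$ is replaced by the partially assembled space $\widetilde{\mathbf W}_\Gamma=\mathbf W_\Pi\oplus\mathbf W_\Delta$, $\mathbf W_\Delta=\bigoplus_i\mathbf W_\Delta^{(i)}$. Here $\mathbf W_\Pi$ is the continuous coarse-level primal velocity space, typically spanned by subdomain vertex nodal basis functions and/or interface edge basis functions with constant values (or values of positive weights) on the edges. $\mathbf W_\Delta^{(i)}$ is spanned by the remaining (dual) interface velocity degrees of freedom of $\Omega_i$, with basis functions vanishing at the primal degrees of freedom; elements of $\mathbf W_\Delta$ may be discontinuous across $\Gamma$. $B_\Delta$ is a matrix with entries in $\{0,1,-1\}$; each row has exactly two nonzero entries $1,-1$, corresponding to the same interface velocity degree of freedom in two neighboring subdomains, so that $B_\Delta\mathbf w_\Delta=0$ expresses continuity of $\mathbf w_\Delta$. Non-redundant constraints are used, so $B_\Delta$ has full row rank. $\Lambda$ is the range of $B_\Delta$ on $\mathbf W_\Delta$. $B_{\Delta,D}$ is obtained from $B_\Delta$ by multiplying each entry corresponding to a node $x$ by $\delta^\dagger(x)=1/\mathcal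 N_x$, $\mathcal N_x$ being the number of subdomains sharing $x$; it satisfies $B_\Delta B_{\Delta,D}^T=I$. Operators. With sub-blocks denoting the subdomain-wise restrictions of $A$ and $B$ to the indicated subspaces, set, on $\mathbf W_I\oplus Q_I\oplus\mathbf W_\Delta\oplus\mathbf W_\Pi$, $$\widetilde A=\begin{bmatrix} A_{II} & B_{II}^T & A_{I\Delta} & A_{I\Pi} \\ B_{II} & 0 & B_{I\Delta} & B_{I\Pi} \\ A_{\Delta I} & B_{I\Delta}^T & A_{\Delta\Delta} & A_{\Delta\Pi} \\ A_{\Pi I} & B_{I\Pi}^T & A_{\Pi\Delta} & A_{\Pi\Pi} \end{bmatrix},\qquad B_C=\begin{bmatrix} B_{\Gamma I} & 0 & B_{\Gamma\Delta} & B_{\Gamma\Pi} \\ 0 & 0 & B_\Delta & 0 \end{bmatrix}.$$ $\widetilde A$ is invertible. The matrix $-G$ is the Schur complement, with respect to the variables $(p_\Gamma,\lambda)$, of $\begin{bmatrix} \widetilde A & B_C^T \\ B_C & 0 \end{bmatrix}$. *)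

theory Defs
  imports
    "HOL-Analysis.Analysis"
    "Jordan_Normal_Form.Char_Poly"
    "Jordan_Normal_Form.Matrix_Kernel"
    "Jordan_Normal_Form.Gauss_Jordan_Elimination"
    "Jordan_Normal_Form.DL_Rank"
begin

type_synonym point = "real ^ 2"

text \<open>A triangle is represented by the set of its three vertices; the closed triangle itself is
  the convex hull. The intersection condition says that two triangles are disjoint or share
  exactly a vertex or an edge.\<close>

definition triangulation :: "point set set \<Rightarrow> bool" where
  "triangulation M \<longleftrightarrow> finite M \<and>
     (\<forall>K\<in>M. card K = 3 \<and> \<not> affine_dependent K) \<and>
     (\<forall>K\<in>M. \<forall>L\<in>M. convex hull K \<inter> convex hull L = convex hull (K \<inter> L))"

definition region :: "point set set \<Rightarrow> point set" where
  "region M = (\<Union>K\<in>M. convex hull K)"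

definition nodes :: "point set set \<Rightarrow> point set" where
  "nodes M = \<Union>M"

definition refine :: "point set set \<Rightarrow> point set set" where
  "refine M =
     {{a, midpoint a b, midpoint a c} | a b c. {a, b, c} \<in> M \<and> card {a, b, c} = 3} \<union>
     {{midpoint a b, midpoint b c, midpoint a c} | a b c. {a, b, c} \<in> M \<and> card {a, b, c} = 3}"

text \<open>With constants depending only on \<open>\<sigma>\<close>, every triangle has diameter at most of order \<open>h\<close>
  and contains a disc of radius of order \<open>h\<close>.\<close>

definition shape_regular :: "real \<Rightarrow> real \<Rightarrow> point set set \<Rightarrow> bool" where
  "shape_regular \<sigma> h M \<longleftrightarrow>
     (\<forall>K\<in>M. diameter (convex hull K) \<le> \<sigma> * h \<and> (\<exists>z. ball z (h / \<sigma>) \<subseteq> convex hull K))"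

text \<open>Functions on the closed domain are extended by zero to the whole plane, so that a finite
  element function is determined by its nodal values.\<close>

definition P1 :: "point set set \<Rightarrow> (point \<Rightarrow> 'b::real_normed_vector) set" where
  "P1 M = {u. continuous_on (region M) u \<and>
              (\<forall>K\<in>M. \<exists>L c. linear L \<and> (\<forall>x\<in>convex hull K. u x = c + L x)) \<and>
              (\<forall>x. x \<notin> region M \<longrightarrow> u x = 0)}"

definition hat :: "point set set \<Rightarrow> point \<Rightarrow> point \<Rightarrow> real" where
  "hat M x = (THE u. u \<in> P1 M \<and> (\<forall>y\<in>nodes M. u y = (if y = x then 1 else 0)))"

text \<open>Finite element functions are differentiable except on the element edges, a null set that
  the (Henstock--Kurzweil) integral ignores. The inner product on \<open>real ^ 2 ^ 2\<close> is the
  Frobenius product.\<close>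

definition grad :: "(point \<Rightarrow> point) \<Rightarrow> point \<Rightarrow> real ^ 2 ^ 2" where
  "grad u x = matrix (frechet_derivative u (at x))"

definition a_form :: "point set \<Rightarrow> (point \<Rightarrow> point) \<Rightarrow> (point \<Rightarrow> point) \<Rightarrow> real" where
  "a_form S u v = integral S (\<lambda>x. inner (grad u x) (grad v x))"

definition b_form :: "point set \<Rightarrow> (point \<Rightarrow> point) \<Rightarrow> (point \<Rightarrow> real) \<Rightarrow> real" where
  "b_form S u q = - integral S (\<lambda>x. trace (grad u x) * q x)"

text \<open>
  \<^item> \<open>subd i\<close>, for \<open>i < nsub\<close>, is the set of triangles forming the closure of subdomain \<open>i\<close>.
  \<^item> \<open>pres_int\<close>, \<open>pres_gam\<close>, \<open>vel_int\<close> number the degrees of freedom of the nodal bases of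
    \<open>Q_I\<close>, \<open>Q_\<Gamma>\<close> and \<open>W_I\<close>; a velocity degree of freedom is a node with a component.
  \<^item> \<open>primal\<close> lists the basis functions of \<open>W_\<Pi>\<close>.
  \<^item> \<open>dual\<close> lists the remaining interface velocity degrees of freedom, each as a node together
    with a basis function. The function need not be the nodal one, since a change of basis is
    needed e.g. when edge averages are primal.
  \<^item> \<open>copies\<close> numbers the basis of \<open>W_\<Delta>\<close>: the pair \<open>(k, i)\<close> stands for the copy of the dual
    degree of freedom \<open>k\<close> in subdomain \<open>i\<close>.
  \<^item> \<open>jump\<close> is the matrix \<open>B_\<Delta>\<close>.\<close>

record setting =
  tri :: "point set set"
  nsub :: nat
  subd :: "nat \<Rightarrow> point set set"
  pres_int :: "point list"
  pres_gam :: "point list"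
  vel_int :: "(point \<times> 2) list"
  primal :: "(point \<Rightarrow> point) list"
  dual :: "(point \<times> (point \<Rightarrow> point)) list"
  copies :: "(nat \<times> nat) list"
  jump :: "real mat"

definition Omega :: "setting \<Rightarrow> point set" where
  "Omega D = interior (region (tri D))"

definition Omega_sub :: "setting \<Rightarrow> nat \<Rightarrow> point set" where
  "Omega_sub D i = interior (region (subd D i))"

definition interface :: "setting \<Rightarrow> point set" where
  "interface D = (\<Union>i<nsub D. frontier (Omega_sub D i)) - frontier (Omega D)"

definition sharing :: "setting \<Rightarrow> point \<Rightarrow> nat set" where
  "sharing D x = {i. i < nsub D \<and> x \<in> closure (Omega_sub D i)}"

abbreviation fmesh :: "setting \<Rightarrow> point set set" where
  "fmesh D \<equiv> refine (tri D)"

definition decomposed_domain :: "setting \<Rightarrow> bool" where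
  "decomposed_domain D \<longleftrightarrow>
     triangulation (tri D) \<and> connected (Omega D) \<and> nsub D \<ge> 2 \<and>
     tri D = (\<Union>i<nsub D. subd D i) \<and>
     (\<forall>i<nsub D. \<forall>j<nsub D. i \<noteq> j \<longrightarrow> subd D i \<inter> subd D j = {}) \<and>
     (\<forall>i<nsub D. subd D i \<noteq> {} \<and> connected (Omega_sub D i))"

definition subdomain_size :: "real \<Rightarrow> real \<Rightarrow> setting \<Rightarrow> bool" where
  "subdomain_size \<sigma> H D \<longleftrightarrow>
     (\<forall>i<nsub D. H / \<sigma> \<le> diameter (Omega_sub D i) \<and> diameter (Omega_sub D i) \<le> \<sigma> * H)"

definition pressure_space :: "setting \<Rightarrow> (point \<Rightarrow> real) set" where
  "pressure_space D = P1 (tri D)"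

definition velocity_space :: "setting \<Rightarrow> (point \<Rightarrow> point) set" where
  "velocity_space D = {u \<in> P1 (fmesh D). \<forall>x\<in>frontier (Omega D). u x = 0}"

definition velocity_gam :: "setting \<Rightarrow> (point \<Rightarrow> point) set" where
  "velocity_gam D = {u \<in> velocity_space D. \<forall>x\<in>nodes (fmesh D). x \<notin> interface D \<longrightarrow> u x = 0}"

definition ker_BT_constants :: "setting \<Rightarrow> bool" where
  "ker_BT_constants D \<longleftrightarrow>
     {q \<in> pressure_space D. \<forall>u\<in>velocity_space D. b_form (Omega D) u q = 0} =
     {q \<in> pressure_space D. \<exists>c. \<forall>x\<in>region (tri D). q x = c}"

text \<open>Pressures are not constrained on the boundary of the domain. A pressure node is therefore an
  interface node as soon as it is shared by several subdomains, even if it lies on that boundary,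
  where an interface edge ends.\<close>

definition numbered_dofs :: "setting \<Rightarrow> bool" where
  "numbered_dofs D \<longleftrightarrow>
     distinct (pres_int D) \<and>
     set (pres_int D) = {x \<in> nodes (tri D). card (sharing D x) = 1} \<and>
     distinct (pres_gam D) \<and>
     set (pres_gam D) = {x \<in> nodes (tri D). card (sharing D x) \<ge> 2} \<and>
     distinct (vel_int D) \<and>
     set (vel_int D) = {x \<in> nodes (fmesh D). \<exists>i<nsub D. x \<in> Omega_sub D i} \<times> UNIV"

definition function_basis :: "(point \<Rightarrow> point) list \<Rightarrow> (point \<Rightarrow> point) set \<Rightarrow> bool" where
  "function_basis fs V \<longleftrightarrow> set fs \<subseteq> V \<and>
     (\<forall>u\<in>V. \<exists>!c. c \<in> carrier_vec (length fs) \<and>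
                u = (\<lambda>x. \<Sum>k<length fs. vec_index c k *\<^sub>R (fs ! k) x))"

text \<open>The primal and dual functions form a basis of \<open>W_\<Gamma>\<close>. The primal degrees of freedom are the
  coefficients of the primal functions in this basis, on which the dual functions vanish.
  A dual function attached to the node \<open>x\<close> lives exactly on the subdomains sharing \<open>x\<close>.\<close>

definition primal_dual_split :: "setting \<Rightarrow> bool" where
  "primal_dual_split D \<longleftrightarrow>
     function_basis (primal D @ map snd (dual D)) (velocity_gam D) \<and>
     (\<forall>(x, f)\<in>set (dual D). x \<in> nodes (fmesh D) \<inter> interface D \<and> f x \<noteq> 0 \<and>
        (\<forall>i<nsub D. i \<notin> sharing D x \<longrightarrow> (\<forall>y\<in>closure (Omega_sub D i). f y = 0))) \<and>
     distinct (copies D) \<and>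
     set (copies D) = {(k, i). k < length (dual D) \<and> i \<in> sharing D (fst (dual D ! k))}"

text \<open>An element of the partially assembled space is a family of functions indexed by the
  subdomains, of which the \<open>i\<close>-th one is relevant on subdomain \<open>i\<close> only.\<close>

type_synonym broken = "nat \<Rightarrow> point \<Rightarrow> point"

definition basis_I :: "setting \<Rightarrow> broken list" where
  "basis_I D = map (\<lambda>(x, c) i y. hat (fmesh D) x y *\<^sub>R axis c 1) (vel_int D)"

definition basis_Dlt :: "setting \<Rightarrow> broken list" where
  "basis_Dlt D = map (\<lambda>(k, j) i. if i = j then snd (dual D ! k) else (\<lambda>y. 0)) (copies D)"

definition basis_Pi :: "setting \<Rightarrow> broken list" where
  "basis_Pi D = map (\<lambda>f i. f) (primal D)"

definition basis_pI :: "setting \<Rightarrow> (point \<Rightarrow> real) list" where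
  "basis_pI D = map (hat (tri D)) (pres_int D)"

definition basis_pG :: "setting \<Rightarrow> (point \<Rightarrow> real) list" where
  "basis_pG D = map (hat (tri D)) (pres_gam D)"

definition continuous_broken :: "setting \<Rightarrow> broken \<Rightarrow> bool" where
  "continuous_broken D w \<longleftrightarrow>
     (\<forall>i<nsub D. \<forall>j<nsub D. \<forall>x\<in>closure (Omega_sub D i) \<inter> closure (Omega_sub D j). w i x = w j x)"

definition Dlt_function :: "setting \<Rightarrow> real vec \<Rightarrow> broken" where
  "Dlt_function D c =
     (\<lambda>i x. \<Sum>s<length (copies D). vec_index c s *\<^sub>R (basis_Dlt D ! s) i x)"

definition jump_scaled :: "setting \<Rightarrow> real mat" where
  "jump_scaled D = Matrix.mat (dim_row (jump D)) (dim_col (jump D))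
     (\<lambda>(r, s). jump D $$ (r, s) / real (card (sharing D (fst (dual D ! fst (copies D ! s))))))"

definition jump_constraints :: "setting \<Rightarrow> bool" where
  "jump_constraints D \<longleftrightarrow>
     dim_col (jump D) = length (copies D) \<and>
     (\<forall>r<dim_row (jump D). \<exists>s<length (copies D). \<exists>t<length (copies D). s \<noteq> t \<and>
        fst (copies D ! s) = fst (copies D ! t) \<and>
        jump D $$ (r, s) = 1 \<and> jump D $$ (r, t) = -1 \<and>
        (\<forall>l<length (copies D). l \<noteq> s \<and> l \<noteq> t \<longrightarrow> jump D $$ (r, l) = 0)) \<and>
     (\<forall>w\<in>carrier_vec (length (copies D)).
        jump D *\<^sub>v w = 0\<^sub>v (dim_row (jump D)) \<longleftrightarrow> continuous_broken D (Dlt_function D w)) \<and>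
     vec_space.rank (dim_row (jump D)) (jump D) = dim_row (jump D)"

definition A_mat :: "setting \<Rightarrow> broken list \<Rightarrow> broken list \<Rightarrow> real mat" where
  "A_mat D us vs = Matrix.mat (length us) (length vs)
     (\<lambda>(r, s). \<Sum>i<nsub D. a_form (Omega_sub D i) ((us ! r) i) ((vs ! s) i))"

definition B_mat :: "setting \<Rightarrow> (point \<Rightarrow> real) list \<Rightarrow> broken list \<Rightarrow> real mat" where
  "B_mat D qs us = Matrix.mat (length qs) (length us)
     (\<lambda>(r, s). \<Sum>i<nsub D. b_form (Omega_sub D i) ((us ! s) i) (qs ! r))"

definition A_tilde :: "setting \<Rightarrow> real mat" where
  "A_tilde D = (let I = basis_I D; P = basis_pI D; Dl = basis_Dlt D; Pr = basis_Pi D;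
       A = A_mat D; B = B_mat D in
     four_block_mat
       (four_block_mat (A I I) (transpose_mat (B P I))
                       (B P I) (0\<^sub>m (length P) (length P)))
       (four_block_mat (A I Dl) (A I Pr)
                       (B P Dl) (B P Pr))
       (four_block_mat (A Dl I) (transpose_mat (B P Dl))
                       (A Pr I) (transpose_mat (B P Pr)))
       (four_block_mat (A Dl Dl) (A Dl Pr)
                       (A Pr Dl) (A Pr Pr)))"

text \<open>The outer block matrix puts the left and the right half of \<open>B_C\<close> side by side; its lower
  blocks have no rows.\<close>

definition B_C :: "setting \<Rightarrow> real mat" where
  "B_C D = (let I = basis_I D; P = basis_pI D; Ga = basis_pG D; Dl = basis_Dlt D; Pr = basis_Pi D;
       B = B_mat D; m = dim_row (jump D) in
     four_block_mat
       (four_block_mat (B Ga I) (0\<^sub>m (length Ga) (length P))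
                       (0\<^sub>m m (length I)) (0\<^sub>m m (length P)))
       (four_block_mat (B Ga Dl) (B Ga Pr)
                       (jump D) (0\<^sub>m m (length Pr)))
       (0\<^sub>m 0 (length I + length P))
       (0\<^sub>m 0 (length Dl + length Pr)))"

definition G_mat :: "setting \<Rightarrow> real mat" where
  "G_mat D = B_C D * the (mat_inverse (A_tilde D)) * transpose_mat (B_C D)"

text \<open>The dimension of \<open>Q_\<Gamma> \<oplus> \<Lambda>\<close>: since \<open>B_\<Delta>\<close> has full row rank, its range \<open>\<Lambda>\<close> consists of
  all vectors of length \<open>dim_row (jump D)\<close>.\<close>

definition dim_X :: "setting \<Rightarrow> nat" where
  "dim_X D = length (pres_gam D) + dim_row (jump D)"

definition ones :: "nat \<Rightarrow> real vec" where
  "ones n = Matrix.vec n (\<lambda>_. 1)"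

definition null_vector :: "setting \<Rightarrow> real vec" where
  "null_vector D =
     ones (length (pres_gam D)) @\<^sub>v
     - (jump_scaled D *\<^sub>v
         (transpose_mat (B_mat D (basis_pI D) (basis_Dlt D) @\<^sub>r B_mat D (basis_pG D) (basis_Dlt D))
          *\<^sub>v (ones (length (pres_int D)) @\<^sub>v ones (length (pres_gam D)))))"

end

theory Submission
  imports Defs
begin

text \<open>Let \<open>K\<close> be the matrix \<open>A_tilde\<close> and \<open>C\<close> the matrix \<open>B_C\<close>. For \<open>x \<in> Q\<^sub>\<Gamma> \<oplus> \<Lambda>\<close> solve
  \<open>K y = C\<^sup>T x\<close> and let \<open>w\<close> be the velocity part of \<open>y\<close>. The rows of the interior pressures show
  that \<open>w\<close> is discretely divergence free, so \<open>x \<bullet> G x\<close> equals the subdomain-wise Dirichlet energy of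
  \<open>w\<close>. If this energy vanishes, then \<open>(w, 0)\<close> lies in the kernel of \<open>K\<close>, hence \<open>w = 0\<close>, and the
  equation says that the pressure \<open>q = (- p\<^sub>I, p\<^sub>\<Gamma>)\<close> is orthogonal to the divergence of every
  continuous velocity. Hence \<open>q\<close> is constant, and the remaining equation determines \<open>\<lambda>\<close> because
  \<open>B\<^sub>\<Delta>\<^sub>,\<^sub>D B\<^sub>\<Delta>\<^sup>T = I\<close>. Conversely, the constant pressure 1 gives a kernel vector, since the functional
  \<open>b(\<cdot>, 1)\<close> on \<open>W\<^sub>\<Delta>\<close> vanishes on the kernel of \<open>B\<^sub>\<Delta>\<close>. The algebraic multiplicity is one because \<open>G\<close> is
  symmetric.\<close>

section \<open>Schur complements of saddle point matrices\<close>

text \<open>The obstacle to semi-definiteness is that \<open>A_tilde\<close> is indefinite: it is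
  nonnegative only on velocity vectors and isotropic on interior pressure vectors. The abstract
  result therefore works with two such sets, and invertibility of \<open>A_tilde\<close> takes the
  place of a coercivity estimate on discontinuous velocities. The minus sign at the interior
  pressure arises because that pressure is an unknown on the left of the system, while the interface
  pressure is data on the right. The analytic work links coefficients with functions. Nodal
  functions are given by a definite description, so their existence must be proved, on the refined
  mesh by formulas in the coarse hat functions; those of interior nodes must also vanish on the
  boundary of the domain to lie in the velocity space. As \<open>ker_BT_constants\<close> speaks of
  continuous velocities only, broken velocities without jumps have to be glued, which yields the
  null vector, and continuous ones have to be decomposed in the broken basis, which shows that a
  kernel pressure is constant.\<close>

lemma scalar_prod_self_eq_0_iff:
  fixes v :: "real vec"
  assumes "v \<in> carrier_vec n"
  shows "scalar_prod v v = 0 \<longleftrightarrow> v = 0\<^sub>v n"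
proof
  assume "scalar_prod v v = 0"
  then have "\<forall>i\<in>{0..<n}. vec_index v i * vec_index v i = 0"
    using assms by (subst (asm) scalar_prod_def) (auto simp: sum_nonneg_eq_0_iff)
  then show "v = 0\<^sub>v n" using assms by auto
qed (use assms in auto)

text \<open>Testing replaces the comparison of entries, so the block systems below can be treated as
  variational equations.\<close>

lemma vec_eqI_scalar_prod:
  fixes v w :: "real vec"
  assumes v: "v \<in> carrier_vec n" and w: "w \<in> carrier_vec n"
    and eq: "\<And>u. u \<in> carrier_vec n \<Longrightarrow> scalar_prod u v = scalar_prod u w"
  shows "v = w"
proof -
  have "scalar_prod (v - w) (v - w) = scalar_prod (v - w) v - scalar_prod (v - w) w"
    using v w by (simp add: scalar_prod_minus_distrib[of _ n])
  also have "\<dots> = 0" using eq[of "v - w"] v w by simp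
  finally have "v - w = 0\<^sub>v n" using v w by (subst (asm) scalar_prod_self_eq_0_iff) auto
  then have "vec_index v i = vec_index w i" if "i < n" for i
    using v w that by (metis (no_types) carrier_vecD diff_eq_eq add_0 index_minus_vec(1) index_zero_vec(1))
  then show ?thesis using v w by auto
qed

lemma symmetric_scalar_prod:
  fixes K :: "real mat"
  assumes "K \<in> carrier_mat n n" "transpose_mat K = K" "x \<in> carrier_vec n" "y \<in> carrier_vec n"
  shows "scalar_prod x (K *\<^sub>v y) = scalar_prod y (K *\<^sub>v x)"
  using transpose_vec_mult_scalar[OF assms(1) assms(4) assms(3)] assms
  by (metis comm_scalar_prod mult_mat_vec_carrier)

text \<open>The degenerate case of the Cauchy-Schwarz inequality. It is confined to \<open>W\<close>
  because the form is indefinite on the whole space.\<close>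

lemma isotropic_of_nonneg_form:
  fixes K :: "real mat"
  assumes K: "K \<in> carrier_mat n n" "transpose_mat K = K"
    and WV: "W \<subseteq> carrier_vec n"
    and Wadd: "\<And>u v. u \<in> W \<Longrightarrow> v \<in> W \<Longrightarrow> u + v \<in> W"
    and Wsm: "\<And>c u. u \<in> W \<Longrightarrow> c \<cdot>\<^sub>v u \<in> W"
    and psd: "\<And>u. u \<in> W \<Longrightarrow> 0 \<le> scalar_prod u (K *\<^sub>v u)"
    and w: "w \<in> W" "scalar_prod w (K *\<^sub>v w) = 0" and u: "u \<in> W"
  shows "scalar_prod u (K *\<^sub>v w) = 0"
proof -
  define a b where "a = scalar_prod u (K *\<^sub>v w)" and "b = scalar_prod u (K *\<^sub>v u)"
  have uc: "u \<in> carrier_vec n" and wc: "w \<in> carrier_vec n" using u w WV by auto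
  have q: "0 \<le> 2 * t * a + t\<^sup>2 * b" for t
  proof -
    have "0 \<le> scalar_prod (w + t \<cdot>\<^sub>v u) (K *\<^sub>v (w + t \<cdot>\<^sub>v u))"
      by (intro psd Wadd Wsm u w)
    also have "\<dots> = scalar_prod w (K *\<^sub>v w) + t * scalar_prod w (K *\<^sub>v u) + t * a + t * t * b"
      using K uc wc
      by (simp add: a_def b_def mult_add_distrib_mat_vec[of _ n n] mult_mat_vec[of _ n n]
          add_scalar_prod_distrib[of _ n] scalar_prod_add_distrib[of _ n] algebra_simps)
    also have "scalar_prod w (K *\<^sub>v u) = a"
      unfolding a_def by (rule symmetric_scalar_prod[OF K wc uc])
    finally show ?thesis using w by (simp add: power2_eq_square algebra_simps)
  qed
  have "b \<ge> 0" using psd[OF u] b_def by simp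
  show ?thesis
  proof (cases "b = 0")
    \<comment> \<open>The quadratic is then linear in \<open>t\<close>, and the two signs of
      \<open>t\<close> force \<open>a = 0\<close>.\<close>
    case True
    with q[of 1] q[of "-1"] show ?thesis by (simp add: a_def)
  next
    case False
    \<comment> \<open>\<open>t = - a / b\<close> is the minimizer of the quadratic.\<close>
    have "2 * (- a / b) * a + (- a / b)\<^sup>2 * b = - (a\<^sup>2 / b)"
      using False by (simp add: field_simps power2_eq_square)
    with q[of "- a / b"] have "a\<^sup>2 / b \<le> 0" by simp
    with False \<open>b \<ge> 0\<close> have "a\<^sup>2 \<le> 0" by (simp add: divide_le_0_iff)
    then show ?thesis by (simp add: a_def)
  qed
qed

text \<open>Testing with \<open>p'\<close> in \<open>P\<close> annihilates the right-hand side
  because \<open>C\<close> vanishes on \<open>P\<close>, and the part of \<open>K\<close> on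
  \<open>P\<close> because \<open>P\<close> is isotropic. The resulting constraint on
  \<open>w\<close> removes the cross terms from the energy.\<close>

lemma saddle_point_energy:
  fixes K C :: "real mat"
  assumes K: "K \<in> carrier_mat n n" "transpose_mat K = K" and C: "C \<in> carrier_mat m n"
    and WV: "W \<subseteq> carrier_vec n" and PV: "P \<subseteq> carrier_vec n"
    and Piso: "\<And>p p'. p \<in> P \<Longrightarrow> p' \<in> P \<Longrightarrow> scalar_prod p (K *\<^sub>v p') = 0"
    and CP: "\<And>p. p \<in> P \<Longrightarrow> C *\<^sub>v p = 0\<^sub>v m"
    and x: "x \<in> carrier_vec m" and w: "w \<in> W" and p: "p \<in> P"
    and eq: "K *\<^sub>v (w + p) = transpose_mat C *\<^sub>v x"
  shows "scalar_prod x (C *\<^sub>v (w + p)) = scalar_prod w (K *\<^sub>v w)"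
    and "\<And>p'. p' \<in> P \<Longrightarrow> scalar_prod p' (K *\<^sub>v w) = 0"
proof -
  have wc: "w \<in> carrier_vec n" and pc: "p \<in> carrier_vec n" using w p WV PV by auto
  show *: "scalar_prod p' (K *\<^sub>v w) = 0" if p': "p' \<in> P" for p'
  proof -
    have p'c: "p' \<in> carrier_vec n" using p' PV by auto
    have "scalar_prod p' (K *\<^sub>v (w + p)) = scalar_prod (transpose_mat C *\<^sub>v x) p'"
      unfolding eq using C x p'c by (intro comm_scalar_prod[of _ n]) auto
    also have "\<dots> = scalar_prod x (C *\<^sub>v p')" by (rule transpose_vec_mult_scalar[OF C p'c x])
    also have "\<dots> = 0" using CP[OF p'] x by simp
    finally show ?thesis
      using K wc pc p'c Piso[OF p' p]
      by (simp add: mult_add_distrib_mat_vec[of _ n n] scalar_prod_add_distrib[of _ n])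
  qed
  have "scalar_prod x (C *\<^sub>v (w + p)) = scalar_prod (transpose_mat C *\<^sub>v x) (w + p)"
    using wc pc by (intro transpose_vec_mult_scalar[OF C _ x, symmetric]) auto
  also have "\<dots> = scalar_prod (w + p) (K *\<^sub>v (w + p))"
    unfolding eq[symmetric] using K wc pc by (intro comm_scalar_prod[of _ n]) auto
  also have "\<dots> = scalar_prod w (K *\<^sub>v w) + scalar_prod w (K *\<^sub>v p)"
    using K wc pc *[OF p] Piso[OF p p]
    by (simp add: mult_add_distrib_mat_vec[of _ n n] scalar_prod_add_distrib[of _ n]
        add_scalar_prod_distrib[of _ n])
  also have "scalar_prod w (K *\<^sub>v p) = 0"
    using symmetric_scalar_prod[OF K wc pc] *[OF p] by simp
  finally show "scalar_prod x (C *\<^sub>v (w + p)) = scalar_prod w (K *\<^sub>v w)" by simp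
qed

lemma mult_mat_zero_vec:
  "A \<in> carrier_mat nr nc \<Longrightarrow> A *\<^sub>v 0\<^sub>v nc = (0\<^sub>v nr :: 'a :: semiring_0 vec)"
  by (intro eq_vecI) auto

section \<open>Algebraic multiplicity of the eigenvalue 0 of a symmetric matrix\<close>

lemma index_mult_mat_sum:
  assumes "A \<in> carrier_mat nr n" "B \<in> carrier_mat n nc" "i < nr" "j < nc"
  shows "(A * B) $$ (i, j) = (\<Sum>l\<in>{0..<n}. A $$ (i, l) * B $$ (l, j))"
  using assms by (simp add: scalar_prod_def)

text \<open>Deflation: multiplying \<open>x I - A\<close> by the identity matrix whose column \<open>k\<close> is replaced by
  \<open>v\<close> turns that column into \<open>x v\<close>. The factor \<open>x\<close> is split off, and the rest is regular at 0.\<close>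

lemma order_char_poly_simple_kernel:
  fixes A :: "real mat"
  assumes A: "A \<in> carrier_mat n n" "transpose_mat A = A"
    and v: "v \<in> carrier_vec n" "v \<noteq> 0\<^sub>v n"
    and ker: "mat_kernel A = {c \<cdot>\<^sub>v v | c. True}"
  shows "Polynomial.order 0 (char_poly A) = 1"
proof -
  obtain k where k: "k < n" "vec_index v k \<noteq> 0"
    using v by (metis carrier_vecD eq_vecI index_zero_vec(1) index_zero_vec(2))
  have kerD: "A *\<^sub>v u = 0\<^sub>v n \<longleftrightarrow> (\<exists>c. u = c \<cdot>\<^sub>v v)" if "u \<in> carrier_vec n" for u
    using ker that A unfolding mat_kernel_def by (auto simp: set_eq_iff)
  have Av: "A *\<^sub>v v = 0\<^sub>v n"
    using kerD[OF v(1)] by (metis one_smult_vec)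
  define P where "P = Matrix.mat n n (\<lambda>(i, j). if j = k then vec_index v i else if i = j then 1 else (0::real))"
  have P: "P \<in> carrier_mat n n" by (simp add: P_def)
  \<comment> \<open>Entry \<open>k\<close> of \<open>v\<close> is nonzero, so row \<open>k\<close>
    of \<open>P u = 0\<close> kills entry \<open>k\<close> of \<open>u\<close>, and the other rows
    then kill the rest.\<close>
  have detP: "Determinant.det P \<noteq> 0"
  proof
    assume "Determinant.det P = 0"
    then obtain u where u: "u \<in> carrier_vec n" "u \<noteq> 0\<^sub>v n" "P *\<^sub>v u = 0\<^sub>v n"
      using det_0_iff_vec_prod_zero[OF P] by blast
    have row: "(\<Sum>j\<in>{0..<n}. (if j = k then vec_index v i else if i = j then 1 else 0) * vec_index u j) = 0"
      if "i < n" for i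
      using arg_cong[OF u(3), of "\<lambda>x. vec_index x i"] that u(1) P
      by (simp add: scalar_prod_def P_def)
    have "vec_index u k = 0"
      using row[OF k(1)] k
      by (simp add: sum.remove[of _ k] if_distrib[of "\<lambda>x. x * _"] cong: if_cong) 
    moreover have "vec_index u i = 0" if "i < n" "i \<noteq> k" for i
      using row[OF that(1)] that k \<open>vec_index u k = 0\<close>
      by (simp add: sum.remove[of _ k] if_distrib[of "\<lambda>x. x * _"] cong: if_cong) 
    ultimately have "u = 0\<^sub>v n" using u(1) by (intro eq_vecI) auto
    with u show False by simp
  qed
  define X where "X = char_poly_matrix A"
  have X: "X \<in> carrier_mat n n" using A by (simp add: X_def)
  define M where "M = Matrix.mat n n (\<lambda>(i, j). if j = k then [:vec_index v i:] else X $$ (i, j))"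
  have M: "M \<in> carrier_mat n n" by (simp add: M_def)
  define Pp where "Pp = map_mat (\<lambda>a. [:a:]) P"
  have Pp: "Pp \<in> carrier_mat n n" using P by (simp add: Pp_def)
  \<comment> \<open>As a right factor, \<open>multrow_mat\<close> scales column \<open>k\<close> by
    the indeterminate \<open>[:0, 1:]\<close>. Column \<open>k\<close> of the product on the left
    has this factor because \<open>A\<close> annihilates \<open>v\<close>.\<close>
  have XP: "X * Pp = M * multrow_mat n k [:0, 1:]"
  proof (rule eq_matI)
    fix i j assume "i < dim_row (M * multrow_mat n k [:0, 1:])" "j < dim_col (M * multrow_mat n k [:0, 1:])"
    then have ij: "i < n" "j < n" using M by auto
    have L: "(X * Pp) $$ (i, j) = (\<Sum>l\<in>{0..<n}. X $$ (i, l) * [:P $$ (l, j):])"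
      using ij X P by (simp add: scalar_prod_def Pp_def)
    have R: "(M * multrow_mat n k [:0, 1:]) $$ (i, j) =
        (\<Sum>l\<in>{0..<n}. M $$ (i, l) * (if l = k \<and> k = j then [:0, 1:] else if l = j then 1 else 0))"
    proof -
      have ent: "multrow_mat n k [:0, 1:] $$ (l, j) = (if l = k \<and> k = j then [:0, 1:] else if l = j then 1 else (0::real poly))"
        if "l < n" for l
        using that ij(2) unfolding multrow_mat_def by auto
      have prod: "(M * multrow_mat n k [:0, 1:]) $$ (i, j)
          = (\<Sum>l\<in>{0..<n}. M $$ (i, l) * multrow_mat n k [:0, 1:] $$ (l, j))"
        by (rule index_mult_mat_sum[OF M multrow_mat_carrier ij])
      show ?thesis
        unfolding prod by (intro sum.cong refl) (simp only: ent atLeastLessThan_iff)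
    qed
    show "(X * Pp) $$ (i, j) = (M * multrow_mat n k [:0, 1:]) $$ (i, j)"
    proof (cases "j = k")
      case True
      have "(X * Pp) $$ (i, j) = (\<Sum>l\<in>{0..<n}. (if l = i then [:0, vec_index v i:] else 0) - [:A $$ (i, l) * vec_index v l:])"
        unfolding L using ij A True
        by (intro sum.cong) (auto simp: X_def char_poly_matrix_def P_def)
      also have "\<dots> = [:0, vec_index v i:] - (\<Sum>l\<in>{0..<n}. [:A $$ (i, l) * vec_index v l:])"
        using ij by (simp add: sum_subtractf)
      also have "(\<Sum>l\<in>{0..<n}. [:A $$ (i, l) * vec_index v l:]) = [:\<Sum>l\<in>{0..<n}. A $$ (i, l) * vec_index v l:]"
        by (induction n) (auto)
      also have "(\<Sum>l\<in>{0..<n}. A $$ (i, l) * vec_index v l) = vec_index (A *\<^sub>v v) i"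
        using ij A v by (simp add: scalar_prod_def)
      finally have "(X * Pp) $$ (i, j) = [:0, vec_index v i:]" using Av ij by simp
      moreover have "(M * multrow_mat n k [:0, 1:]) $$ (i, j) = [:0, vec_index v i:]"
        unfolding R using ij k True by (simp add: M_def if_distrib cong: if_cong)
      ultimately show ?thesis by simp
    next
      case False
      have "(X * Pp) $$ (i, j) = (\<Sum>l\<in>{0..<n}. if l = j then X $$ (i, l) else 0)"
        unfolding L using ij False by (intro sum.cong) (auto simp: P_def)
      moreover have "(M * multrow_mat n k [:0, 1:]) $$ (i, j) = (\<Sum>l\<in>{0..<n}. if l = j then X $$ (i, l) else 0)"
        unfolding R using ij False by (intro sum.cong) (auto simp: M_def)
      ultimately show ?thesis by simp
    qed
  qed (use X Pp M in auto)
  interpret cst: comm_ring_hom "\<lambda>a::real. [:a:]" by unfold_locales (auto simp: one_pCons)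
  have eq: "char_poly A * [:Determinant.det P:] = Determinant.det M * [:0, 1:]"
  proof -
    have "Determinant.det (X * Pp) = char_poly A * [:Determinant.det P:]"
      using det_mult[OF X Pp] cst.hom_det[of P] by (simp add: X_def char_poly_def Pp_def)
    moreover have "Determinant.det (M * multrow_mat n k [:0, 1:]) = Determinant.det M * [:0, 1:]"
      by (simp only: det_mult[OF M multrow_mat_carrier] det_multrow_mat[OF k(1)])
    ultimately show ?thesis using XP by simp
  qed
  \<comment> \<open>The value of \<open>M\<close> at 0: column \<open>k\<close> is \<open>v\<close>,
    the other columns are those of \<open>- A\<close>.\<close>
  define M0 where "M0 = map_mat (\<lambda>p. poly p 0) M"
  have M0: "M0 \<in> carrier_mat n n" using M by (simp add: M0_def)
  have ev: "comm_ring_hom (\<lambda>p::real poly. poly p 0)" by unfold_locales auto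
  have "Determinant.det M0 \<noteq> 0"
  proof
    assume "Determinant.det M0 = 0"
    then obtain u where u: "u \<in> carrier_vec n" "u \<noteq> 0\<^sub>v n" "M0 *\<^sub>v u = 0\<^sub>v n"
      using det_0_iff_vec_prod_zero[OF M0] by blast
    define u' where "u' = Matrix.vec n (\<lambda>j. if j = k then 0 else vec_index u j)"
    have u': "u' \<in> carrier_vec n" by (simp add: u'_def)
    have M0u: "M0 *\<^sub>v u = vec_index u k \<cdot>\<^sub>v v - A *\<^sub>v u'"
    proof (rule eq_vecI)
      fix i assume "i < dim_vec (vec_index u k \<cdot>\<^sub>v v - A *\<^sub>v u')"
      then have i: "i < n" using A by simp
      have "vec_index (M0 *\<^sub>v u) i = (\<Sum>l\<in>{0..<n}. M0 $$ (i, l) * vec_index u l)"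
        using i M0 u(1) by (simp add: scalar_prod_def)
      also have "\<dots> = (\<Sum>l\<in>{0..<n}. (if l = k then vec_index u k * vec_index v i else 0) - A $$ (i, l) * vec_index u' l)"
        using i A by (intro sum.cong) (auto simp: M0_def M_def X_def char_poly_matrix_def u'_def)
      also have "\<dots> = vec_index u k * vec_index v i - (\<Sum>l\<in>{0..<n}. A $$ (i, l) * vec_index u' l)"
        using k by (simp add: sum_subtractf)
      also have "\<dots> = vec_index (vec_index u k \<cdot>\<^sub>v v - A *\<^sub>v u') i"
        using i A v u' by (simp add: scalar_prod_def)
      finally show "vec_index (M0 *\<^sub>v u) i = vec_index (vec_index u k \<cdot>\<^sub>v v - A *\<^sub>v u') i" .
    qed (use M0 A in auto)
    \<comment> \<open>A kernel vector of a symmetric matrix is orthogonal to its range, so pairing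
      \<open>M0 u = 0\<close> with \<open>v\<close> isolates entry \<open>k\<close> of
      \<open>u\<close>.\<close>
    have "scalar_prod v (A *\<^sub>v u') = 0"
      using symmetric_scalar_prod[OF A v(1) u'] Av u' by simp
    then have "vec_index u k * scalar_prod v v = scalar_prod v (M0 *\<^sub>v u)"
      unfolding M0u using A v u' by (simp add: scalar_prod_minus_distrib[of _ n])
    then have "vec_index u k * scalar_prod v v = 0" using u(3) v by simp
    then have uk: "vec_index u k = 0" using v scalar_prod_self_eq_0_iff by auto
    have "A *\<^sub>v u' = 0\<^sub>v n"
    proof (rule eq_vecI)
      fix i assume i: "i < dim_vec (0\<^sub>v n :: real vec)"
      have "vec_index (vec_index u k \<cdot>\<^sub>v v - A *\<^sub>v u') i = vec_index (0\<^sub>v n) i"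
        by (simp only: M0u[symmetric] u(3))
      then show "vec_index (A *\<^sub>v u') i = vec_index (0\<^sub>v n) i"
        using i uk carrier_matD[OF A(1)] carrier_vecD[OF v(1)] by simp
    qed (use A in auto)
    \<comment> \<open>As a kernel vector, \<open>u'\<close> is a multiple of \<open>v\<close>; its
      entry \<open>k\<close> is zero while that of \<open>v\<close> is not.\<close>
    then obtain c where c: "u' = c \<cdot>\<^sub>v v" using kerD[OF u'] by blast
    have "vec_index u' k = 0" using k by (simp add: u'_def)
    then have "c = 0" using c k v by simp
    then have "vec_index u' i = 0" if "i < n" for i using c v that by simp
    then have "vec_index u i = 0" if "i < n" for i
      using that uk by (cases "i = k") (force simp: u'_def)+
    then have "u = 0\<^sub>v n" using u(1) by (intro eq_vecI) auto
    with u show False by simp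
  qed
  then have detM: "poly (Determinant.det M) 0 \<noteq> 0"
    using comm_ring_hom.hom_det[OF ev, of M] by (simp add: M0_def)
  then have M_nz: "Determinant.det M \<noteq> 0" by auto
  have A_nz: "char_poly A \<noteq> 0" using eq M_nz by auto
  have "Polynomial.order 0 (char_poly A) = Polynomial.order 0 (char_poly A * [:Determinant.det P:])"
    using A_nz detP by (subst order_mult) (auto simp: order_0I)
  also have "\<dots> = 1"
    unfolding eq using M_nz detM order_power_n_n[of "0::real" 1]
    by (subst order_mult) (auto simp: order_0I)
  finally show ?thesis .
qed

text \<open>Abstract form of the theorem, with velocities \<open>W\<close> and interior pressures
  \<open>P\<close>. The concrete problem enters through \<open>N\<close>, which supplies a kernel
  vector, and \<open>ker\<close>, which concerns only solutions without velocity part; this suffices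
  because zero energy makes the velocity part vanish.\<close>

lemma saddle_point_schur_complement:
  fixes K C Ki :: "real mat"
  assumes K: "K \<in> carrier_mat n n" "transpose_mat K = K" and C: "C \<in> carrier_mat m n"
    and Ki: "Ki \<in> carrier_mat n n" "K * Ki = 1\<^sub>m n" "Ki * K = 1\<^sub>m n"
    and WV: "W \<subseteq> carrier_vec n" and PV: "P \<subseteq> carrier_vec n"
    and split: "\<And>y. y \<in> carrier_vec n \<Longrightarrow> \<exists>w\<in>W. \<exists>p\<in>P. y = w + p"
    and Wadd: "\<And>u v. u \<in> W \<Longrightarrow> v \<in> W \<Longrightarrow> u + v \<in> W"
    and Wsm: "\<And>c u. u \<in> W \<Longrightarrow> c \<cdot>\<^sub>v u \<in> W"
    and psd: "\<And>u. u \<in> W \<Longrightarrow> 0 \<le> scalar_prod u (K *\<^sub>v u)"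
    and Piso: "\<And>p p'. p \<in> P \<Longrightarrow> p' \<in> P \<Longrightarrow> scalar_prod p (K *\<^sub>v p') = 0"
    and CP: "\<And>p. p \<in> P \<Longrightarrow> C *\<^sub>v p = 0\<^sub>v m"
    and N: "N \<in> carrier_vec m" "N \<noteq> 0\<^sub>v m" "pN \<in> P" "K *\<^sub>v pN = transpose_mat C *\<^sub>v N"
    and ker: "\<And>x p. x \<in> carrier_vec m \<Longrightarrow> p \<in> P \<Longrightarrow> K *\<^sub>v p = transpose_mat C *\<^sub>v x \<Longrightarrow> \<exists>c. x = c \<cdot>\<^sub>v N"
  defines "G \<equiv> C * Ki * transpose_mat C"
  shows "G \<in> carrier_mat m m" "transpose_mat G = G"
    "\<forall>x\<in>carrier_vec m. 0 \<le> scalar_prod x (G *\<^sub>v x)"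
    "eigenvalue G 0" "Polynomial.order 0 (char_poly G) = 1"
    "\<forall>ev. eigenvalue G ev \<and> ev \<noteq> 0 \<longrightarrow> ev > 0"
    "mat_kernel G = {c \<cdot>\<^sub>v N | c. True}"
proof -
  have Ct: "transpose_mat C \<in> carrier_mat n m" using C by simp
  have Kinj: "y = z" if "y \<in> carrier_vec n" "z \<in> carrier_vec n" "K *\<^sub>v y = K *\<^sub>v z" for y z
  proof -
    have "(Ki * K) *\<^sub>v y = (Ki * K) *\<^sub>v z"
      unfolding assoc_mult_mat_vec[OF Ki(1) K(1) that(1)] assoc_mult_mat_vec[OF Ki(1) K(1) that(2)] that(3) ..
    then show ?thesis using that Ki(3) by simp
  qed
  have Kit: "transpose_mat Ki = Ki"
  proof -
    have "transpose_mat Ki * K = 1\<^sub>m n"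
      using transpose_mult[OF K(1) Ki(1)] K(2) Ki(2) by simp
    then have "transpose_mat Ki * K * Ki = Ki" using Ki(1) by simp
    moreover have "transpose_mat Ki * K * Ki = transpose_mat Ki * (K * Ki)"
      using K(1) Ki(1) by (intro assoc_mult_mat[of _ n n _ n _ n]) auto
    ultimately show ?thesis using Ki(1,2) by simp
  qed
  show G: "G \<in> carrier_mat m m" unfolding G_def using C Ki by auto
  show Gt: "transpose_mat G = G"
  proof -
    have "transpose_mat G = C * (Ki * transpose_mat C)"
      unfolding G_def transpose_mult[OF mult_carrier_mat[OF C Ki(1)] Ct] transpose_mult[OF C Ki(1)] Kit
      by simp
    also have "\<dots> = G" unfolding G_def using C Ki by (intro assoc_mult_mat[symmetric, of _ m n _ n _ m]) auto
    finally show ?thesis .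
  qed
  have Gx: "G *\<^sub>v x = C *\<^sub>v (Ki *\<^sub>v (transpose_mat C *\<^sub>v x))" if "x \<in> carrier_vec m" for x
  proof -
    have "G *\<^sub>v x = (C * Ki) *\<^sub>v (transpose_mat C *\<^sub>v x)"
      unfolding G_def by (rule assoc_mult_mat_vec[OF mult_carrier_mat[OF C Ki(1)] Ct that])
    also have "\<dots> = C *\<^sub>v (Ki *\<^sub>v (transpose_mat C *\<^sub>v x))"
      using Ct that by (intro assoc_mult_mat_vec[OF C Ki(1)]) auto
    finally show ?thesis .
  qed
  have KKi: "K *\<^sub>v (Ki *\<^sub>v (transpose_mat C *\<^sub>v x)) = transpose_mat C *\<^sub>v x" if "x \<in> carrier_vec m" for x
    using assoc_mult_mat_vec[OF K(1) Ki(1), of "transpose_mat C *\<^sub>v x"] Ki(2) Ct that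
    by (metis mult_mat_vec_carrier one_mult_mat_vec)
  have Gy: "G *\<^sub>v x = C *\<^sub>v y" if "x \<in> carrier_vec m" "y \<in> carrier_vec n" "K *\<^sub>v y = transpose_mat C *\<^sub>v x" for x y
  proof -
    have "Ki *\<^sub>v (transpose_mat C *\<^sub>v x) = y"
      using mult_mat_vec_carrier[OF Ki(1) mult_mat_vec_carrier[OF Ct that(1)]] that(2)
      by (rule Kinj) (simp only: KKi[OF that(1)] that(3))
    then show ?thesis using Gx[OF that(1)] by simp
  qed
  have energy: "\<exists>w\<in>W. \<exists>p\<in>P. scalar_prod x (G *\<^sub>v x) = scalar_prod w (K *\<^sub>v w) \<and>
      K *\<^sub>v (w + p) = transpose_mat C *\<^sub>v x \<and> (\<forall>p'\<in>P. scalar_prod p' (K *\<^sub>v w) = 0)"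
    if x: "x \<in> carrier_vec m" for x
  proof -
    obtain w p where wp: "w \<in> W" "p \<in> P" and y: "Ki *\<^sub>v (transpose_mat C *\<^sub>v x) = w + p"
      using split[OF mult_mat_vec_carrier[OF Ki(1) mult_mat_vec_carrier[OF Ct x]]] by blast
    have eq: "K *\<^sub>v (w + p) = transpose_mat C *\<^sub>v x" using KKi[OF x] unfolding y .
    show ?thesis
      using saddle_point_energy[OF K C WV PV Piso CP x wp eq] wp eq unfolding Gx[OF x] y by blast
  qed
  show psdG: "\<forall>x\<in>carrier_vec m. 0 \<le> scalar_prod x (G *\<^sub>v x)"
    using energy psd by metis
  \<comment> \<open>\<open>pN\<close> solves the system with data \<open>N\<close>, so
    \<open>G N\<close> equals \<open>C pN\<close>, and \<open>C\<close> vanishes on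
    \<open>P\<close>.\<close>
  have GN: "G *\<^sub>v N = 0\<^sub>v m"
    using Gy[OF N(1) _ N(4)] CP[OF N(3)] N(3) PV by auto
  have kerG: "\<exists>c. x = c \<cdot>\<^sub>v N" if x: "x \<in> carrier_vec m" "G *\<^sub>v x = 0\<^sub>v m" for x
  proof -
    obtain w p where wp: "w \<in> W" "p \<in> P"
      and e: "scalar_prod x (G *\<^sub>v x) = scalar_prod w (K *\<^sub>v w)"
      and eq: "K *\<^sub>v (w + p) = transpose_mat C *\<^sub>v x"
      and orth: "\<forall>p'\<in>P. scalar_prod p' (K *\<^sub>v w) = 0"
      using energy[OF x(1)] by blast
    have wc: "w \<in> carrier_vec n" and pc: "p \<in> carrier_vec n" using wp WV PV by auto
    have w0: "scalar_prod w (K *\<^sub>v w) = 0" using e x by simp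
    \<comment> \<open>\<open>K w\<close> is orthogonal to \<open>W\<close> by the Cauchy-Schwarz
      argument and to \<open>P\<close> by the constraint, and sums of the two fill the
      space.\<close>
    have "K *\<^sub>v w = 0\<^sub>v n"
    proof (rule vec_eqI_scalar_prod)
      fix u :: "real vec" assume "u \<in> carrier_vec n"
      then obtain w' p' where wp': "w' \<in> W" "p' \<in> P" "u = w' + p'" using split by blast
      have c: "w' \<in> carrier_vec n" "p' \<in> carrier_vec n" using wp' WV PV by auto
      have "scalar_prod w' (K *\<^sub>v w) = 0"
        by (rule isotropic_of_nonneg_form[OF K WV Wadd Wsm psd wp(1) w0 wp'(1)])
      then show "scalar_prod u (K *\<^sub>v w) = scalar_prod u (0\<^sub>v n)"
        using orth wp' c K wc by (simp add: add_scalar_prod_distrib[of _ n])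
    qed (use K wc in auto)
    then have "w = 0\<^sub>v n" using Kinj[OF wc zero_carrier_vec] mult_mat_zero_vec[OF K(1)] by simp
    then have "K *\<^sub>v p = transpose_mat C *\<^sub>v x" using eq pc by simp
    then show ?thesis using ker[OF x(1) wp(2)] by blast
  qed
  show kernel: "mat_kernel G = {c \<cdot>\<^sub>v N | c. True}"
  proof -
    have "G *\<^sub>v (c \<cdot>\<^sub>v N) = 0\<^sub>v m" for c
      unfolding mult_mat_vec[OF G N(1)] GN by (intro eq_vecI) auto
    then show ?thesis unfolding mat_kernel_def using G N kerG by auto
  qed
  show "eigenvalue G 0"
    unfolding eigenvalue_def eigenvector_def using carrier_matD[OF G] N GN
    by (intro exI[of _ N]) (auto intro!: eq_vecI)
  show "Polynomial.order 0 (char_poly G) = 1"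
    by (rule order_char_poly_simple_kernel[OF G Gt N(1,2) kernel])
  show "\<forall>ev. eigenvalue G ev \<and> ev \<noteq> 0 \<longrightarrow> ev > 0"
  proof (intro allI impI)
    fix ev :: real assume ev: "eigenvalue G ev \<and> ev \<noteq> 0"
    then obtain u where u: "u \<in> carrier_vec m" "u \<noteq> 0\<^sub>v m" "G *\<^sub>v u = ev \<cdot>\<^sub>v u"
      using G unfolding eigenvalue_def eigenvector_def by auto
    have "0 \<le> ev * scalar_prod u u" using psdG u by (metis scalar_prod_smult_right carrier_vecD)
    moreover have "scalar_prod u u > 0"
    proof -
      have "scalar_prod u u \<ge> 0" by (simp add: scalar_prod_def sum_nonneg)
      then show ?thesis using u scalar_prod_self_eq_0_iff[OF u(1)] by linarith
    qed
    ultimately show "ev > 0" using ev by (simp add: zero_le_mult_iff)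
  qed
qed

section \<open>Piecewise linear functions and their hat functions\<close>

text \<open>The elementwise clause of \<open>P1\<close>, isolated because it is needed on triangles,
  on their pieces, on common faces and on the whole plane.\<close>

definition affine_on :: "point set \<Rightarrow> (point \<Rightarrow> 'b::real_normed_vector) \<Rightarrow> bool" where
  "affine_on S u \<longleftrightarrow> (\<exists>L c. linear L \<and> (\<forall>x\<in>S. u x = c + L x))"

lemma affine_on_subset: "affine_on T u \<Longrightarrow> S \<subseteq> T \<Longrightarrow> affine_on S u"
  unfolding affine_on_def by blast

lemma affine_on_cong: "affine_on S u \<Longrightarrow> (\<And>x. x \<in> S \<Longrightarrow> v x = u x) \<Longrightarrow> affine_on S v"
  unfolding affine_on_def by (metis (no_types))

lemma affine_on_const [simp]: "affine_on S (\<lambda>_. c)"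
  unfolding affine_on_def
  by (intro exI[of _ "\<lambda>_. 0"] exI[of _ c]) (simp add: linear_zero)

lemma affine_on_add:
  assumes "affine_on S u" "affine_on S v"
  shows "affine_on S (\<lambda>x. u x + v x)"
proof -
  obtain L c M d where "linear L" "linear M" "\<forall>x\<in>S. u x = c + L x" "\<forall>x\<in>S. v x = d + M x"
    using assms unfolding affine_on_def by blast
  then show ?thesis unfolding affine_on_def
    by (intro exI[of _ "\<lambda>x. L x + M x"] exI[of _ "c + d"])
      (simp add: linear_compose_add)
qed

lemma affine_on_linear_image:
  assumes "affine_on S u" "linear f"
  shows "affine_on S (\<lambda>x. f (u x))"
proof -
  obtain L c where "linear L" "\<forall>x\<in>S. u x = c + L x"
    using assms unfolding affine_on_def by blast
  then show ?thesis unfolding affine_on_def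
    using linear_compose[of L f] assms(2)
    by (intro exI[of _ "f \<circ> L"] exI[of _ "f c"]) (simp add: linear_add)
qed

lemma affine_on_scaleR: "affine_on S u \<Longrightarrow> affine_on S (\<lambda>x. r *\<^sub>R u x)"
  by (rule affine_on_linear_image[where f = "\<lambda>y. r *\<^sub>R y"]) (auto intro!: linear_compose_scale_right linear_ident)

lemma affine_on_cmult: "affine_on S u \<Longrightarrow> affine_on S (\<lambda>x. r * u x :: real)"
  using affine_on_scaleR[of S u r] by simp

lemma affine_on_diff: "affine_on S u \<Longrightarrow> affine_on S v \<Longrightarrow> affine_on S (\<lambda>x. u x - v x)"
  using affine_on_add[of S u "\<lambda>x. (-1) *\<^sub>R v x"] affine_on_scaleR[of S v "-1"] by simp

lemma affine_on_sum:
  "(\<And>k. k \<in> I \<Longrightarrow> affine_on S (u k)) \<Longrightarrow> affine_on S (\<lambda>x. \<Sum>k\<in>I. u k x)"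
  by (induction I rule: infinite_finite_induct) (auto intro!: affine_on_add)

lemma affine_on_convex_comb:
  assumes "affine_on S u" "x \<in> S" "y \<in> S" "s *\<^sub>R x + t *\<^sub>R y \<in> S" "s + t = 1"
  shows "u (s *\<^sub>R x + t *\<^sub>R y) = s *\<^sub>R u x + t *\<^sub>R u y"
proof -
  obtain L c where L: "linear L" and u: "\<forall>x\<in>S. u x = c + L x"
    using assms unfolding affine_on_def by blast
  have "s *\<^sub>R c + t *\<^sub>R c = c" using assms(5) by (simp flip: scaleR_left_distrib)
  then show ?thesis using assms u
    by (simp add: linear_add[OF L] linear_scale[OF L] scaleR_right_distrib)
qed

lemma affine_on_midpoint:
  assumes "affine_on (convex hull K) u" "a \<in> K" "b \<in> K"
  shows "u (midpoint a b) = (1 / 2) *\<^sub>R (u a + u b)"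
proof -
  have "(1 / 2) *\<^sub>R a + (1 / 2) *\<^sub>R b \<in> convex hull K"
    using assms by (intro convexD[OF convex_convex_hull]) (auto intro: hull_inc)
  then have "u ((1 / 2) *\<^sub>R a + (1 / 2) *\<^sub>R b) = (1 / 2) *\<^sub>R u a + (1 / 2) *\<^sub>R u b"
    using assms by (intro affine_on_convex_comb[of "convex hull K"]) (auto intro: hull_inc)
  then show ?thesis by (simp add: midpoint_def scaleR_right_distrib)
qed

text \<open>The points of agreement form a convex set that contains the vertices.\<close>

lemma affine_on_eq:
  assumes "affine_on (convex hull K) u" "affine_on (convex hull K) v"
    and "\<And>x. x \<in> K \<Longrightarrow> u x = v x" and "x \<in> convex hull K"
  shows "u x = v x"
proof -
  let ?T = "{x \<in> convex hull K. u x = v x}"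
  have "convex ?T"
  proof (rule convexI)
    fix x y and s t :: real assume xy: "x \<in> ?T" "y \<in> ?T" "0 \<le> s" "0 \<le> t" "s + t = 1"
    then have "s *\<^sub>R x + t *\<^sub>R y \<in> convex hull K" by (intro convexD[OF convex_convex_hull]) auto
    then show "s *\<^sub>R x + t *\<^sub>R y \<in> ?T"
      using xy affine_on_convex_comb[OF assms(1)] affine_on_convex_comb[OF assms(2)] by simp
  qed
  then have "convex hull K \<subseteq> ?T" using assms(3) by (intro hull_minimal) (auto intro: hull_inc)
  then show ?thesis using assms(4) by auto
qed

lemma affine_on_nonneg:
  fixes u :: "point \<Rightarrow> real"
  assumes "affine_on (convex hull K) u" and "\<And>x. x \<in> K \<Longrightarrow> 0 \<le> u x" and "x \<in> convex hull K"
  shows "0 \<le> u x"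
proof -
  let ?T = "{x \<in> convex hull K. 0 \<le> u x}"
  have "convex ?T"
  proof (rule convexI)
    fix x y and s t :: real assume xy: "x \<in> ?T" "y \<in> ?T" "0 \<le> s" "0 \<le> t" "s + t = 1"
    then have "s *\<^sub>R x + t *\<^sub>R y \<in> convex hull K" by (intro convexD[OF convex_convex_hull]) auto
    then show "s *\<^sub>R x + t *\<^sub>R y \<in> ?T"
      using xy affine_on_convex_comb[OF assms(1)] by simp
  qed
  then have "convex hull K \<subseteq> ?T" using assms(2) by (intro hull_minimal) (auto intro: hull_inc)
  then show ?thesis using assms(3) by auto
qed

lemma affine_on_le:
  fixes u v :: "point \<Rightarrow> real"
  assumes "affine_on (convex hull K) u" "affine_on (convex hull K) v"
    and "\<And>x. x \<in> K \<Longrightarrow> u x \<le> v x" and "x \<in> convex hull K"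
  shows "u x \<le> v x"
  using affine_on_nonneg[OF affine_on_diff[OF assms(2,1)] _ assms(4)] assms(3) by simp

lemma continuous_on_affine_on: "affine_on S u \<Longrightarrow> continuous_on S u"
proof -
  assume "affine_on S u"
  then obtain L c where L: "linear L" and u: "\<forall>x\<in>S. u x = c + L x"
    unfolding affine_on_def by blast
  have "continuous_on S (\<lambda>x. c + L x)"
    using linear_continuous_on_compose[OF continuous_on_id L] by (intro continuous_intros) simp
  then show ?thesis using u by (simp cong: continuous_on_cong)
qed

text \<open>Moving one vertex to the origin turns affine into linear independence, and linear maps
  extend from independent sets.\<close>

lemma affine_interpolant:
  fixes g :: "point \<Rightarrow> real"
  assumes "\<not> affine_dependent K"
  shows "\<exists>f. affine_on UNIV f \<and> (\<forall>y\<in>K. f y = g y)"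
proof (cases "K = {}")
  case True
  then show ?thesis by (intro exI[of _ "\<lambda>_. 0"]) auto
next
  case False
  then obtain x where x: "x \<in> K" by blast
  let ?S = "(\<lambda>y. - x + y) ` (K - {x})"
  have "independent ?S" using assms affine_dependent_iff_dependent2[OF x] by simp
  from linear_independent_extend[OF this, of "\<lambda>z. g (x + z) - g x"]
  obtain L :: "point \<Rightarrow> real" where L: "linear L" "\<forall>z\<in>?S. L z = g (x + z) - g x" by blast
  have "g x - L x + L y = g y" if "y \<in> K" for y
  proof (cases "y = x")
    case False
    then have "L (- x + y) = g y - g x" using L(2) that by force
    moreover have "L (- x + y) = L y - L x" using linear_add[OF L(1), of "-x" y] linear_neg[OF L(1), of x] by simp
    ultimately show ?thesis by simp
  qed simp
  then show ?thesis using L(1)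
    by (intro exI[of _ "\<lambda>y. g x - L x + L y"]) (auto simp: affine_on_def)
qed

section \<open>Nodal interpolation and coarse hat functions\<close>

lemma P1_iff:
  "u \<in> P1 M \<longleftrightarrow> continuous_on (region M) u \<and> (\<forall>K\<in>M. affine_on (convex hull K) u) \<and>
     (\<forall>x. x \<notin> region M \<longrightarrow> u x = 0)"
  by (simp add: P1_def affine_on_def)

lemma P1_affine_on: "u \<in> P1 M \<Longrightarrow> K \<in> M \<Longrightarrow> affine_on (convex hull K) u"
  by (simp add: P1_iff)

lemma P1_zero: "(\<lambda>_. 0) \<in> P1 M"
  by (simp add: P1_iff)

lemma P1_scaleR: "u \<in> P1 M \<Longrightarrow> (\<lambda>x. c *\<^sub>R u x) \<in> P1 M"
  by (auto simp: P1_iff intro!: affine_on_scaleR continuous_intros)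

lemma P1_sum:
  "(\<And>k. k \<in> I \<Longrightarrow> u k \<in> P1 M) \<Longrightarrow> (\<lambda>x. \<Sum>k\<in>I. u k x) \<in> P1 M"
  by (auto simp: P1_iff intro!: affine_on_sum continuous_on_sum sum.neutral)

lemma P1_diff: "u \<in> P1 M \<Longrightarrow> v \<in> P1 M \<Longrightarrow> (\<lambda>x. u x - v x) \<in> P1 M"
  by (auto simp: P1_iff intro!: affine_on_diff continuous_intros)

lemma P1_scaleR_vector: "u \<in> P1 M \<Longrightarrow> (\<lambda>x. u x *\<^sub>R b) \<in> P1 M"
  unfolding P1_iff
  by (auto intro!: continuous_intros affine_on_linear_image[where f = "\<lambda>y. y *\<^sub>R b"] linear_scaleR_left)

lemma P1_unique:
  assumes "u \<in> P1 M" "v \<in> P1 M" "\<And>y. y \<in> nodes M \<Longrightarrow> u y = v y"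
  shows "u = v"
proof
  fix x show "u x = v x"
  proof (cases "x \<in> region M")
    case True
    then obtain K where K: "K \<in> M" "x \<in> convex hull K" unfolding region_def by blast
    show ?thesis
      using assms(3) K by (intro affine_on_eq[OF P1_affine_on[OF assms(1) K(1)] P1_affine_on[OF assms(2) K(1)] _ K(2)])
        (auto simp: nodes_def)
  qed (use assms in \<open>auto simp: P1_iff\<close>)
qed

text \<open>Since \<open>hat\<close> is a definite description, exhibiting one function with the
  right nodal values identifies it; uniqueness is automatic.\<close>

lemma hat_eqI:
  fixes u :: "point \<Rightarrow> real"
  assumes "u \<in> P1 M" "\<And>y. y \<in> nodes M \<Longrightarrow> u y = (if y = x then 1 else 0)"
  shows "hat M x = u"
  unfolding hat_def
proof (rule the_equality)
  fix v :: "point \<Rightarrow> real" assume v: "v \<in> P1 M \<and> (\<forall>y\<in>nodes M. v y = (if y = x then 1 else 0))"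
  show "v = u" by (rule P1_unique[of _ M]) (use v assms in auto)
qed (use assms in auto)

lemma finite_vertices: "triangulation M \<Longrightarrow> K \<in> M \<Longrightarrow> finite K"
  unfolding triangulation_def by (metis card.infinite zero_neq_numeral)

lemma P1_interpolant:
  fixes g :: "point \<Rightarrow> real"
  assumes M: "triangulation M"
  shows "\<exists>u\<in>P1 M. \<forall>y\<in>nodes M. u y = g y"
proof -
  have "\<forall>K\<in>M. \<exists>f. affine_on UNIV f \<and> (\<forall>y\<in>K. f y = g y)"
    using M affine_interpolant unfolding triangulation_def by blast
  then obtain f where f: "\<And>K. K \<in> M \<Longrightarrow> affine_on UNIV (f K)" "\<And>K y. K \<in> M \<Longrightarrow> y \<in> K \<Longrightarrow> f K y = g y"
    by metis
  \<comment> \<open>Conformity of the mesh enters here: a common point lies in the hull of the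
    common vertices, where both interpolants have the prescribed values.\<close>
  have agree: "f K x = f L x" if "K \<in> M" "L \<in> M" "x \<in> convex hull K" "x \<in> convex hull L" for K L x
  proof (rule affine_on_eq[of "K \<inter> L"])
    show "x \<in> convex hull (K \<inter> L)" using M that unfolding triangulation_def by blast
  qed (use f that in \<open>auto intro: affine_on_subset\<close>)
  define u where "u = (\<lambda>x. if x \<in> region M then f (SOME K. K \<in> M \<and> x \<in> convex hull K) x else 0)"
  have u: "u x = f K x" if "K \<in> M" "x \<in> convex hull K" for K x
  proof -
    let ?L = "SOME K. K \<in> M \<and> x \<in> convex hull K"
    have L: "?L \<in> M \<and> x \<in> convex hull ?L" by (rule someI_ex) (use that in blast)
    have "x \<in> region M" using that unfolding region_def by blast
    then have "u x = f ?L x" unfolding u_def by (rule if_P)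
    also have "\<dots> = f K x" by (rule agree) (use L that in blast)+
    finally show ?thesis .
  qed
  have "affine_on (convex hull K) u" if "K \<in> M" for K
    by (rule affine_on_cong[OF affine_on_subset[OF f(1)[OF that]]]) (use u that in auto)
  moreover have "continuous_on (region M) u"
    unfolding region_def
  proof (rule continuous_on_closed_Union)
    show "finite M" using M by (simp add: triangulation_def)
    show "closed (convex hull K)" if "K \<in> M" for K
      using finite_vertices[OF M that] by (intro compact_imp_closed finite_imp_compact_convex_hull)
    show "continuous_on (convex hull K) u" if "K \<in> M" for K
      using calculation[OF that] by (rule continuous_on_affine_on)
  qed
  ultimately have "u \<in> P1 M" unfolding P1_iff by (auto simp: u_def)
  moreover have "u y = g y" if "y \<in> nodes M" for y
  proof -
    obtain K where "K \<in> M" "y \<in> K" using \<open>y \<in> nodes M\<close> unfolding nodes_def by blast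
    then show ?thesis using u[of K y] f(2)[of K y] hull_inc[of y K convex] by simp
  qed
  ultimately show ?thesis by blast
qed

lemma
  assumes "triangulation M"
  shows hat_P1: "hat M x \<in> P1 M"
    and hat_node: "y \<in> nodes M \<Longrightarrow> hat M x y = (if y = x then 1 else 0)"
proof -
  obtain u where u: "u \<in> P1 M" "\<And>y. y \<in> nodes M \<Longrightarrow> u y = (if y = x then 1 else (0::real))"
    using P1_interpolant[OF assms, of "\<lambda>y. if y = x then 1 else 0"] by blast
  then have "hat M x = u" by (rule hat_eqI)
  with u show "hat M x \<in> P1 M" "y \<in> nodes M \<Longrightarrow> hat M x y = (if y = x then 1 else 0)" by auto
qed

section \<open>Midpoint refinement and its hat functions\<close>

lemma refine_cases:
  assumes "K \<in> refine M"
  obtains (corner) a b c where "{a, b, c} \<in> M" "card {a, b, c} = 3" "K = {a, midpoint a b, midpoint a c}"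
  | (middle) a b c where "{a, b, c} \<in> M" "card {a, b, c} = 3" "K = {midpoint a b, midpoint b c, midpoint a c}"
  using assms unfolding refine_def by blast

text \<open>Recording the parent as \<open>refine {L}\<close> later allows the small triangle to be
  located in the refined mesh of the subdomain containing \<open>L\<close>.\<close>

lemma refine_parent:
  assumes "K \<in> refine M"
  obtains L where "L \<in> M" "convex hull K \<subseteq> convex hull L" "K \<in> refine {L}"
proof -
  have sub: "convex hull K \<subseteq> convex hull {a, b, c}"
    if "K \<subseteq> {a, b, c, midpoint a b, midpoint b c, midpoint a c}" for a b c
  proof (rule hull_minimal)
    have "midpoint x y \<in> convex hull {a, b, c}" if "x \<in> {a, b, c}" "y \<in> {a, b, c}" for x y
      using that convexD[OF convex_convex_hull, of x "{a, b, c}" y "1/2" "1/2"]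
      by (auto simp: midpoint_def scaleR_right_distrib intro: hull_inc)
    then show "K \<subseteq> convex hull {a, b, c}" using that by (auto intro: hull_inc)
  qed (rule convex_convex_hull)
  from assms show ?thesis
  proof (cases rule: refine_cases)
    case (corner a b c)
    then have "K \<in> refine {{a, b, c}}" unfolding refine_def by blast
    with corner show ?thesis by (intro that[of "{a, b, c}"] sub) auto
  next
    case (middle a b c)
    then have "K \<in> refine {{a, b, c}}" unfolding refine_def by blast
    with middle show ?thesis by (intro that[of "{a, b, c}"] sub) auto
  qed
qed

lemma refine_mono: "N \<subseteq> M \<Longrightarrow> refine N \<subseteq> refine M"
  unfolding refine_def by blast

lemma finite_refine_triangle: "K \<in> refine M \<Longrightarrow> finite K"
  by (erule refine_cases) auto

lemma finite_refine:
  assumes "triangulation M" shows "finite (refine M)"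
proof -
  have fin: "finite M" "\<And>K. K \<in> M \<Longrightarrow> finite K"
    using assms finite_vertices by (auto simp: triangulation_def)
  let ?V = "nodes M \<union> (\<lambda>(a, b). midpoint a b) ` (nodes M \<times> nodes M)"
  have "finite ?V" using fin by (auto simp: nodes_def)
  moreover have "refine M \<subseteq> Pow ?V"
    unfolding refine_def nodes_def by blast
  ultimately show ?thesis by (meson finite_Pow_iff finite_subset)
qed

lemma convex_comb_in_hull_3:
  "0 \<le> u \<Longrightarrow> 0 \<le> v \<Longrightarrow> 0 \<le> w \<Longrightarrow> u + v + w = 1 \<Longrightarrow>
    u *\<^sub>R a + v *\<^sub>R b + w *\<^sub>R c \<in> convex hull {a, b, c}"
  unfolding convex_hull_3 by blast

text \<open>In barycentric coordinates, a point with a coordinate at least 1/2 lies in the corner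
  triangle at that vertex; every other point lies in the middle triangle.\<close>

lemma region_refine:
  assumes "\<And>K. K \<in> M \<Longrightarrow> card K = 3"
  shows "region (refine M) = region M"
proof
  show "region (refine M) \<subseteq> region M"
    unfolding region_def by (auto elim: refine_parent)
  show "region M \<subseteq> region (refine M)"
  proof
    fix z assume "z \<in> region M"
    then obtain K where K: "K \<in> M" "z \<in> convex hull K" unfolding region_def by blast
    obtain a b c where abc: "K = {a, b, c}" "card {a, b, c} = 3"
      using assms[OF K(1)] by (metis card_3_iff)
    obtain u v w where z: "z = u *\<^sub>R a + v *\<^sub>R b + w *\<^sub>R c" and uvw: "0 \<le> u" "0 \<le> v" "0 \<le> w" "u + v + w = 1"
      using K(2) unfolding abc convex_hull_3 by blast
    have corner: "z \<in> region (refine M)"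
      if "{a, b, c} \<in> M" "card {a, b, c} = 3" "z = u *\<^sub>R a + v *\<^sub>R b + w *\<^sub>R c"
        "1 / 2 \<le> u" "0 \<le> v" "0 \<le> w" "u + v + w = 1" for a b c u v w
    proof -
      \<comment> \<open>The new coefficients are the barycentric coordinates with respect to the
        corner triangle at \<open>a\<close>; they are nonnegative because \<open>u\<close> is at
        least 1/2.\<close>
      have "z = (2 * u - 1) *\<^sub>R a + (2 * v) *\<^sub>R midpoint a b + (2 * w) *\<^sub>R midpoint a c"
      proof -
        have "u = 1 - v - w" using that by simp
        then show ?thesis
          unfolding that(3) midpoint_def Finite_Cartesian_Product.vec_eq_iff
          by (simp only:) (simp add: field_simps)
      qed
      also have "\<dots> \<in> convex hull {a, midpoint a b, midpoint a c}"
        by (rule convex_comb_in_hull_3) (use that in auto)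
      finally have "z \<in> convex hull {a, midpoint a b, midpoint a c}" .
      moreover have "{a, midpoint a b, midpoint a c} \<in> refine M"
        using that unfolding refine_def by blast
      ultimately show ?thesis unfolding region_def by blast
    qed
    show "z \<in> region (refine M)"
    proof (cases "1 / 2 \<le> u \<or> 1 / 2 \<le> v \<or> 1 / 2 \<le> w")
      case True
      have perm: "{b, a, c} = {a, b, c}" "{c, a, b} = {a, b, c}" by auto
      have zz: "z = v *\<^sub>R b + u *\<^sub>R a + w *\<^sub>R c" "z = w *\<^sub>R c + u *\<^sub>R a + v *\<^sub>R b"
        unfolding z by (simp_all only: add_ac)
      have sums: "v + u + w = 1" "w + u + v = 1" using uvw(4) by simp_all
      have tri: "{a, b, c} \<in> M" using K(1) abc(1) by simp
      from True consider "1 / 2 \<le> u" | "1 / 2 \<le> v" | "1 / 2 \<le> w" by blast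
      then show ?thesis
      proof cases
        case 1
        then show ?thesis by (rule corner[OF tri abc(2) z _ uvw(2,3,4)])
      next
        case 2
        then show ?thesis by (rule corner[of b a c, unfolded perm, OF tri abc(2) zz(1) _ uvw(1,3) sums(1)])
      next
        case 3
        then show ?thesis by (rule corner[of c a b, unfolded perm, OF tri abc(2) zz(2) _ uvw(1,2) sums(2)])
      qed
    next
      case False
      \<comment> \<open>An edge midpoint gets the weight 1 minus twice the coordinate of the
        opposite vertex.\<close>
      have "z = (1 - 2 * w) *\<^sub>R midpoint a b + (1 - 2 * u) *\<^sub>R midpoint b c + (1 - 2 * v) *\<^sub>R midpoint a c"
      proof -
        have "u = 1 - v - w" using uvw by simp
        then show ?thesis
          unfolding z midpoint_def Finite_Cartesian_Product.vec_eq_iff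
          by (simp only:) (simp add: field_simps)
      qed
      also have "\<dots> \<in> convex hull {midpoint a b, midpoint b c, midpoint a c}"
        by (rule convex_comb_in_hull_3) (use False uvw in auto)
      finally have "z \<in> convex hull {midpoint a b, midpoint b c, midpoint a c}" .
      moreover have "{midpoint a b, midpoint b c, midpoint a c} \<in> refine M"
        using K(1) abc unfolding refine_def by blast
      ultimately show ?thesis unfolding region_def by blast
    qed
  qed
qed

lemma nodes_refine_cases:
  assumes "y \<in> nodes (refine M)"
  obtains (vertex) "y \<in> nodes M"
  | (mid) a b K where "K \<in> M" "a \<in> K" "b \<in> K" "a \<noteq> b" "y = midpoint a b"
proof -
  obtain K where K: "K \<in> refine M" "y \<in> K" using assms unfolding nodes_def by blast
  have dist: "a \<noteq> b" "b \<noteq> c" "a \<noteq> c" if "card {a, b, c} = 3" for a b c :: point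
    using that by (auto simp: card_insert_if split: if_splits)
  from K(1) show ?thesis
  proof (cases rule: refine_cases)
    case (corner a b c)
    with K(2) consider "y = a" | "y = midpoint a b" | "y = midpoint a c" by blast
    then show ?thesis
      using vertex mid[of "{a, b, c}" a b] mid[of "{a, b, c}" a c] corner dist[of a b c]
      unfolding nodes_def by cases blast+
  next
    case (middle a b c)
    with K(2) consider "y = midpoint a b" | "y = midpoint b c" | "y = midpoint a c" by blast
    then show ?thesis
      using mid[of "{a, b, c}" a b] mid[of "{a, b, c}" b c] mid[of "{a, b, c}" a c] middle dist[of a b c]
      by cases blast+
  qed
qed

lemma affine_on_refine:
  assumes "\<And>K. K \<in> M \<Longrightarrow> affine_on (convex hull K) u" "K \<in> refine M"
  shows "affine_on (convex hull K) u"
  using assms(2) by (rule refine_parent) (blast intro: affine_on_subset assms(1))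

text \<open>Truncation at 0 creates a kink only where \<open>g\<close> changes sign, and on a hull
  the signs at the vertices decide.\<close>

lemma affine_on_min_0:
  fixes g :: "point \<Rightarrow> real"
  assumes g: "affine_on (convex hull K) g" and "(\<forall>y\<in>K. 0 \<le> g y) \<or> (\<forall>y\<in>K. g y \<le> 0)"
  shows "affine_on (convex hull K) (\<lambda>x. min (g x) 0)"
  using assms(2)
proof
  assume "\<forall>y\<in>K. 0 \<le> g y"
  then show ?thesis
    using affine_on_nonneg[OF g] by (intro affine_on_cong[OF affine_on_const[of _ 0]]) auto
next
  assume "\<forall>y\<in>K. g y \<le> 0"
  then show ?thesis
    using affine_on_le[OF g affine_on_const[of _ 0]] by (intro affine_on_cong[OF g]) auto
qed

definition cut :: "point set set \<Rightarrow> point \<Rightarrow> point \<Rightarrow> real" where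
  "cut M p x = min (2 * hat M p x - 1) 0"

lemma hat_midpoint:
  assumes "triangulation M" "K \<in> M" "a \<in> K" "b \<in> K"
  shows "hat M p (midpoint a b) = ((if a = p then 1 else 0) + (if b = p then 1 else 0)) / 2"
proof -
  have "a \<in> nodes M" "b \<in> nodes M" using assms(2-4) by (auto simp: nodes_def)
  then show ?thesis
    unfolding affine_on_midpoint[OF P1_affine_on[OF hat_P1[OF assms(1)] assms(2)] assms(3,4), of p]
    by (simp add: hat_node[OF assms(1)])
qed

text \<open>At the vertices of the refinement \<open>2 * hat M p - 1\<close> takes only the values
  -1, 0 and 1. The value 1 occurs only at \<open>p\<close>, and a fine triangle at \<open>p\<close>
  has the value 0 at its other vertices, so no fine triangle mixes signs.\<close>

lemma cut_affine_on:
  assumes M: "triangulation M" and K: "K \<in> refine M"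
  shows "affine_on (convex hull K) (cut M p)"
proof -
  have "affine_on (convex hull K) (hat M p)"
    by (rule affine_on_refine[OF P1_affine_on[OF hat_P1[OF M]] K])
  then have aff: "affine_on (convex hull K) (\<lambda>x. 2 * hat M p x - 1)"
    by (intro affine_on_diff affine_on_cmult affine_on_const)
  have dist: "a \<noteq> b" "b \<noteq> c" "a \<noteq> c" if "card {a, b, c} = 3" for a b c :: point
    using that by (auto simp: card_insert_if split: if_splits)
  have "(\<forall>y\<in>K. 0 \<le> 2 * hat M p y - 1) \<or> (\<forall>y\<in>K. 2 * hat M p y - 1 \<le> 0)"
    using K
  proof (cases rule: refine_cases)
    case (corner a b c)
    have "a \<in> nodes M" using corner(1) by (auto simp: nodes_def)
    from hat_node[OF M this, of p] hat_midpoint[OF M corner(1), of a b p] hat_midpoint[OF M corner(1), of a c p]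
    have "hat M p a = (if a = p then 1 else 0)"
      "hat M p (midpoint a b) = ((if a = p then 1 else 0) + (if b = p then 1 else 0)) / 2"
      "hat M p (midpoint a c) = ((if a = p then 1 else 0) + (if c = p then 1 else 0)) / 2"
      by simp_all
    then show ?thesis
      using dist[OF corner(2)] unfolding corner(3)
      by (cases "a = p"; cases "b = p"; cases "c = p") simp_all
  next
    case (middle a b c)
    from hat_midpoint[OF M middle(1), of a b p] hat_midpoint[OF M middle(1), of a c p]
      hat_midpoint[OF M middle(1), of b c p]
    have "hat M p (midpoint a b) = ((if a = p then 1 else 0) + (if b = p then 1 else 0)) / 2"
      "hat M p (midpoint a c) = ((if a = p then 1 else 0) + (if c = p then 1 else 0)) / 2"
      "hat M p (midpoint b c) = ((if b = p then 1 else 0) + (if c = p then 1 else 0)) / 2"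
      by simp_all
    then show ?thesis
      using dist[OF middle(2)] unfolding middle(3)
      by (cases "a = p"; cases "b = p"; cases "c = p") simp_all
  qed
  then show ?thesis unfolding cut_def using affine_on_min_0[OF aff] by simp
qed

lemma P1_refineI:
  assumes M: "triangulation M"
    and aff: "\<And>K. K \<in> refine M \<Longrightarrow> affine_on (convex hull K) F"
    and cont: "continuous_on (region M) F"
    and zero: "\<And>x. x \<notin> region M \<Longrightarrow> F x = 0"
  shows "F \<in> P1 (refine M)"
proof -
  have "region (refine M) = region M" using M by (intro region_refine) (auto simp: triangulation_def)
  then show ?thesis using assms by (auto simp: P1_iff)
qed

lemma continuous_on_hat: "triangulation M \<Longrightarrow> continuous_on (region M) (hat M p)"
  using hat_P1[of M p] by (simp add: P1_iff)

lemma continuous_on_cut: "triangulation M \<Longrightarrow> continuous_on (region M) (cut M p)"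
  unfolding cut_def by (intro continuous_intros continuous_on_hat)

text \<open>Writing \<open>\<lambda>\<^sub>p\<close> for the coarse hat functions, the fine hat function at the vertex \<open>p\<close> is
  \<open>max 0 (2 \<lambda>\<^sub>p - 1)\<close>, and the one at the midpoint of \<open>p\<close> and \<open>q\<close> is
  \<open>max 0 (1 + min 0 (2 \<lambda>\<^sub>p - 1) + min 0 (2 \<lambda>\<^sub>q - 1))\<close>.\<close>

lemma refine_vertex_hat:
  assumes M: "triangulation M" and p: "p \<in> nodes M"
  shows "\<exists>F\<in>P1 (refine M). \<forall>y\<in>nodes (refine M). F y = (if y = p then 1 else (0::real))"
proof -
  \<comment> \<open>\<open>t - min t 0\<close> is \<open>max t 0\<close>, written with the
    truncation already known to be affine on fine triangles.\<close>
  define F where "F = (\<lambda>x. 2 * hat M p x - 1 - cut M p x)"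
  have "F \<in> P1 (refine M)"
  proof (rule P1_refineI[OF M])
    show "affine_on (convex hull K) F" if "K \<in> refine M" for K
      unfolding F_def
      by (intro affine_on_diff affine_on_cmult affine_on_const cut_affine_on[OF M]
          affine_on_refine[OF P1_affine_on[OF hat_P1[OF M]]]) (use that in simp_all)
    show "continuous_on (region M) F"
      unfolding F_def by (intro continuous_intros continuous_on_hat continuous_on_cut M)
    show "F x = 0" if "x \<notin> region M" for x
      using that hat_P1[OF M, of p] by (simp add: F_def cut_def P1_iff)
  qed
  moreover have "F y = (if y = p then 1 else 0)" if "y \<in> nodes (refine M)" for y
    using that
  proof (cases rule: nodes_refine_cases)
    case vertex
    then show ?thesis using hat_node[OF M vertex] by (simp add: F_def cut_def)
  next
    case (mid a b K)
    have F: "F y = 0"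
      unfolding F_def cut_def mid(5) hat_midpoint[OF M mid(1-3)] using mid(4) by auto
    have "F p = 1" using hat_node[OF M p] by (simp add: F_def cut_def)
    with F show ?thesis by auto
  qed
  ultimately show ?thesis by blast
qed

text \<open>The finite sign check for the next lemma. \<open>A\<close>, \<open>B\<close>,
  \<open>C\<close> stand for \<open>a = p\<close>, \<open>b = p\<close>, \<open>c = p\<close> and
  the primed letters for the same equations with \<open>q\<close>; the exclusions express distinct
  vertices and \<open>p \<noteq> q\<close>. The first claim is for corner triangles, the second for
  middle ones.\<close>

lemma midpoint_hat_signs:
  fixes A B C A' B' C' :: bool
  defines "s \<equiv> \<lambda>P Q P' Q'. 1 + min ((if P then 1 else 0) + (if Q then 1 else 0) - 1) 0
      + min ((if P' then 1 else 0) + (if Q' then 1 else 0) - 1) (0::real)"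
  assumes "\<not> (A \<and> B)" "\<not> (A \<and> C)" "\<not> (B \<and> C)" "\<not> (A' \<and> B')" "\<not> (A' \<and> C')" "\<not> (B' \<and> C')"
    "\<not> (A \<and> A')" "\<not> (B \<and> B')" "\<not> (C \<and> C')"
  shows "0 \<le> (if A then 0 else if A' then 0 else -1::real) \<and> 0 \<le> s A B A' B' \<and> 0 \<le> s A C A' C' \<or>
      (if A then 0 else if A' then 0 else -1::real) \<le> 0 \<and> s A B A' B' \<le> 0 \<and> s A C A' C' \<le> 0"
    and "0 \<le> s A B A' B' \<and> 0 \<le> s B C B' C' \<and> 0 \<le> s A C A' C' \<or>
      s A B A' B' \<le> 0 \<and> s B C B' C' \<le> 0 \<and> s A C A' C' \<le> 0"
  using assms(2-) unfolding s_def
  by (cases A; cases B; cases C; cases A'; cases B'; cases C'; simp)+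

lemma refine_midpoint_hat:
  assumes M: "triangulation M" and pq: "L \<in> M" "p \<in> L" "q \<in> L" "p \<noteq> q"
  shows "\<exists>F\<in>P1 (refine M). \<forall>y\<in>nodes (refine M). F y = (if y = midpoint p q then 1 else (0::real))"
proof -
  define S where "S = (\<lambda>x. 1 + cut M p x + cut M q x)"
  define F where "F = (\<lambda>x. S x - min (S x) 0)"
  have dist: "a \<noteq> b" "b \<noteq> c" "a \<noteq> c" if "card {a, b, c} = 3" for a b c :: point
    using that by (auto simp: card_insert_if split: if_splits)
  have S: "affine_on (convex hull K) S" if "K \<in> refine M" for K
    unfolding S_def using that by (intro affine_on_add affine_on_const cut_affine_on[OF M])
  have Smid: "S (midpoint a b) = 1 + min ((if a = p then 1 else 0) + (if b = p then 1 else 0) - 1) 0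
      + min ((if a = q then 1 else 0) + (if b = q then 1 else 0) - 1) 0"
    if "K \<in> M" "a \<in> K" "b \<in> K" for a b K
    unfolding S_def cut_def hat_midpoint[OF M that] by simp
  have Snode: "S a = (if a = p then 0 else if a = q then 0 else -1)" if "a \<in> nodes M" for a
    using hat_node[OF M that] pq(4) by (auto simp: S_def cut_def)
  have "F \<in> P1 (refine M)"
  proof (rule P1_refineI[OF M])
    fix K assume K: "K \<in> refine M"
    have "(\<forall>y\<in>K. 0 \<le> S y) \<or> (\<forall>y\<in>K. S y \<le> 0)"
      using K
    proof (cases rule: refine_cases)
      case (corner a b c)
      have "a \<in> nodes M" using corner(1) by (auto simp: nodes_def)
      then show ?thesis
        using midpoint_hat_signs(1)[of "a = p" "b = p" "c = p" "a = q" "b = q" "c = q"] dist[OF corner(2)] pq(4)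
        unfolding corner(3) by (simp add: Smid[OF corner(1)] Snode)
    next
      case (middle a b c)
      show ?thesis
        using midpoint_hat_signs(2)[of "a = p" "b = p" "c = p" "a = q" "b = q" "c = q"] dist[OF middle(2)] pq(4)
        unfolding middle(3) by (simp add: Smid[OF middle(1)])
    qed
    then show "affine_on (convex hull K) F"
      unfolding F_def using K by (intro affine_on_diff S affine_on_min_0)
  next
    show "continuous_on (region M) F"
      unfolding F_def S_def by (intro continuous_intros continuous_on_cut M)
    show "F x = 0" if "x \<notin> region M" for x
      using that hat_P1[OF M, of p] hat_P1[OF M, of q] by (simp add: F_def S_def cut_def P1_iff)
  qed
  moreover have "F y = (if y = midpoint p q then 1 else 0)" if "y \<in> nodes (refine M)" for y
  proof -
    have F1: "F (midpoint p q) = 1"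
      using Smid[OF pq(1-3)] pq(4) by (simp add: F_def)
    show ?thesis using that
    proof (cases rule: nodes_refine_cases)
      case vertex
      have "F y = 0" using Snode[OF vertex] by (simp add: F_def)
      with F1 show ?thesis by auto
    next
      case (mid a b K)
      \<comment> \<open>At an edge midpoint, \<open>S\<close> is 1 if the edge ends in both
        \<open>p\<close> and \<open>q\<close>, 0 if it ends in just one of them, and -1
        otherwise.\<close>
      show ?thesis
      proof (cases "{a, b} = {p, q}")
        case True
        then have "y = midpoint p q" using mid(5) by (auto simp: doubleton_eq_iff midpoint_sym)
        with F1 show ?thesis by simp
      next
        case False
        then have "F y = 0" using Smid[OF mid(1-3)] mid(4,5) pq(4)
          unfolding F_def by (cases "a = p"; cases "b = p"; cases "a = q"; cases "b = q") auto
        with F1 show ?thesis by auto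
      qed
    qed
  qed
  ultimately show ?thesis by blast
qed

text \<open>Existence on the refined mesh comes from the two explicit functions instead of the
  interpolation argument, which rests on conformity of the mesh.\<close>

lemma
  assumes M: "triangulation M" and x: "x \<in> nodes (refine M)"
  shows hat_refine_P1: "hat (refine M) x \<in> P1 (refine M)"
    and hat_refine_node: "y \<in> nodes (refine M) \<Longrightarrow> hat (refine M) x y = (if y = x then 1 else 0)"
proof -
  have "\<exists>u\<in>P1 (refine M). \<forall>y\<in>nodes (refine M). u y = (if y = x then 1 else (0::real))"
    using x
  proof (cases rule: nodes_refine_cases)
    case vertex
    then show ?thesis by (rule refine_vertex_hat[OF M])
  next
    case (mid a b K)
    show ?thesis unfolding mid(5) by (rule refine_midpoint_hat[OF M mid(1-4)])
  qed
  then obtain u where u: "u \<in> P1 (refine M)" "\<And>y. y \<in> nodes (refine M) \<Longrightarrow> u y = (if y = x then 1 else (0::real))"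
    by blast
  then have "hat (refine M) x = u" by (rule hat_eqI)
  with u show "hat (refine M) x \<in> P1 (refine M)"
    "y \<in> nodes (refine M) \<Longrightarrow> hat (refine M) x y = (if y = x then 1 else 0)" by auto
qed

text \<open>The star of an interior node \<open>x\<close> is open: the homothety with center \<open>x\<close> and a small ratio \<open>d\<close>
  maps a neighborhood of \<open>y\<close> into the triangles around \<open>x\<close>, on which \<open>F > 1 - d\<close> describes the image
  of the star.\<close>

lemma hat_zero_off_interior:
  fixes F :: "point \<Rightarrow> real"
  assumes N: "finite N" "\<And>K. K \<in> N \<Longrightarrow> finite K"
    and F: "F \<in> P1 N" "F x = 1" "\<And>z. z \<in> nodes N \<Longrightarrow> z \<noteq> x \<Longrightarrow> F z = 0"
    and x: "x \<in> interior (region N)" and y: "y \<notin> interior (region N)"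
  shows "F y = 0"
proof (rule ccontr)
  assume Fy: "F y \<noteq> 0"
  have aff: "affine_on (convex hull K) F" if "K \<in> N" for K using F(1) that by (simp add: P1_iff)
  have Fzero: "F z = 0" if "K \<in> N" "z \<in> convex hull K" "x \<notin> K" for K z
  proof (rule affine_on_eq[OF aff[OF that(1)] affine_on_const[of _ 0] _ that(2)])
    fix y assume "y \<in> K"
    then show "F y = 0" using that(1,3) by (intro F(3)) (auto simp: nodes_def)
  qed
  have "y \<in> region N" using Fy F(1) by (auto simp: P1_iff)
  then obtain K where K: "K \<in> N" "y \<in> convex hull K" unfolding region_def by blast
  have xK: "x \<in> K" using Fzero[OF K] Fy by blast
  have "0 \<le> F y"
  proof (rule affine_on_nonneg[OF aff[OF K(1)] _ K(2)])
    fix z assume "z \<in> K"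
    then have "z \<in> nodes N" using K(1) by (auto simp: nodes_def)
    then show "0 \<le> F z" using F(2,3) by (cases "z = x") auto
  qed
  with Fy have Fy0: "0 < F y" by simp
  \<comment> \<open>Removing the triangles without vertex \<open>x\<close> leaves an open
    neighborhood of \<open>x\<close> covered by the triangles at \<open>x\<close>.\<close>
  define U where "U = interior (region N) - (\<Union>L\<in>{L\<in>N. x \<notin> L}. convex hull L)"
  have "open U" unfolding U_def
    using N by (intro open_Diff open_interior closed_UN compact_imp_closed finite_imp_compact_convex_hull ballI) auto
  have xU: "x \<in> U" unfolding U_def using x Fzero F(2) by auto
  have U: "\<exists>L\<in>N. x \<in> L \<and> z \<in> convex hull L" if "z \<in> U" for z
    using that interior_subset[of "region N"] unfolding U_def region_def by blast
  define T where "T = (\<lambda>d v. x + d *\<^sub>R (v - x))"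
  have "((\<lambda>d. T d y) \<longlongrightarrow> x + 0 *\<^sub>R (y - x)) (at_right 0)"
    unfolding T_def by (intro tendsto_intros)
  then have "\<forall>\<^sub>F d in at_right 0. T d y \<in> U"
    using topological_tendstoD[OF _ \<open>open U\<close>] xU by simp
  moreover have "\<forall>\<^sub>F d in at_right (0::real). d \<in> {0<..<1}"
    by (rule eventually_at_right_field[THEN iffD2]) (auto intro: exI[of _ 1])
  ultimately have "\<forall>\<^sub>F d in at_right 0. T d y \<in> U \<and> d \<in> {0<..<1}"
    by (rule eventually_conj)
  then obtain d :: real where d: "0 < d" "d < 1" and Ty: "T d y \<in> U"
    using eventually_happens[of _ "at_right (0::real)"] by (auto simp: trivial_limit_at_right_real)
  \<comment> \<open>\<open>V\<close> collects the points that the homothety sends into the shrunken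
    star. It is open and contains \<open>y\<close>; once it is shown to lie in the region,
    \<open>y\<close> would be an interior point.\<close>
  define V where "V = T d -` (U \<inter> F -` {1 - d<..})"
  have "open (U \<inter> F -` {1 - d<..})"
  proof (rule continuous_open_preimage)
    show "continuous_on U F"
      using F(1) interior_subset[of "region N"]
      by (auto simp: P1_iff U_def intro: continuous_on_subset)
  qed (use \<open>open U\<close> in auto)
  then have "open V"
    unfolding V_def T_def by (intro open_vimage continuous_intros)
  have Tcomb: "T d v = (1 - d) *\<^sub>R x + d *\<^sub>R v" for v
    by (simp add: T_def algebra_simps)
  have "y \<in> V"
  proof -
    have xhull: "x \<in> convex hull K" using xK by (rule hull_inc)
    have "(1 - d) *\<^sub>R x + d *\<^sub>R y \<in> convex hull K"
      using d by (intro convexD[OF convex_convex_hull xhull K(2)]) auto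
    then have "F (T d y) = (1 - d) *\<^sub>R F x + d *\<^sub>R F y"
      unfolding Tcomb using d by (intro affine_on_convex_comb[OF aff[OF K(1)] xhull K(2)]) auto
    then show ?thesis unfolding V_def using Ty F(2) d Fy0 by simp
  qed
  moreover have "V \<subseteq> region N"
  proof
    fix v assume v: "v \<in> V"
    then obtain L where L: "L \<in> N" "x \<in> L" "T d v \<in> convex hull L" using U unfolding V_def by blast
    have FT: "1 - d < F (T d v)" using v unfolding V_def by simp
    show "v \<in> region N"
    proof (cases "L - {x} = {}")
      case True
      then have "L = {x}" using L(2) by blast
      then have "d *\<^sub>R (v - x) = 0" using L(3) by (simp add: T_def)
      then have "v = x" using d by simp
      then show ?thesis using x interior_subset by blast
    next
      case False
      have "insert x (L - {x}) = L" using L(2) by blast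
      then have "T d v \<in> {z. \<exists>u\<ge>0. \<exists>s\<ge>0. \<exists>b. u + s = 1 \<and> b \<in> convex hull (L - {x}) \<and> z = u *\<^sub>R x + s *\<^sub>R b}"
        using L(3) convex_hull_insert[OF False, of x] by simp
      then obtain u s b where us: "0 \<le> u" "0 \<le> s" "u + s = 1" "b \<in> convex hull (L - {x})"
        and Tv: "T d v = u *\<^sub>R x + s *\<^sub>R b"
        by blast
      have bL: "b \<in> convex hull L" using us(4) hull_mono[of "L - {x}" L] by blast
      have xL: "x \<in> convex hull L" using L(2) by (rule hull_inc)
      have "affine_on (convex hull (L - {x})) F"
        by (rule affine_on_subset[OF aff[OF L(1)] hull_mono]) blast
      then have "F b = 0"
      proof (rule affine_on_eq[OF _ affine_on_const[of _ 0] _ us(4)])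
        fix z assume "z \<in> L - {x}"
        then show "F z = 0" using L(1) by (intro F(3)) (auto simp: nodes_def)
      qed
      then have "F (T d v) = u"
        unfolding Tv using affine_on_convex_comb[OF aff[OF L(1)] xL bL _ us(3)] L(3) F(2)
        unfolding Tv by simp
      \<comment> \<open>The value of \<open>F\<close> at the image point is the weight of
        \<open>x\<close>, so \<open>F > 1 - d\<close> bounds the remaining weight by
        \<open>d\<close>. Undoing the homothety replaces \<open>s\<close> by
        \<open>s / d < 1\<close> and stays in \<open>L\<close>.\<close>
      then have s: "s < d" using FT us by simp
      have "d *\<^sub>R (v - x) = s *\<^sub>R (b - x)"
      proof -
        have u: "u = 1 - s" using us by simp
        have "x + d *\<^sub>R (v - x) = (1 - s) *\<^sub>R x + s *\<^sub>R b" using Tv unfolding T_def u .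
        then show ?thesis by (simp add: algebra_simps)
      qed
      then have "(1 / d) *\<^sub>R (d *\<^sub>R (v - x)) = (1 / d) *\<^sub>R (s *\<^sub>R (b - x))" by simp
      then have "v - x = (s / d) *\<^sub>R (b - x)" using d by simp
      then have "v = x + (s / d) *\<^sub>R (b - x)" by (metis add.commute diff_add_cancel)
      then have v: "v = (1 - s / d) *\<^sub>R x + (s / d) *\<^sub>R b"
        by (simp add: algebra_simps)
      have "v \<in> convex hull L"
        unfolding v using s d us by (intro convexD[OF convex_convex_hull xL bL]) (auto simp: field_simps)
      then show ?thesis using L(1) unfolding region_def by blast
    qed
  qed
  ultimately show False using y \<open>open V\<close> interior_maximal by blast
qed

section \<open>The bilinear forms on piecewise affine functions\<close>

abbreviation skeleton :: "point set set \<Rightarrow> point set" where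
  "skeleton N \<equiv> \<Union>K\<in>N. frontier (convex hull K)"

lemma negligible_skeleton: "finite N \<Longrightarrow> negligible (skeleton N)"
  by (intro negligible_Union) (auto intro: negligible_convex_frontier)

lemma off_skeleton:
  assumes "x \<in> region N" "x \<notin> skeleton N"
  obtains K where "K \<in> N" "x \<in> interior (convex hull K)"
  using assms closure_subset unfolding region_def frontier_def by blast

lemma frontier_region:
  assumes "finite N" shows "frontier (region N) \<subseteq> skeleton N"
  using frontier_Union_subset[of "(\<lambda>K. convex hull K) ` N"] assms
  unfolding region_def by auto

lemma negligible_frontier_region: "finite N \<Longrightarrow> negligible (frontier (region N))"
  using negligible_subset[OF negligible_skeleton frontier_region] .

lemma affine_on_grad:
  assumes "affine_on (convex hull K) u"
  obtains G where "\<And>x. x \<in> interior (convex hull K) \<Longrightarrow> u differentiable (at x)"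
    "\<And>x. x \<in> interior (convex hull K) \<Longrightarrow> grad u x = G"
proof -
  obtain L c where L: "linear L" and u: "\<forall>x\<in>convex hull K. u x = c + L x"
    using assms unfolding affine_on_def by blast
  have der: "(u has_derivative L) (at x)" if "x \<in> interior (convex hull K)" for x
  proof (rule has_derivative_transform_within_open[OF _ open_interior that])
    show "((\<lambda>x. c + L x) has_derivative L) (at x)"
      using linear_imp_has_derivative[OF L] by (auto intro!: derivative_eq_intros)
    show "c + L z = u z" if "z \<in> interior (convex hull K)" for z
      using u that interior_subset by (metis subsetD)
  qed
  then have "grad u x = matrix L" if "x \<in> interior (convex hull K)" for x
    using that unfolding grad_def by (metis frechet_derivative_at)
  with der show thesis using that[of "matrix L"] unfolding differentiable_def by blast
qed

text \<open>Absolute integrability is the intermediate notion because it passes to unions of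
  triangles whatever their overlaps. Frontiers of convex sets and of the region are null sets, so
  values there do not matter.\<close>

lemma integrable_piecewise:
  fixes f :: "point \<Rightarrow> real"
  assumes N: "finite N" "\<And>K. K \<in> N \<Longrightarrow> finite K"
    and f: "\<And>K. K \<in> N \<Longrightarrow> \<exists>g. continuous_on (convex hull K) g \<and> (\<forall>x\<in>interior (convex hull K). f x = g x)"
  shows "f integrable_on interior (region N)"
proof -
  have "f absolutely_integrable_on (convex hull K)" if K: "K \<in> N" for K
  proof -
    obtain g where g: "continuous_on (convex hull K) g" "\<forall>x\<in>interior (convex hull K). f x = g x"
      using f[OF K] by blast
    have int: "h integrable_on (convex hull K)" if "continuous_on (convex hull K) h" for h :: "point \<Rightarrow> real"
      using borel_integrable_compact[OF finite_imp_compact_convex_hull[OF N(2)[OF K]] that]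
      by (intro set_borel_integral_eq_integral) (simp add: set_integrable_def)
    have "g absolutely_integrable_on (convex hull K)"
      unfolding absolutely_integrable_on_def using g(1) by (intro conjI int continuous_intros)
    then show ?thesis
    proof (rule absolutely_integrable_spike)
      show "negligible (frontier (convex hull K))" by (rule negligible_convex_frontier) simp
      show "f x = g x" if "x \<in> convex hull K - frontier (convex hull K)" for x
        using that g(2) closure_subset unfolding frontier_def by blast
    qed
  qed
  with N(1) have "f absolutely_integrable_on (\<Union>K\<in>N. convex hull K)"
  proof (induction N rule: finite_induct)
    case empty
    then show ?case by (simp add: absolutely_integrable_on_def)
  next
    case (insert K N)
    then show ?case by (simp add: absolutely_integrable_Un)
  qed
  then have "f integrable_on region N"
    unfolding region_def absolutely_integrable_on_def by blast
  then show ?thesis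
    using has_integral_interior[OF negligible_frontier_region[OF N(1)]] unfolding integrable_on_def by blast
qed

lemma grad_sum:
  assumes "finite I" "\<And>k. k \<in> I \<Longrightarrow> u k differentiable (at x)"
  shows "grad (\<lambda>x. \<Sum>k\<in>I. c k *\<^sub>R u k x) x = (\<Sum>k\<in>I. c k *\<^sub>R grad (u k) x)"
proof -
  let ?D = "\<lambda>k. frechet_derivative (u k) (at x)"
  have "((\<lambda>x. \<Sum>k\<in>I. c k *\<^sub>R u k x) has_derivative (\<lambda>h. \<Sum>k\<in>I. c k *\<^sub>R ?D k h)) (at x)"
    using assms(2) frechet_derivative_works by (intro has_derivative_sum has_derivative_scaleR_right) blast
  from frechet_derivative_at[OF this]
  have "frechet_derivative (\<lambda>x. \<Sum>k\<in>I. c k *\<^sub>R u k x) (at x) = (\<lambda>h. \<Sum>k\<in>I. c k *\<^sub>R ?D k h)"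
    by (rule sym)
  then show ?thesis
    unfolding grad_def matrix_def Finite_Cartesian_Product.vec_eq_iff by (simp add: sum_component)
qed

text \<open>No differentiability is assumed: the choice behind \<open>frechet_derivative\<close>
  depends only on which maps are derivatives at the point, and that is a local matter.\<close>

lemma grad_cong:
  assumes "open S" "x \<in> S" "\<And>y. y \<in> S \<Longrightarrow> u y = v y"
  shows "grad u x = grad v x"
proof -
  have "(u has_derivative D) (at x) \<longleftrightarrow> (v has_derivative D) (at x)" for D
    using has_derivative_transform_within_open[OF _ assms(1,2)] assms(3) by (metis (no_types, lifting))
  then show ?thesis unfolding grad_def frechet_derivative_def by simp
qed

lemma b_form_cong:
  assumes "open S" "\<And>y. y \<in> S \<Longrightarrow> u y = u' y" "\<And>y. y \<in> S \<Longrightarrow> q y = q' y"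
  shows "b_form S u q = b_form S u' q'"
  unfolding b_form_def
  using grad_cong[OF assms(1) _ assms(2)] assms(3) by (intro arg_cong[of _ _ uminus] integral_cong) simp

lemma a_form_commute: "a_form S u v = a_form S v u"
  unfolding a_form_def by (simp add: inner_commute)

lemma trace_sum: "trace (\<Sum>k\<in>I. c k *\<^sub>R A k :: real ^ 'n ^ 'n) = (\<Sum>k\<in>I. c k * trace (A k))"
  unfolding trace_def by (simp add: sum_component sum_distrib_left) (rule sum.swap)

text \<open>Weaker than \<open>P1\<close> in order to survive restriction to a submesh: a function
  on the whole mesh need not vanish outside the region of a subdomain.\<close>

definition piecewise_affine :: "point set set \<Rightarrow> (point \<Rightarrow> point) \<Rightarrow> bool" where
  "piecewise_affine N u \<longleftrightarrow> (\<forall>K\<in>N. affine_on (convex hull K) u)"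

lemma P1_piecewise_affine: "u \<in> P1 M \<Longrightarrow> N \<subseteq> M \<Longrightarrow> piecewise_affine N u"
  by (auto simp: P1_iff piecewise_affine_def)

context
  fixes N :: "point set set" and S :: "point set"
  assumes N: "finite N" "\<And>K. K \<in> N \<Longrightarrow> finite K" and S: "S = interior (region N)"
begin

lemma off_skeleton_differentiable:
  assumes "x \<in> S - skeleton N" "piecewise_affine N u"
  shows "u differentiable (at x)"
proof -
  obtain K where "K \<in> N" "x \<in> interior (convex hull K)"
    using off_skeleton assms(1) interior_subset unfolding S by blast
  then show ?thesis using assms(2) affine_on_grad unfolding piecewise_affine_def by metis
qed

lemma a_form_integrable:
  assumes "piecewise_affine N u" "piecewise_affine N v"
  shows "(\<lambda>x. inner (grad u x) (grad v x)) integrable_on S"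
  unfolding S
proof (rule integrable_piecewise[OF N])
  fix K assume K: "K \<in> N"
  obtain G where G: "\<And>x. x \<in> interior (convex hull K) \<Longrightarrow> grad u x = G"
    using assms(1) K affine_on_grad unfolding piecewise_affine_def by metis
  obtain H where H: "\<And>x. x \<in> interior (convex hull K) \<Longrightarrow> grad v x = H"
    using assms(2) K affine_on_grad unfolding piecewise_affine_def by metis
  show "\<exists>g. continuous_on (convex hull K) g \<and>
      (\<forall>x\<in>interior (convex hull K). inner (grad u x) (grad v x) = g x)"
    using G H by (intro exI[of _ "\<lambda>_. inner G H"]) simp
qed

lemma b_form_integrable:
  assumes "piecewise_affine N u" "continuous_on (region N) q"
  shows "(\<lambda>x. trace (grad u x) * q x) integrable_on S"
  unfolding S
proof (rule integrable_piecewise[OF N])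
  fix K assume K: "K \<in> N"
  obtain G where G: "\<And>x. x \<in> interior (convex hull K) \<Longrightarrow> grad u x = G"
    using assms(1) K affine_on_grad unfolding piecewise_affine_def by metis
  have "continuous_on (convex hull K) q"
    using assms(2) by (rule continuous_on_subset) (use K in \<open>auto simp: region_def\<close>)
  then show "\<exists>g. continuous_on (convex hull K) g \<and>
      (\<forall>x\<in>interior (convex hull K). trace (grad u x) * q x = g x)"
    using G by (intro exI[of _ "\<lambda>x. trace G * q x"]) (auto intro!: continuous_intros)
qed

lemma a_form_nonneg: "piecewise_affine N u \<Longrightarrow> 0 \<le> a_form S u u"
  unfolding a_form_def by (intro integral_nonneg a_form_integrable) auto

text \<open>The gradient is linear only where all summands are differentiable, hence off the
  skeleton; the integral ignores this null set.\<close>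

lemma a_form_sum_left:
  assumes I: "finite I" and u: "\<And>k. k \<in> I \<Longrightarrow> piecewise_affine N (u k)" and v: "piecewise_affine N v"
  shows "a_form S (\<lambda>x. \<Sum>k\<in>I. c k *\<^sub>R u k x) v = (\<Sum>k\<in>I. c k * a_form S (u k) v)"
proof -
  have "a_form S (\<lambda>x. \<Sum>k\<in>I. c k *\<^sub>R u k x) v
      = integral S (\<lambda>x. \<Sum>k\<in>I. c k * inner (grad (u k) x) (grad v x))"
    unfolding a_form_def
  proof (rule integral_spike[OF negligible_skeleton[OF N(1)]])
    fix x assume x: "x \<in> S - skeleton N"
    have "grad (\<lambda>x. \<Sum>k\<in>I. c k *\<^sub>R u k x) x = (\<Sum>k\<in>I. c k *\<^sub>R grad (u k) x)"
      by (rule grad_sum[OF I off_skeleton_differentiable[OF x u]])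
    then show "(\<Sum>k\<in>I. c k * inner (grad (u k) x) (grad v x)) =
        inner (grad (\<lambda>x. \<Sum>k\<in>I. c k *\<^sub>R u k x) x) (grad v x)"
      by (simp add: inner_sum_left)
  qed
  also have "\<dots> = (\<Sum>k\<in>I. integral S (\<lambda>x. c k * inner (grad (u k) x) (grad v x)))"
    using a_form_integrable[OF u v] by (intro integral_sum I) (auto intro!: integrable_on_mult_right)
  finally show ?thesis by (simp add: a_form_def)
qed

lemma a_form_sum_right:
  assumes "finite I" "\<And>k. k \<in> I \<Longrightarrow> piecewise_affine N (u k)" "piecewise_affine N v"
  shows "a_form S v (\<lambda>x. \<Sum>k\<in>I. c k *\<^sub>R u k x) = (\<Sum>k\<in>I. c k * a_form S v (u k))"
  using a_form_sum_left[OF assms] by (simp add: a_form_commute)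

lemma b_form_sum_left:
  assumes I: "finite I" and u: "\<And>k. k \<in> I \<Longrightarrow> piecewise_affine N (u k)" and q: "continuous_on (region N) q"
  shows "b_form S (\<lambda>x. \<Sum>k\<in>I. c k *\<^sub>R u k x) q = (\<Sum>k\<in>I. c k * b_form S (u k) q)"
proof -
  have "integral S (\<lambda>x. trace (grad (\<lambda>x. \<Sum>k\<in>I. c k *\<^sub>R u k x) x) * q x)
      = integral S (\<lambda>x. \<Sum>k\<in>I. c k * (trace (grad (u k) x) * q x))"
  proof (rule integral_spike[OF negligible_skeleton[OF N(1)]])
    fix x assume x: "x \<in> S - skeleton N"
    have "grad (\<lambda>x. \<Sum>k\<in>I. c k *\<^sub>R u k x) x = (\<Sum>k\<in>I. c k *\<^sub>R grad (u k) x)"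
      by (rule grad_sum[OF I off_skeleton_differentiable[OF x u]])
    then show "(\<Sum>k\<in>I. c k * (trace (grad (u k) x) * q x)) =
        trace (grad (\<lambda>x. \<Sum>k\<in>I. c k *\<^sub>R u k x) x) * q x"
      by (simp add: trace_sum sum_distrib_right mult.assoc)
  qed
  also have "\<dots> = (\<Sum>k\<in>I. integral S (\<lambda>x. c k * (trace (grad (u k) x) * q x)))"
    using b_form_integrable[OF u q] by (intro integral_sum I) (auto intro!: integrable_on_mult_right)
  finally show ?thesis by (simp add: b_form_def sum_negf)
qed

lemma b_form_sum_right:
  assumes I: "finite I" and u: "piecewise_affine N u" and q: "\<And>k. k \<in> I \<Longrightarrow> continuous_on (region N) (q k)"
  shows "b_form S u (\<lambda>x. \<Sum>k\<in>I. c k * q k x) = (\<Sum>k\<in>I. c k * b_form S u (q k))"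
proof -
  have "integral S (\<lambda>x. trace (grad u x) * (\<Sum>k\<in>I. c k * q k x))
      = integral S (\<lambda>x. \<Sum>k\<in>I. c k * (trace (grad u x) * q k x))"
    by (intro integral_cong) (simp add: sum_distrib_left algebra_simps)
  also have "\<dots> = (\<Sum>k\<in>I. integral S (\<lambda>x. c k * (trace (grad u x) * q k x)))"
    using b_form_integrable[OF u q] by (intro integral_sum I) (auto intro!: integrable_on_mult_right)
  finally show ?thesis by (simp add: b_form_def sum_negf)
qed

end

text \<open>Distinct triangles share at most two vertices, and the hull of so few points has empty
  interior in the plane.\<close>

lemma negligible_Int_triangles:
  assumes "triangulation M" "K \<in> M" "L \<in> M" "K \<noteq> L"
  shows "negligible (convex hull K \<inter> convex hull L)"
proof -
  have c: "card K = 3" "card L = 3" and eq: "convex hull K \<inter> convex hull L = convex hull (K \<inter> L)"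
    using assms unfolding triangulation_def by auto
  have fin: "finite K" "finite L" using assms finite_vertices by auto
  have "K \<inter> L \<noteq> K"
    using assms(4) c fin by (metis card_subset_eq inf.cobounded2 inf.absorb_iff1)
  then have "K \<inter> L \<subset> K" by blast
  then have "card (K \<inter> L) < 3" using psubset_card_mono[OF fin(1)] c by metis
  then have "interior (convex hull (K \<inter> L)) = {}"
    using fin by (intro empty_interior_convex_hull) auto
  then show ?thesis unfolding eq by (simp add: negligible_convex_interior)
qed

text \<open>The interior of the union exceeds the union of the interiors by interface points.
  Passing to the closed regions and back changes every integral only by null sets.\<close>

lemma integral_interior_region_UN:
  fixes f :: "point \<Rightarrow> real"
  assumes fin: "finite I" "\<And>i. i \<in> I \<Longrightarrow> finite (N i)"
    and neg: "\<And>i j. i \<in> I \<Longrightarrow> j \<in> I \<Longrightarrow> i \<noteq> j \<Longrightarrow> negligible (region (N i) \<inter> region (N j))"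
    and f: "\<And>i. i \<in> I \<Longrightarrow> f integrable_on interior (region (N i))"
  shows "integral (interior (region (\<Union>i\<in>I. N i))) f = (\<Sum>i\<in>I. integral (interior (region (N i))) f)"
proof -
  have fr: "negligible (frontier (region (N i)))" if "i \<in> I" for i
    using fin that by (intro negligible_frontier_region) auto
  have "(f has_integral integral (interior (region (N i))) f) (region (N i))" if "i \<in> I" for i
    using integrable_integral[OF f[OF that]] unfolding has_integral_interior[OF fr[OF that]] .
  then have "(f has_integral (\<Sum>i\<in>I. integral (interior (region (N i))) f)) (\<Union>i\<in>I. region (N i))"
    using neg by (intro has_integral_UN fin) (auto simp: pairwise_def)
  moreover have "(\<Union>i\<in>I. region (N i)) = region (\<Union>i\<in>I. N i)"
    unfolding region_def by blast
  moreover have "negligible (frontier (region (\<Union>i\<in>I. N i)))"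
    using fin by (intro negligible_frontier_region) auto
  ultimately show ?thesis
    using has_integral_interior integral_unique by metis
qed

section \<open>The decomposed domain\<close>

definition comb :: "broken list \<Rightarrow> real vec \<Rightarrow> broken" where
  "comb vs c = (\<lambda>i x. \<Sum>k<length vs. vec_index c k *\<^sub>R (vs ! k) i x)"

definition pcomb :: "(point \<Rightarrow> real) list \<Rightarrow> real vec \<Rightarrow> point \<Rightarrow> real" where
  "pcomb qs p = (\<lambda>x. \<Sum>k<length qs. vec_index p k * (qs ! k) x)"

lemma sum_nth_distinct:
  "distinct xs \<Longrightarrow> (\<Sum>k<length xs. g (xs ! k)) = (\<Sum>z\<in>set xs. g z)"
  using sum_list_distinct_conv_sum_set[of xs g] by (simp add: sum_list_sum_nth atLeast0LessThan)

lemma sum_lessThan_add: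
  "(\<Sum>k<m + n. f k) = (\<Sum>k<m. f k) + (\<Sum>k<n. f (m + k :: nat) :: 'a :: comm_monoid_add)"
  by (induction n) (simp_all add: add.assoc)

locale decomposition =
  fixes D :: setting
  assumes dom: "decomposed_domain D" and ker_BT: "ker_BT_constants D"
    and dofs: "numbered_dofs D" and split: "primal_dual_split D" and jumps: "jump_constraints D"
begin

abbreviation "V \<equiv> velocity_space D"
abbreviation "subm i \<equiv> refine (subd D i)"

section \<open>Geometry of the subdomains and their refined meshes\<close>

lemma triangulation_tri: "triangulation (tri D)"
  using dom unfolding decomposed_domain_def by blast

lemma card_tri: "K \<in> tri D \<Longrightarrow> card K = 3"
  using triangulation_tri by (simp add: triangulation_def)

lemma subd_subset: "i < nsub D \<Longrightarrow> subd D i \<subseteq> tri D"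
  using dom by (auto simp: decomposed_domain_def)

lemma tri_eq: "tri D = (\<Union>i<nsub D. subd D i)"
  using dom unfolding decomposed_domain_def by blast

lemma region_subm: "i < nsub D \<Longrightarrow> region (subm i) = region (subd D i)"
  using subd_subset card_tri by (intro region_refine) blast

lemma region_fmesh: "region (fmesh D) = region (tri D)"
  using card_tri by (intro region_refine)

lemma region_tri_UN: "region (tri D) = (\<Union>i<nsub D. region (subd D i))"
  unfolding tri_eq region_def by blast

lemma Omega_sub_eq: "i < nsub D \<Longrightarrow> Omega_sub D i = interior (region (subm i))"
  by (simp add: Omega_sub_def region_subm)

lemma Omega_eq: "Omega D = interior (region (fmesh D))"
  by (simp add: Omega_def region_fmesh)

lemma finite_fmesh: "finite (fmesh D)"
  by (rule finite_refine[OF triangulation_tri])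

lemma subm_subset: "i < nsub D \<Longrightarrow> subm i \<subseteq> fmesh D"
  by (intro refine_mono subd_subset)

lemma finite_subm: "i < nsub D \<Longrightarrow> finite (subm i)"
  using finite_subset[OF subm_subset finite_fmesh] .

lemma fmesh_UN: "fmesh D = (\<Union>i<nsub D. subm i)"
proof
  show "(\<Union>i<nsub D. subm i) \<subseteq> fmesh D" using subm_subset by blast
  show "fmesh D \<subseteq> (\<Union>i<nsub D. subm i)"
  proof
    fix K assume "K \<in> fmesh D"
    then obtain L where L: "L \<in> tri D" "K \<in> refine {L}" by (rule refine_parent)
    then obtain i where "i < nsub D" "L \<in> subd D i" unfolding tri_eq by blast
    then show "K \<in> (\<Union>i<nsub D. subm i)" using L(2) refine_mono[of "{L}" "subd D i"] by blast
  qed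
qed

lemma closed_region_subd: "i < nsub D \<Longrightarrow> closed (region (subd D i))"
  unfolding region_def using subd_subset triangulation_tri finite_vertices[OF triangulation_tri]
  by (intro closed_UN ballI compact_imp_closed finite_imp_compact_convex_hull)
    (auto simp: triangulation_def intro: finite_subset)

text \<open>A nondegenerate triangle is the closure of its interior. This turns
  \<open>sharing\<close> and \<open>continuous_broken\<close>, stated with closures, into statements
  about closed triangles.\<close>

lemma closure_Omega_sub:
  assumes i: "i < nsub D" shows "closure (Omega_sub D i) = region (subd D i)"
proof
  show "closure (Omega_sub D i) \<subseteq> region (subd D i)"
    unfolding Omega_sub_def by (intro closure_minimal interior_subset closed_region_subd i)
  show "region (subd D i) \<subseteq> closure (Omega_sub D i)"
  proof
    fix x assume "x \<in> region (subd D i)"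
    then obtain K where K: "K \<in> subd D i" "x \<in> convex hull K" unfolding region_def by blast
    then have KM: "K \<in> tri D" using subd_subset[OF i] by blast
    then have "interior (convex hull K) \<noteq> {}"
      using triangulation_tri by (subst interior_convex_hull_eq_empty) (auto simp: triangulation_def)
    then have "closure (interior (convex hull K)) = closure (convex hull K)"
      by (intro convex_closure_interior convex_convex_hull)
    then have "x \<in> closure (interior (convex hull K))" using K(2) closure_subset by blast
    moreover have "interior (convex hull K) \<subseteq> Omega_sub D i"
      unfolding Omega_sub_def region_def using K(1) by (intro interior_mono) blast
    ultimately show "x \<in> closure (Omega_sub D i)" using closure_mono by blast
  qed
qed

lemma sharing_iff: "i \<in> sharing D x \<longleftrightarrow> i < nsub D \<and> x \<in> region (subd D i)"
  unfolding sharing_def using closure_Omega_sub by auto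

text \<open>A node is a vertex of a triangle in some subdomain, so it is shared by at least one; the
  counts 1 and at least 2 therefore cover all nodes.\<close>

lemma nodes_tri_dofs: "nodes (tri D) = set (pres_int D) \<union> set (pres_gam D)"
proof -
  have "card (sharing D x) \<ge> 1" if x: "x \<in> nodes (tri D)" for x
  proof -
    obtain i K where "i < nsub D" "K \<in> subd D i" "x \<in> K"
      using x unfolding nodes_def tri_eq by blast
    then have "i \<in> sharing D x" unfolding sharing_iff region_def by (auto intro: hull_inc)
    moreover have "finite (sharing D x)" unfolding sharing_def by simp
    ultimately show ?thesis by (metis One_nat_def Suc_leI card_gt_0_iff empty_iff)
  qed
  then have "card (sharing D x) = 1 \<or> card (sharing D x) \<ge> 2" if "x \<in> nodes (tri D)" for x
    using that by (metis One_nat_def Suc_1 le_SucE not_less_eq_eq order_antisym_conv)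
  then show ?thesis using dofs unfolding numbered_dofs_def by auto
qed

lemma pres_dofs:
  shows "distinct (pres_int D)" "distinct (pres_gam D)" "set (pres_int D) \<inter> set (pres_gam D) = {}"
  using dofs unfolding numbered_dofs_def by auto

lemma nodes_tri_nonempty: "nodes (tri D) \<noteq> {}"
proof -
  have "subd D 0 \<noteq> {}" "0 < nsub D" using dom unfolding decomposed_domain_def by auto
  then obtain K where "K \<in> tri D" unfolding tri_eq by blast
  moreover have "K \<noteq> {}" using card_tri[OF \<open>K \<in> tri D\<close>] by auto
  ultimately show ?thesis unfolding nodes_def by blast
qed

section \<open>The discrete velocity and pressure spaces and their bases\<close>

lemma V_P1: "u \<in> V \<Longrightarrow> u \<in> P1 (fmesh D)"
  by (simp add: velocity_space_def)

lemma V_sum: "(\<And>k. k \<in> I \<Longrightarrow> u k \<in> V) \<Longrightarrow> (\<lambda>x. \<Sum>k\<in>I. c k *\<^sub>R u k x) \<in> V"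
  unfolding velocity_space_def by (auto intro!: P1_sum P1_scaleR sum.neutral)

lemma V_diff: "u \<in> V \<Longrightarrow> v \<in> V \<Longrightarrow> (\<lambda>x. u x - v x) \<in> V"
  unfolding velocity_space_def by (auto intro!: P1_diff)

lemma V_zero: "(\<lambda>_. 0) \<in> V"
  unfolding velocity_space_def by (simp add: P1_zero)

lemma V_piecewise_affine: "u \<in> V \<Longrightarrow> i < nsub D \<Longrightarrow> piecewise_affine (subm i) u"
  by (rule P1_piecewise_affine[OF V_P1 subm_subset])

text \<open>The node is interior to the domain while a frontier point is not, so the zero boundary
  values come from \<open>hat_zero_off_interior\<close>.\<close>

lemma hat_in_V:
  assumes "(x, c) \<in> set (vel_int D)"
  shows "(\<lambda>y. hat (fmesh D) x y *\<^sub>R axis c 1) \<in> V"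
proof -
  have x: "x \<in> nodes (fmesh D)" and "\<exists>i<nsub D. x \<in> Omega_sub D i"
    using assms dofs unfolding numbered_dofs_def by auto
  then obtain i where i: "i < nsub D" "x \<in> Omega_sub D i" by blast
  have P: "hat (fmesh D) x \<in> P1 (fmesh D)" by (rule hat_refine_P1[OF triangulation_tri x])
  have node: "hat (fmesh D) x y = (if y = x then 1 else 0)" if "y \<in> nodes (fmesh D)" for y
    by (rule hat_refine_node[OF triangulation_tri x that])
  have xO: "x \<in> interior (region (fmesh D))"
  proof -
    have "region (subd D i) \<subseteq> region (fmesh D)"
      using i(1) unfolding region_fmesh region_tri_UN by blast
    then show ?thesis using i(2) interior_mono unfolding Omega_sub_def by blast
  qed
  have "hat (fmesh D) x y = 0" if "y \<in> frontier (Omega D)" for y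
  proof (rule hat_zero_off_interior[OF finite_fmesh finite_refine_triangle P _ _ xO])
    show "y \<notin> interior (region (fmesh D))"
      using that unfolding Omega_eq frontier_def by (simp add: interior_open)
  qed (use node x in auto)
  then show ?thesis unfolding velocity_space_def using P1_scaleR_vector[OF P] by auto
qed

lemma length_basis [simp]:
  "length (basis_I D) = length (vel_int D)" "length (basis_Dlt D) = length (copies D)"
  "length (basis_Pi D) = length (primal D)" "length (basis_pI D) = length (pres_int D)"
  "length (basis_pG D) = length (pres_gam D)"
  by (simp_all add: basis_I_def basis_Dlt_def basis_Pi_def basis_pI_def basis_pG_def)

lemma split_functions:
  shows "f \<in> set (primal D) \<Longrightarrow> f \<in> V" "z \<in> set (dual D) \<Longrightarrow> snd z \<in> V"
proof -
  have "set (primal D @ map snd (dual D)) \<subseteq> velocity_gam D"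
    using split unfolding primal_dual_split_def function_basis_def by blast
  then show "f \<in> set (primal D) \<Longrightarrow> f \<in> V" "z \<in> set (dual D) \<Longrightarrow> snd z \<in> V"
    unfolding velocity_gam_def by auto
qed

lemma copies_dofs: "s < length (copies D) \<Longrightarrow> fst (copies D ! s) < length (dual D)"
  using split nth_mem[of s "copies D"] unfolding primal_dual_split_def
  by (metis (no_types, lifting) case_prodD mem_Collect_eq prod.collapse)

lemma basis_in_V:
  shows "k < length (vel_int D) \<Longrightarrow> (basis_I D ! k) i \<in> V"
    and "k < length (primal D) \<Longrightarrow> (basis_Pi D ! k) i \<in> V"
    and "k < length (copies D) \<Longrightarrow> (basis_Dlt D ! k) i \<in> V"
proof -
  assume k: "k < length (vel_int D)"
  then show "(basis_I D ! k) i \<in> V"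
    using hat_in_V[of "fst (vel_int D ! k)" "snd (vel_int D ! k)"] nth_mem[OF k]
    by (simp add: basis_I_def case_prod_beta)
next
  show "k < length (primal D) \<Longrightarrow> (basis_Pi D ! k) i \<in> V"
    by (simp add: basis_Pi_def split_functions)
next
  assume k: "k < length (copies D)"
  have "snd (dual D ! fst (copies D ! k)) \<in> V" using copies_dofs[OF k] by (intro split_functions nth_mem)
  then show "(basis_Dlt D ! k) i \<in> V"
    using k V_zero by (simp add: basis_Dlt_def case_prod_beta)
qed

definition velocity_family :: "broken list \<Rightarrow> bool" where
  "velocity_family vs \<longleftrightarrow> (\<forall>k<length vs. \<forall>i. (vs ! k) i \<in> V)"

definition pressure_family :: "(point \<Rightarrow> real) list \<Rightarrow> bool" where
  "pressure_family qs \<longleftrightarrow> set qs \<subseteq> P1 (tri D)"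

lemma velocity_family_basis: "velocity_family (basis_I D)" "velocity_family (basis_Dlt D)" "velocity_family (basis_Pi D)"
  unfolding velocity_family_def by (simp_all add: basis_in_V)

lemma pressure_family_basis: "pressure_family (basis_pI D)" "pressure_family (basis_pG D)"
  unfolding pressure_family_def basis_pI_def basis_pG_def using hat_P1[OF triangulation_tri] by auto

lemma comb_in_V: "velocity_family vs \<Longrightarrow> comb vs c i \<in> V"
  unfolding comb_def velocity_family_def by (intro V_sum) auto

lemma pcomb_P1: "pressure_family qs \<Longrightarrow> pcomb qs p \<in> P1 (tri D)"
proof -
  assume "pressure_family qs"
  then have "(\<lambda>x. \<Sum>k<length qs. vec_index p k *\<^sub>R (qs ! k) x) \<in> P1 (tri D)"
    by (intro P1_sum P1_scaleR) (auto simp: pressure_family_def)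
  then show ?thesis by (simp add: pcomb_def)
qed

lemma P1_continuous_on_subm: "q \<in> P1 (tri D) \<Longrightarrow> i < nsub D \<Longrightarrow> continuous_on (region (subm i)) q"
  by (rule continuous_on_subset[of "region (tri D)"]) (auto simp: P1_iff region_subm region_tri_UN)

text \<open>Summed over subdomains because a \<open>broken\<close> velocity may have different
  values from two sides and no single gradient on the domain.\<close>

definition a_sum :: "broken \<Rightarrow> broken \<Rightarrow> real" where
  "a_sum u v = (\<Sum>i<nsub D. a_form (Omega_sub D i) (u i) (v i))"

definition b_sum :: "broken \<Rightarrow> (point \<Rightarrow> real) \<Rightarrow> real" where
  "b_sum u q = (\<Sum>i<nsub D. b_form (Omega_sub D i) (u i) q)"

text \<open>With its counterpart for \<open>B_mat\<close>, this trades matrix blocks for forms, so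
  that later steps can test with functions instead of computing entries.\<close>

lemma A_mat_bilinear:
  assumes us: "velocity_family us" and vs: "velocity_family vs" and ab: "a \<in> carrier_vec (length us)" "b \<in> carrier_vec (length vs)"
  shows "scalar_prod a (A_mat D us vs *\<^sub>v b) = a_sum (comb us a) (comb vs b)"
proof -
  have "a_form (Omega_sub D i) (comb us a i) (comb vs b i) =
      (\<Sum>r<length us. \<Sum>s<length vs. vec_index a r * (vec_index b s * a_form (Omega_sub D i) ((us ! r) i) ((vs ! s) i)))"
    if i: "i < nsub D" for i
  proof -
    note N = finite_subm[OF i] finite_refine_triangle[of _ "subd D i"] Omega_sub_eq[OF i]
    have "a_form (Omega_sub D i) (comb us a i) (comb vs b i) =
        (\<Sum>r<length us. vec_index a r * a_form (Omega_sub D i) ((us ! r) i) (comb vs b i))"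
      unfolding comb_def[of us]
      using us V_piecewise_affine[OF comb_in_V[OF vs] i] i
      by (intro a_form_sum_left[OF N]) (auto simp: velocity_family_def intro: V_piecewise_affine)
    also have "\<dots> = (\<Sum>r<length us. vec_index a r *
        (\<Sum>s<length vs. vec_index b s * a_form (Omega_sub D i) ((us ! r) i) ((vs ! s) i)))"
      unfolding comb_def
      using us vs i
      by (intro sum.cong refl arg_cong2[where f = "(*)"] a_form_sum_right[OF N])
        (auto simp: velocity_family_def intro: V_piecewise_affine)
    finally show ?thesis by (simp add: sum_distrib_left)
  qed
  then have "a_sum (comb us a) (comb vs b) =
      (\<Sum>i<nsub D. \<Sum>r<length us. \<Sum>s<length vs. vec_index a r * (vec_index b s * a_form (Omega_sub D i) ((us ! r) i) ((vs ! s) i)))"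
    unfolding a_sum_def by simp
  also have "\<dots> = (\<Sum>r<length us. \<Sum>i<nsub D. \<Sum>s<length vs. vec_index a r * (vec_index b s * a_form (Omega_sub D i) ((us ! r) i) ((vs ! s) i)))"
    by (rule sum.swap)
  also have "\<dots> = (\<Sum>r<length us. \<Sum>s<length vs. \<Sum>i<nsub D. vec_index a r * (vec_index b s * a_form (Omega_sub D i) ((us ! r) i) ((vs ! s) i)))"
    by (intro sum.cong refl sum.swap)
  also have "\<dots> = (\<Sum>r<length us. vec_index a r * (\<Sum>s<length vs. A_mat D us vs $$ (r, s) * vec_index b s))"
    by (intro sum.cong refl) (simp add: A_mat_def sum_distrib_left sum_distrib_right mult_ac)
  also have "\<dots> = scalar_prod a (A_mat D us vs *\<^sub>v b)"
    using ab by (simp add: scalar_prod_def A_mat_def atLeast0LessThan)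
  finally show ?thesis by simp
qed

lemma B_mat_bilinear:
  assumes us: "velocity_family us" and qs: "pressure_family qs" and pw: "p \<in> carrier_vec (length qs)" "w \<in> carrier_vec (length us)"
  shows "scalar_prod p (B_mat D qs us *\<^sub>v w) = b_sum (comb us w) (pcomb qs p)"
proof -
  have "b_form (Omega_sub D i) (comb us w i) (pcomb qs p) =
      (\<Sum>r<length qs. \<Sum>s<length us. vec_index p r * (vec_index w s * b_form (Omega_sub D i) ((us ! s) i) (qs ! r)))"
    if i: "i < nsub D" for i
  proof -
    note N = finite_subm[OF i] finite_refine_triangle[of _ "subd D i"] Omega_sub_eq[OF i]
    have q: "continuous_on (region (subm i)) (qs ! r)" if "r < length qs" for r
      using qs that i by (intro P1_continuous_on_subm) (auto simp: pressure_family_def)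
    have "b_form (Omega_sub D i) (comb us w i) (pcomb qs p) =
        (\<Sum>r<length qs. vec_index p r * b_form (Omega_sub D i) (comb us w i) (qs ! r))"
      unfolding pcomb_def
      using q V_piecewise_affine[OF comb_in_V[OF us] i] by (intro b_form_sum_right[OF N]) auto
    also have "\<dots> = (\<Sum>r<length qs. vec_index p r *
        (\<Sum>s<length us. vec_index w s * b_form (Omega_sub D i) ((us ! s) i) (qs ! r)))"
      unfolding comb_def using us q i
      by (intro sum.cong refl arg_cong2[where f = "(*)"] b_form_sum_left[OF N])
        (auto simp: velocity_family_def intro: V_piecewise_affine)
    finally show ?thesis by (simp add: sum_distrib_left)
  qed
  then have "b_sum (comb us w) (pcomb qs p) =
      (\<Sum>i<nsub D. \<Sum>r<length qs. \<Sum>s<length us. vec_index p r * (vec_index w s * b_form (Omega_sub D i) ((us ! s) i) (qs ! r)))"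
    unfolding b_sum_def by simp
  also have "\<dots> = (\<Sum>r<length qs. \<Sum>i<nsub D. \<Sum>s<length us. vec_index p r * (vec_index w s * b_form (Omega_sub D i) ((us ! s) i) (qs ! r)))"
    by (rule sum.swap)
  also have "\<dots> = (\<Sum>r<length qs. \<Sum>s<length us. \<Sum>i<nsub D. vec_index p r * (vec_index w s * b_form (Omega_sub D i) ((us ! s) i) (qs ! r)))"
    by (intro sum.cong refl sum.swap)
  also have "\<dots> = (\<Sum>r<length qs. vec_index p r * (\<Sum>s<length us. B_mat D qs us $$ (r, s) * vec_index w s))"
    by (intro sum.cong refl) (simp add: B_mat_def sum_distrib_left sum_distrib_right mult_ac)
  also have "\<dots> = scalar_prod p (B_mat D qs us *\<^sub>v w)"
    using pw by (simp add: scalar_prod_def B_mat_def atLeast0LessThan)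
  finally show ?thesis by simp
qed

lemma a_sum_commute: "a_sum u v = a_sum v u"
  unfolding a_sum_def by (simp add: a_form_commute)

lemma a_sum_nonneg: "(\<And>i. i < nsub D \<Longrightarrow> u i \<in> V) \<Longrightarrow> 0 \<le> a_sum u u"
  unfolding a_sum_def
  by (intro sum_nonneg a_form_nonneg[OF finite_subm finite_refine_triangle Omega_sub_eq])
    (auto intro: V_piecewise_affine)

lemma a_sum_add_left:
  assumes "\<And>i. u i \<in> V" "\<And>i. v i \<in> V" "\<And>i. w i \<in> V"
  shows "a_sum (\<lambda>i x. u i x + v i x) w = a_sum u w + a_sum v w"
proof -
  \<comment> \<open>The two summands are indexed by \<open>bool\<close>, which makes this an
    instance of the rule for finite linear combinations.\<close>
  have "a_form (Omega_sub D i) (\<lambda>x. u i x + v i x) (w i) =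
      a_form (Omega_sub D i) (u i) (w i) + a_form (Omega_sub D i) (v i) (w i)" if i: "i < nsub D" for i
    using a_form_sum_left[OF finite_subm[OF i] finite_refine_triangle[of _ "subd D i"] Omega_sub_eq[OF i],
        where I = "UNIV :: bool set" and u = "\<lambda>b. if b then u i else v i" and v = "w i" and c = "\<lambda>_. 1"] assms V_piecewise_affine[OF _ i]
    by (simp add: UNIV_bool add.commute)
  then show ?thesis unfolding a_sum_def by (simp add: sum.distrib)
qed

lemma b_sum_add_left:
  assumes "\<And>i. u i \<in> V" "\<And>i. v i \<in> V" "q \<in> P1 (tri D)"
  shows "b_sum (\<lambda>i x. u i x + v i x) q = b_sum u q + b_sum v q"
proof -
  have "b_form (Omega_sub D i) (\<lambda>x. u i x + v i x) q =
      b_form (Omega_sub D i) (u i) q + b_form (Omega_sub D i) (v i) q" if i: "i < nsub D" for i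
    using b_form_sum_left[OF finite_subm[OF i] finite_refine_triangle[of _ "subd D i"] Omega_sub_eq[OF i],
        where I = "UNIV :: bool set" and u = "\<lambda>b. if b then u i else v i" and q = q and c = "\<lambda>_. 1"] assms V_piecewise_affine[OF _ i] P1_continuous_on_subm[OF assms(3) i]
    by (simp add: UNIV_bool add.commute)
  then show ?thesis unfolding b_sum_def by (simp add: sum.distrib)
qed

lemma b_sum_lincomb_right:
  assumes "\<And>i. u i \<in> V" "q \<in> P1 (tri D)" "r \<in> P1 (tri D)"
  shows "b_sum u (\<lambda>x. s * q x + t * r x) = s * b_sum u q + t * b_sum u r"
proof -
  have "b_form (Omega_sub D i) (u i) (\<lambda>x. s * q x + t * r x) =
      s * b_form (Omega_sub D i) (u i) q + t * b_form (Omega_sub D i) (u i) r" if i: "i < nsub D" for i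
    using b_form_sum_right[OF finite_subm[OF i] finite_refine_triangle[of _ "subd D i"] Omega_sub_eq[OF i],
        where I = "UNIV :: bool set" and u = "u i" and q = "\<lambda>b. if b then q else r"
          and c = "\<lambda>b. if b then s else t"] assms V_piecewise_affine[OF _ i] P1_continuous_on_subm[OF assms(2) i] P1_continuous_on_subm[OF assms(3) i]
    by (simp add: UNIV_bool add.commute)
  then show ?thesis unfolding b_sum_def by (simp add: sum.distrib sum_distrib_left)
qed

lemma b_sum_cong:
  assumes "\<And>i x. i < nsub D \<Longrightarrow> x \<in> region (subd D i) \<Longrightarrow> u i x = v i x"
  shows "b_sum u q = b_sum v q"
  unfolding b_sum_def
proof (intro sum.cong refl b_form_cong)
  show "u i x = v i x" if "i \<in> {..<nsub D}" "x \<in> Omega_sub D i" for i x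
    using that interior_subset by (intro assms) (auto simp: Omega_sub_def)
qed (simp_all add: Omega_sub_def)

text \<open>Triangles of different subdomains overlap in null sets only, so splitting the integral
  loses nothing.\<close>

lemma b_form_Omega:
  assumes u: "u \<in> V" and q: "q \<in> P1 (tri D)"
  shows "b_form (Omega D) u q = b_sum (\<lambda>_. u) q"
proof -
  have "integral (interior (region (\<Union>i\<in>{..<nsub D}. subm i))) (\<lambda>x. trace (grad u x) * q x) =
      (\<Sum>i\<in>{..<nsub D}. integral (interior (region (subm i))) (\<lambda>x. trace (grad u x) * q x))"
  proof (rule integral_interior_region_UN)
    fix i j assume "i \<in> {..<nsub D}" "j \<in> {..<nsub D}" "i \<noteq> j"
    then have ij: "i < nsub D" "j < nsub D" "i \<noteq> j" by auto
    have disj: "subd D i \<inter> subd D j = {}"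
      using dom ij unfolding decomposed_domain_def by blast
    have "negligible (\<Union>K\<in>subd D i. \<Union>L\<in>subd D j. convex hull K \<inter> convex hull L)"
    proof (intro negligible_Union)
      have fin: "finite (subd D k)" if "k < nsub D" for k
        using subd_subset[OF that] triangulation_tri by (auto simp: triangulation_def intro: finite_subset)
      show "finite ((\<lambda>K. \<Union>L\<in>subd D j. convex hull K \<inter> convex hull L) ` subd D i)" using fin ij by blast
      fix T assume "T \<in> (\<lambda>K. \<Union>L\<in>subd D j. convex hull K \<inter> convex hull L) ` subd D i"
      then obtain K where K: "K \<in> subd D i" "T = (\<Union>L\<in>subd D j. convex hull K \<inter> convex hull L)" by blast
      show "negligible T" unfolding K(2)
      proof (intro negligible_Union)
        show "finite ((\<lambda>L. convex hull K \<inter> convex hull L) ` subd D j)" using fin ij by blast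
        fix T' assume "T' \<in> (\<lambda>L. convex hull K \<inter> convex hull L) ` subd D j"
        then obtain L where L: "L \<in> subd D j" "T' = convex hull K \<inter> convex hull L" by blast
        show "negligible T'" unfolding L(2)
          using K L disj ij subd_subset by (intro negligible_Int_triangles[OF triangulation_tri]) blast+
      qed
    qed
    moreover have "region (subd D i) \<inter> region (subd D j) \<subseteq> (\<Union>K\<in>subd D i. \<Union>L\<in>subd D j. convex hull K \<inter> convex hull L)"
      unfolding region_def by blast
    ultimately show "negligible (region (subm i) \<inter> region (subm j))"
      unfolding region_subm[OF ij(1)] region_subm[OF ij(2)] by (rule negligible_subset)
  next
    fix i assume "i \<in> {..<nsub D}"
    then have i: "i < nsub D" by simp
    show "finite (subm i)" by (rule finite_subm[OF i])
    show "(\<lambda>x. trace (grad u x) * q x) integrable_on interior (region (subm i))"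
      by (rule b_form_integrable[OF finite_subm[OF i] finite_refine_triangle refl
            V_piecewise_affine[OF u i] P1_continuous_on_subm[OF q i]])
  qed simp
  then show ?thesis
    unfolding b_sum_def b_form_def Omega_eq fmesh_UN using Omega_sub_eq by (simp add: sum_negf)
qed

text \<open>Both directions are used: constants in the kernel give the null vector, and kernel
  elements being constant gives uniqueness.\<close>

lemma kernel_iff:
  assumes q: "q \<in> P1 (tri D)"
  shows "(\<forall>u\<in>V. b_sum (\<lambda>_. u) q = 0) \<longleftrightarrow> (\<exists>c. \<forall>x\<in>region (tri D). q x = c)"
proof -
  have "(\<forall>u\<in>V. b_form (Omega D) u q = 0) \<longleftrightarrow> (\<exists>c. \<forall>x\<in>region (tri D). q x = c)"
    using ker_BT q unfolding ker_BT_constants_def pressure_space_def by (auto simp: set_eq_iff)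
  then show ?thesis using b_form_Omega[OF _ q] by simp
qed

text \<open>The pieces agree at common points, so any subdomain containing a point may define the
  value there. Continuity follows from the finite closed cover, and the boundary values are
  inherited from the pieces.\<close>

lemma glue_continuous_broken:
  assumes w: "\<And>i. w i \<in> V" and cont: "continuous_broken D w"
  obtains u where "u \<in> V" "\<And>i x. i < nsub D \<Longrightarrow> x \<in> region (subd D i) \<Longrightarrow> u x = w i x"
proof -
  define u where "u = (\<lambda>x. if x \<in> region (tri D) then w (SOME i. i < nsub D \<and> x \<in> region (subd D i)) x else 0)"
  have u: "u x = w i x" if "i < nsub D" "x \<in> region (subd D i)" for i x
  proof -
    let ?j = "SOME i. i < nsub D \<and> x \<in> region (subd D i)"
    have j: "?j < nsub D \<and> x \<in> region (subd D ?j)" by (rule someI_ex) (use that in blast)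
    have "x \<in> region (tri D)" using that unfolding region_tri_UN by blast
    then have "u x = w ?j x" unfolding u_def by (rule if_P)
    also have "\<dots> = w i x"
    proof -
      have "x \<in> closure (Omega_sub D ?j) \<inter> closure (Omega_sub D i)"
        using j that closure_Omega_sub by blast
      then show ?thesis using cont j that(1) unfolding continuous_broken_def by blast
    qed
    finally show ?thesis .
  qed
  have "u \<in> P1 (fmesh D)"
    unfolding P1_iff region_fmesh
  proof (intro conjI ballI allI impI)
    have "continuous_on (\<Union>i\<in>{..<nsub D}. region (subd D i)) u"
    proof (rule continuous_on_closed_Union)
      fix i assume "i \<in> {..<nsub D}"
      then have i: "i < nsub D" by simp
      show "closed (region (subd D i))" by (rule closed_region_subd[OF i])
      have "continuous_on (region (tri D)) (w i)"
        using V_P1[OF w] by (simp add: P1_iff region_fmesh)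
      then have "continuous_on (region (subd D i)) (w i)"
        by (rule continuous_on_subset) (use i in \<open>auto simp: region_tri_UN\<close>)
      then show "continuous_on (region (subd D i)) u"
        by (rule continuous_on_eq) (simp add: u[OF i])
    qed simp
    then show "continuous_on (region (tri D)) u" by (simp add: region_tri_UN)
  next
    fix K assume "K \<in> fmesh D"
    then obtain i where i: "i < nsub D" "K \<in> subm i" unfolding fmesh_UN by blast
    have "convex hull K \<subseteq> region (subm i)"
      unfolding region_def using i(2) by (rule UN_upper)
    then have "convex hull K \<subseteq> region (subd D i)" unfolding region_subm[OF i(1)] .
    then have "u x = w i x" if "x \<in> convex hull K" for x using that by (intro u i(1)) (rule subsetD)
    with P1_affine_on[OF V_P1[OF w] \<open>K \<in> fmesh D\<close>] show "affine_on (convex hull K) u"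
      by (rule affine_on_cong)
  next
    show "u x = 0" if "x \<notin> region (tri D)" for x using that by (simp add: u_def)
  qed
  moreover have "u x = 0" if "x \<in> frontier (Omega D)" for x
  proof (cases "x \<in> region (tri D)")
    case True
    then obtain i where "i < nsub D" "x \<in> region (subd D i)"
      unfolding region_tri_UN by (elim UN_E) simp
    then have "u x = w i x" by (rule u)
    also have "w i x = 0" using w[of i] that unfolding velocity_space_def by blast
    finally show ?thesis .
  next
    case False
    then show ?thesis unfolding u_def by (rule if_not_P)
  qed
  ultimately have "u \<in> V" unfolding velocity_space_def by blast
  then show thesis by (rule that) (rule u)
qed

section \<open>Decomposition of continuous velocities in the broken basis\<close>

lemma Dlt_function_eq: "Dlt_function D c = comb (basis_Dlt D) c"
  by (simp add: Dlt_function_def comb_def)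

lemma comb_I_eq:
  "comb (basis_I D) c i x =
    (\<Sum>k<length (vel_int D). vec_index c k *\<^sub>R (hat (fmesh D) (fst (vel_int D ! k)) x *\<^sub>R axis (snd (vel_int D ! k)) 1))"
  unfolding comb_def by (auto simp: basis_I_def case_prod_beta intro!: sum.cong)

lemma comb_Pi_eq:
  "comb (basis_Pi D) c i x = (\<Sum>k<length (primal D). vec_index c k *\<^sub>R (primal D ! k) x)"
  unfolding comb_def by (auto simp: basis_Pi_def intro!: sum.cong)

text \<open>By hypothesis \<open>c\<close> all copies of a dual degree of freedom carry the same
  coefficient. A subdomain without a copy misses the corresponding term, but the dual function
  vanishes there.\<close>

lemma comb_Dlt_eq:
  assumes i: "i < nsub D" and x: "x \<in> region (subd D i)"
    and c: "\<And>s. s < length (copies D) \<Longrightarrow> vec_index c s = d (fst (copies D ! s))"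
  shows "comb (basis_Dlt D) c i x = (\<Sum>k<length (dual D). d k *\<^sub>R snd (dual D ! k) x)"
proof -
  let ?g = "\<lambda>(k, j). if j = i then d k *\<^sub>R snd (dual D ! k) x else 0"
  have "comb (basis_Dlt D) c i x = (\<Sum>s<length (copies D). ?g (copies D ! s))"
    unfolding comb_def by (auto simp: basis_Dlt_def c case_prod_beta intro!: sum.cong)
  also have "\<dots> = (\<Sum>z\<in>set (copies D). ?g z)"
    using split unfolding primal_dual_split_def by (intro sum_nth_distinct) blast
  also have "set (copies D) = (SIGMA k:{..<length (dual D)}. sharing D (fst (dual D ! k)))"
    using split unfolding primal_dual_split_def by auto
  also have "(\<Sum>z\<in>\<dots>. ?g z) = (\<Sum>k<length (dual D). \<Sum>j\<in>sharing D (fst (dual D ! k)). ?g (k, j))"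
    by (subst sum.Sigma) (auto simp: sharing_def)
  also have "\<dots> = (\<Sum>k<length (dual D). d k *\<^sub>R snd (dual D ! k) x)"
  proof (intro sum.cong refl)
    fix k assume "k \<in> {..<length (dual D)}"
    then have k: "dual D ! k \<in> set (dual D)" by simp
    have fin: "finite (sharing D (fst (dual D ! k)))" by (simp add: sharing_def)
    have "snd (dual D ! k) x = 0" if "i \<notin> sharing D (fst (dual D ! k))"
    proof -
      have "\<forall>(x, f)\<in>set (dual D). \<forall>i<nsub D. i \<notin> sharing D x \<longrightarrow> (\<forall>y\<in>closure (Omega_sub D i). f y = 0)"
        using split unfolding primal_dual_split_def by blast
      from bspec[OF this k] show ?thesis
        using that i x by (simp add: case_prod_beta closure_Omega_sub)
    qed
    then show "(\<Sum>j\<in>sharing D (fst (dual D ! k)). ?g (k, j)) = d k *\<^sub>R snd (dual D ! k) x"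
      using fin by (cases "i \<in> sharing D (fst (dual D ! k))") (auto intro!: sum.neutral)
  qed
  finally show ?thesis .
qed

text \<open>The basis functions are nodal, so subtracting this combination from \<open>u\<close>
  clears exactly the values at nodes inside subdomains.\<close>

lemma nodal_part:
  fixes u :: "point \<Rightarrow> point"
  assumes y: "y \<in> nodes (fmesh D)"
  shows "comb (basis_I D) (Matrix.vec (length (vel_int D))
      (\<lambda>k. u (fst (vel_int D ! k)) $ snd (vel_int D ! k))) i y
    = (if \<exists>i<nsub D. y \<in> Omega_sub D i then u y else 0)"
proof -
  let ?Y = "{x \<in> nodes (fmesh D). \<exists>i<nsub D. x \<in> Omega_sub D i}"
  let ?g = "\<lambda>z. (u (fst z) $ snd z) *\<^sub>R ((if y = fst z then 1 else 0) *\<^sub>R axis (snd z) (1::real))"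
  have set: "set (vel_int D) = ?Y \<times> UNIV" and dist: "distinct (vel_int D)"
    using dofs unfolding numbered_dofs_def by auto
  have finY: "finite ?Y"
  proof -
    have "finite (?Y \<times> (UNIV :: 2 set))" unfolding set[symmetric] by simp
    then show ?thesis using finite_cartesian_productD1[of ?Y "UNIV :: 2 set"] by simp
  qed
  have "comb (basis_I D) (Matrix.vec (length (vel_int D)) (\<lambda>k. u (fst (vel_int D ! k)) $ snd (vel_int D ! k))) i y
      = (\<Sum>k<length (vel_int D). ?g (vel_int D ! k))"
    unfolding comb_I_eq
  proof (intro sum.cong refl)
    fix k assume k: "k \<in> {..<length (vel_int D)}"
    then have "vel_int D ! k \<in> ?Y \<times> UNIV" unfolding set[symmetric] by simp
    then have "fst (vel_int D ! k) \<in> nodes (fmesh D)" by auto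
    from hat_refine_node[OF triangulation_tri this y] k
    show "vec_index (Matrix.vec (length (vel_int D)) (\<lambda>k. u (fst (vel_int D ! k)) $ snd (vel_int D ! k))) k *\<^sub>R
        (hat (fmesh D) (fst (vel_int D ! k)) y *\<^sub>R axis (snd (vel_int D ! k)) 1) = ?g (vel_int D ! k)"
      by simp
  qed
  also have "\<dots> = (\<Sum>z\<in>?Y \<times> UNIV. ?g z)"
    using sum_nth_distinct[OF dist, of ?g] unfolding set .
  also have "\<dots> = (\<Sum>x\<in>?Y. \<Sum>c\<in>UNIV. ?g (x, c))"
    by (simp add: sum.cartesian_product case_prod_beta)
  also have "\<dots> = (\<Sum>x\<in>?Y. if y = x then u x else 0)"
  proof (intro sum.cong refl)
    fix x
    have "(\<Sum>c\<in>UNIV. (u x $ c) *\<^sub>R axis c (1::real)) = u x"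
      unfolding Finite_Cartesian_Product.vec_eq_iff
      by (auto simp: sum_component axis_def if_distrib cong: if_cong)
    then show "(\<Sum>c\<in>UNIV. ?g (x, c)) = (if y = x then u x else 0)" by simp
  qed
  also have "\<dots> = (if \<exists>i<nsub D. y \<in> Omega_sub D i then u y else 0)"
    using finY y by auto
  finally show ?thesis .
qed

text \<open>After subtraction of the interior part, the remainder vanishes at all nodes off the
  interface and expands in the primal and dual functions. Giving every copy the coefficient of its
  dual function makes the dual part continuous, so \<open>jump D\<close> annihilates it.\<close>

lemma velocity_decomposition:
  assumes u: "u \<in> V"
  obtains a d r where "a \<in> carrier_vec (length (vel_int D))" "d \<in> carrier_vec (length (copies D))"
    "r \<in> carrier_vec (length (primal D))" "jump D *\<^sub>v d = 0\<^sub>v (dim_row (jump D))"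
    "\<And>i x. i < nsub D \<Longrightarrow> x \<in> region (subd D i) \<Longrightarrow>
      u x = comb (basis_I D) a i x + comb (basis_Dlt D) d i x + comb (basis_Pi D) r i x"
proof -
  define a where "a = Matrix.vec (length (vel_int D)) (\<lambda>k. u (fst (vel_int D ! k)) $ snd (vel_int D ! k))"
  define v where "v = (\<lambda>x. u x - comb (basis_I D) a 0 x)"
  have vV: "v \<in> V" unfolding v_def by (intro V_diff u comb_in_V velocity_family_basis)
  have "v y = 0" if y: "y \<in> nodes (fmesh D)" "y \<notin> interface D" for y
  proof (cases "\<exists>i<nsub D. y \<in> Omega_sub D i")
    case True
    then show ?thesis using nodal_part[OF y(1), of u 0] by (simp add: v_def a_def)
  next
    \<comment> \<open>A node in no open subdomain lies on the frontier of one. Being off the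
      interface, it is on the boundary of the domain, where velocities vanish.\<close>
    case False
    have "y \<in> region (fmesh D)" using y(1) unfolding nodes_def region_def by (auto intro: hull_inc)
    then obtain i where i: "i < nsub D" "y \<in> region (subd D i)"
      unfolding region_fmesh region_tri_UN by blast
    have "interior (Omega_sub D i) = Omega_sub D i" by (simp add: Omega_sub_def)
    then have "y \<in> frontier (Omega_sub D i)"
      using i False unfolding frontier_def by (simp add: closure_Omega_sub)
    then have "y \<in> frontier (Omega D)" using i(1) y(2) unfolding interface_def by blast
    then show ?thesis using vV by (simp add: velocity_space_def)
  qed
  then have "v \<in> velocity_gam D" using vV by (simp add: velocity_gam_def)
  let ?fs = "primal D @ map snd (dual D)"
  have "function_basis ?fs (velocity_gam D)"
    using split unfolding primal_dual_split_def by blast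
  then obtain c where c: "c \<in> carrier_vec (length ?fs)" "v = (\<lambda>x. \<Sum>k<length ?fs. vec_index c k *\<^sub>R (?fs ! k) x)"
    using \<open>v \<in> velocity_gam D\<close> unfolding function_basis_def by blast
  define r where "r = Matrix.vec (length (primal D)) (\<lambda>k. vec_index c k)"
  define e where "e = (\<lambda>k. vec_index c (length (primal D) + k))"
  define d where "d = Matrix.vec (length (copies D)) (\<lambda>s. e (fst (copies D ! s)))"
  have v_eq: "v x = comb (basis_Pi D) r i x + (\<Sum>k<length (dual D). e k *\<^sub>R snd (dual D ! k) x)" for i x
  proof -
    have "v x = (\<Sum>k<length (primal D) + length (dual D). vec_index c k *\<^sub>R (?fs ! k) x)"
      unfolding c(2) by simp
    also have "\<dots> = (\<Sum>k<length (primal D). vec_index c k *\<^sub>R (?fs ! k) x) +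
        (\<Sum>k<length (dual D). vec_index c (length (primal D) + k) *\<^sub>R (?fs ! (length (primal D) + k)) x)"
      by (rule sum_lessThan_add)
    finally show ?thesis by (simp add: comb_Pi_eq r_def e_def nth_append)
  qed
  have d_eq: "comb (basis_Dlt D) d i x = (\<Sum>k<length (dual D). e k *\<^sub>R snd (dual D ! k) x)"
    if "i < nsub D" "x \<in> region (subd D i)" for i x
    by (rule comb_Dlt_eq[OF that]) (simp add: d_def)
  have "continuous_broken D (comb (basis_Dlt D) d)"
    unfolding continuous_broken_def using d_eq by (simp add: closure_Omega_sub)
  then have "jump D *\<^sub>v d = 0\<^sub>v (dim_row (jump D))"
    using jumps unfolding jump_constraints_def Dlt_function_eq by (simp add: d_def)
  moreover have "u x = comb (basis_I D) a i x + comb (basis_Dlt D) d i x + comb (basis_Pi D) r i x"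
    if "i < nsub D" "x \<in> region (subd D i)" for i x
  proof -
    have "u x = comb (basis_I D) a 0 x + v x" by (simp add: v_def)
    also have "comb (basis_I D) a 0 x = comb (basis_I D) a i x" by (simp add: comb_I_eq)
    finally show ?thesis using v_eq[of x i] d_eq[OF that] by simp
  qed
  ultimately show thesis using that[of a d r] by (simp add: a_def d_def r_def)
qed

section \<open>Pressure coefficients and the constant pressure\<close>

lemma pcomb_hat_node:
  assumes "distinct xs" "y \<in> nodes (tri D)"
  shows "j < length xs \<Longrightarrow> xs ! j = y \<Longrightarrow> pcomb (map (hat (tri D)) xs) p y = vec_index p j"
    and "y \<notin> set xs \<Longrightarrow> pcomb (map (hat (tri D)) xs) p y = 0"
proof -
  have eq: "pcomb (map (hat (tri D)) xs) p y = (\<Sum>k<length xs. if y = xs ! k then vec_index p k else 0)"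
    unfolding pcomb_def using hat_node[OF triangulation_tri assms(2)] by (auto intro!: sum.cong)
  show "pcomb (map (hat (tri D)) xs) p y = 0" if "y \<notin> set xs"
    unfolding eq using that by (intro sum.neutral) auto
  assume j: "j < length xs" "xs ! j = y"
  then have "y = xs ! k \<longleftrightarrow> j = k" if "k < length xs" for k
    using assms(1) that nth_eq_iff_index_eq by blast
  then have "pcomb (map (hat (tri D)) xs) p y = (\<Sum>k<length xs. if j = k then vec_index p k else 0)"
    unfolding eq by (intro sum.cong) auto
  also have "\<dots> = vec_index p j" using j(1) by simp
  finally show "pcomb (map (hat (tri D)) xs) p y = vec_index p j" .
qed

text \<open>Partition of unity: each node occurs in exactly one of the two lists, so the sum is the
  \<open>P1\<close> function with all nodal values 1.\<close>

lemma pcomb_ones: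
  assumes "x \<in> region (tri D)"
  shows "pcomb (basis_pI D) (ones (length (pres_int D))) x + pcomb (basis_pG D) (ones (length (pres_gam D))) x = 1"
proof -
  \<comment> \<open>The sum is written as a difference to fit the closure rules for
    \<open>P1\<close>.\<close>
  let ?q = "\<lambda>x. pcomb (basis_pI D) (ones (length (pres_int D))) x - (-1) *\<^sub>R pcomb (basis_pG D) (ones (length (pres_gam D))) x"
  let ?one = "\<lambda>x. if x \<in> region (tri D) then 1 else (0::real)"
  have "?q = ?one"
  proof (rule P1_unique)
    show "?q \<in> P1 (tri D)" by (intro P1_diff P1_scaleR pcomb_P1 pressure_family_basis)
    have "affine_on (convex hull K) ?one" if "K \<in> tri D" for K
      using that by (intro affine_on_cong[OF affine_on_const[of _ 1]]) (auto simp: region_def)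
    moreover have "continuous_on (region (tri D)) ?one"
      by (rule continuous_on_eq[of _ "\<lambda>_. 1"]) auto
    ultimately show "?one \<in> P1 (tri D)" by (auto simp: P1_iff)
    fix y assume y: "y \<in> nodes (tri D)"
    then have one: "?one y = 1" unfolding nodes_def region_def by (auto intro: hull_inc)
    from y consider "y \<in> set (pres_int D)" "y \<notin> set (pres_gam D)" | "y \<in> set (pres_gam D)" "y \<notin> set (pres_int D)"
      using nodes_tri_dofs pres_dofs(3) by blast
    then show "?q y = ?one y"
    proof cases
      case 1
      then obtain j where "j < length (pres_int D)" "pres_int D ! j = y" by (metis in_set_conv_nth)
      then show ?thesis
        using pcomb_hat_node(1)[OF pres_dofs(1) y] pcomb_hat_node(2)[OF pres_dofs(2) y 1(2)] one
        by (simp add: basis_pI_def basis_pG_def ones_def)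
    next
      case 2
      then obtain j where "j < length (pres_gam D)" "pres_gam D ! j = y" by (metis in_set_conv_nth)
      then show ?thesis
        using pcomb_hat_node(1)[OF pres_dofs(2) y] pcomb_hat_node(2)[OF pres_dofs(1) y 2(2)] one
        by (simp add: basis_pI_def basis_pG_def ones_def)
    qed
  qed
  from fun_cong[OF this, of x] show ?thesis using assms by simp
qed

text \<open>Evaluation at nodes recovers the coefficients; the sign in \<open>p\<close> reflects
  that the pressure is the interface part minus the interior part.\<close>

lemma constant_pressure_coefficients:
  assumes p: "p \<in> carrier_vec (length (pres_int D))" and g: "g \<in> carrier_vec (length (pres_gam D))"
    and c: "\<And>x. x \<in> region (tri D) \<Longrightarrow> pcomb (basis_pG D) g x - pcomb (basis_pI D) p x = c"
  shows "p = (- c) \<cdot>\<^sub>v ones (length (pres_int D))" "g = c \<cdot>\<^sub>v ones (length (pres_gam D))"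
proof -
  have reg: "y \<in> region (tri D)" if "y \<in> nodes (tri D)" for y
    using that unfolding nodes_def region_def by (auto intro: hull_inc)
  have "vec_index p j = - c" if j: "j < length (pres_int D)" for j
  proof -
    let ?y = "pres_int D ! j"
    have y: "?y \<in> nodes (tri D)" and "?y \<notin> set (pres_gam D)"
      using j nodes_tri_dofs pres_dofs(3) nth_mem[OF j] by blast+
    then show ?thesis
      using c[OF reg[OF y]] pcomb_hat_node(1)[OF pres_dofs(1) y j refl] pcomb_hat_node(2)[OF pres_dofs(2) y]
      by (simp add: basis_pI_def basis_pG_def)
  qed
  then show "p = (- c) \<cdot>\<^sub>v ones (length (pres_int D))" using p by (intro eq_vecI) (auto simp: ones_def)
  have "vec_index g j = c" if j: "j < length (pres_gam D)" for j
  proof -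
    let ?y = "pres_gam D ! j"
    have y: "?y \<in> nodes (tri D)" and "?y \<notin> set (pres_int D)"
      using j nodes_tri_dofs pres_dofs(3) nth_mem[OF j] by blast+
    then show ?thesis
      using c[OF reg[OF y]] pcomb_hat_node(1)[OF pres_dofs(2) y j refl] pcomb_hat_node(2)[OF pres_dofs(1) y]
      by (simp add: basis_pI_def basis_pG_def)
  qed
  then show "g = c \<cdot>\<^sub>v ones (length (pres_gam D))" using g by (intro eq_vecI) (auto simp: ones_def)
qed

text \<open>The factors 1 bring the sum into the shape of the linear combination rule for
  \<open>b_sum\<close>.\<close>

definition one_pressure :: "point \<Rightarrow> real" where
  "one_pressure = (\<lambda>x. 1 * pcomb (basis_pI D) (ones (length (pres_int D))) x
      + 1 * pcomb (basis_pG D) (ones (length (pres_gam D))) x)"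

lemma one_pressure_P1: "one_pressure \<in> P1 (tri D)"
proof -
  have "(\<lambda>x. pcomb (basis_pI D) (ones (length (pres_int D))) x - (-1) *\<^sub>R pcomb (basis_pG D) (ones (length (pres_gam D))) x)
      \<in> P1 (tri D)"
    by (intro P1_diff P1_scaleR pcomb_P1 pressure_family_basis)
  then show ?thesis by (simp add: one_pressure_def)
qed

lemma b_sum_one_pressure_continuous:
  assumes w: "\<And>i. w i \<in> V" and "continuous_broken D w"
  shows "b_sum w one_pressure = 0"
proof -
  obtain u where u: "u \<in> V" "\<And>i x. i < nsub D \<Longrightarrow> x \<in> region (subd D i) \<Longrightarrow> u x = w i x"
    using glue_continuous_broken[OF assms] by blast
  have "\<exists>c. \<forall>x\<in>region (tri D). one_pressure x = c"
    using pcomb_ones unfolding one_pressure_def by auto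
  then have "b_sum (\<lambda>_. u) one_pressure = 0" using kernel_iff[OF one_pressure_P1] u(1) by blast
  then show ?thesis using b_sum_cong[of "\<lambda>_. u" w one_pressure] u(2) by simp
qed

end

section \<open>The matrix \<open>G\<close>\<close>

lemma append_vec_empty: "v \<in> carrier_vec 0 \<Longrightarrow> x @\<^sub>v v = x"
  by (intro eq_vecI) auto

lemma smult_append_vec: "c \<cdot>\<^sub>v (x @\<^sub>v y) = (c \<cdot>\<^sub>v x) @\<^sub>v (c \<cdot>\<^sub>v y)"
  by (intro eq_vecI) auto

lemma smult_vec_zero_right: "c \<cdot>\<^sub>v 0\<^sub>v n = (0\<^sub>v n :: 'a :: mult_zero vec)"
  by (intro eq_vecI) auto

lemma scalar_prod_uminus:
  fixes v :: "real vec"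
  assumes "v \<in> carrier_vec n" "w \<in> carrier_vec n"
  shows "scalar_prod (- v) w = - scalar_prod v w"
  using assms by (simp add: scalar_prod_def sum_negf)

lemma zero_mat_mult_vec: "v \<in> carrier_vec nc \<Longrightarrow> 0\<^sub>m nr nc *\<^sub>v v = 0\<^sub>v nr"
  by (intro eq_vecI) auto

text \<open>Since \<open>J J'\<^sup>T = I\<close>, the matrix \<open>J'\<^sup>T J\<close> is a projection along the kernel of \<open>J\<close>, so a functional
  that vanishes on this kernel factors through \<open>J\<close>.\<close>

lemma functional_vanishing_on_kernel:
  fixes J J' :: "real mat"
  assumes J: "J \<in> carrier_mat m n" and J': "J' \<in> carrier_mat m n" and JJ: "J * transpose_mat J' = 1\<^sub>m m"
    and g: "g \<in> carrier_vec n" and ker: "\<And>d. d \<in> carrier_vec n \<Longrightarrow> J *\<^sub>v d = 0\<^sub>v m \<Longrightarrow> scalar_prod g d = 0"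
    and d: "d \<in> carrier_vec n"
  shows "scalar_prod g d = scalar_prod (J' *\<^sub>v g) (J *\<^sub>v d)"
proof -
  have Jd: "J *\<^sub>v d \<in> carrier_vec m" using J d by simp
  have Jt: "transpose_mat J' \<in> carrier_mat n m" using J' by simp
  define e where "e = transpose_mat J' *\<^sub>v (J *\<^sub>v d)"
  have e: "e \<in> carrier_vec n" unfolding e_def by (rule mult_mat_vec_carrier[OF Jt Jd])
  have "J *\<^sub>v e = J *\<^sub>v d"
    unfolding e_def assoc_mult_mat_vec[OF J Jt Jd, symmetric] JJ using Jd by simp
  then have "J *\<^sub>v (d - e) = 0\<^sub>v m"
    unfolding mult_minus_distrib_mat_vec[OF J d e] using Jd by simp
  then have "scalar_prod g (d - e) = 0" using d e by (intro ker) auto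
  then have "scalar_prod g d = scalar_prod g e"
    unfolding scalar_prod_minus_distrib[OF g d e] by simp
  also have "\<dots> = scalar_prod e g" by (rule comm_scalar_prod[OF g e])
  also have "\<dots> = scalar_prod (J *\<^sub>v d) (J' *\<^sub>v g)"
    unfolding e_def by (rule transpose_vec_mult_scalar[OF J' g Jd])
  also have "\<dots> = scalar_prod (J' *\<^sub>v g) (J *\<^sub>v d)"
    using J' g by (intro comm_scalar_prod[OF Jd]) simp
  finally show ?thesis .
qed

locale scaled_decomposition = decomposition +
  assumes JJ: "jump D * transpose_mat (jump_scaled D) = 1\<^sub>m (dim_row (jump D))"
    and inv: "invertible_mat (A_tilde D)"
begin

abbreviation "nI \<equiv> length (vel_int D)"
abbreviation "nP \<equiv> length (pres_int D)"
abbreviation "nD \<equiv> length (copies D)"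
abbreviation "nR \<equiv> length (primal D)"
abbreviation "nG \<equiv> length (pres_gam D)"
abbreviation "nL \<equiv> dim_row (jump D)"
abbreviation "nV \<equiv> nI + nP + (nD + nR)"

abbreviation "bI \<equiv> basis_I D"
abbreviation "bD \<equiv> basis_Dlt D"
abbreviation "bR \<equiv> basis_Pi D"
abbreviation "bP \<equiv> basis_pI D"
abbreviation "bG \<equiv> basis_pG D"
abbreviation "K \<equiv> A_tilde D"
abbreviation "C \<equiv> B_C D"

text \<open>The inner abstraction makes the first two summands one \<open>broken\<close> velocity,
  so that two-term additivity applies twice.\<close>

definition vcomb :: "real vec \<Rightarrow> real vec \<Rightarrow> real vec \<Rightarrow> broken" where
  "vcomb a d r = (\<lambda>i x. (\<lambda>i x. comb bI a i x + comb bD d i x) i x + comb bR r i x)"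

section \<open>Block structure of \<open>A_tilde\<close> and \<open>B_C\<close> and the forms they
  represent\<close>

lemma A_mat_carrier: "length us = n \<Longrightarrow> length vs = m \<Longrightarrow> A_mat D us vs \<in> carrier_mat n m"
  by (simp add: A_mat_def)

lemma B_mat_carrier: "length qs = n \<Longrightarrow> length us = m \<Longrightarrow> B_mat D qs us \<in> carrier_mat n m"
  by (simp add: B_mat_def)

text \<open>Positions matter below: 1 to 9 are the \<open>A\<close> blocks, 10 to 12 the interior
  and 13 to 15 the interface pressure blocks. With the transposes appended, 25 to 27 are the
  transposes of 10 to 12.\<close>

lemmas mat_carriers =
  A_mat_carrier[OF length_basis(1) length_basis(1)] A_mat_carrier[OF length_basis(1) length_basis(2)]
  A_mat_carrier[OF length_basis(1) length_basis(3)] A_mat_carrier[OF length_basis(2) length_basis(1)]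
  A_mat_carrier[OF length_basis(2) length_basis(2)] A_mat_carrier[OF length_basis(2) length_basis(3)]
  A_mat_carrier[OF length_basis(3) length_basis(1)] A_mat_carrier[OF length_basis(3) length_basis(2)]
  A_mat_carrier[OF length_basis(3) length_basis(3)]
  B_mat_carrier[OF length_basis(4) length_basis(1)] B_mat_carrier[OF length_basis(4) length_basis(2)]
  B_mat_carrier[OF length_basis(4) length_basis(3)] B_mat_carrier[OF length_basis(5) length_basis(1)]
  B_mat_carrier[OF length_basis(5) length_basis(2)] B_mat_carrier[OF length_basis(5) length_basis(3)]

lemmas mat_carriers_transpose = mat_carriers[THEN transpose_carrier_mat[THEN iffD2]]

lemma J_carrier: "jump D \<in> carrier_mat nL nD"
  using jumps unfolding jump_constraints_def by (auto intro: carrier_matI)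

lemma Js_carrier: "jump_scaled D \<in> carrier_mat nL nD"
  by (rule carrier_matI) (simp_all only: jump_scaled_def dim_row_mat dim_col_mat carrier_matD(2)[OF J_carrier])

lemma A_mat_transpose: "transpose_mat (A_mat D us vs) = A_mat D vs us"
  by (rule eq_matI) (auto simp: A_mat_def a_form_commute)

lemma K_blocks:
  "K = four_block_mat
       (four_block_mat (A_mat D bI bI) (transpose_mat (B_mat D bP bI)) (B_mat D bP bI) (0\<^sub>m nP nP))
       (four_block_mat (A_mat D bI bD) (A_mat D bI bR) (B_mat D bP bD) (B_mat D bP bR))
       (four_block_mat (A_mat D bD bI) (transpose_mat (B_mat D bP bD))
                       (A_mat D bR bI) (transpose_mat (B_mat D bP bR)))
       (four_block_mat (A_mat D bD bD) (A_mat D bD bR) (A_mat D bR bD) (A_mat D bR bR))"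
  unfolding A_tilde_def Let_def by simp

lemma C_blocks:
  "C = four_block_mat
       (four_block_mat (B_mat D bG bI) (0\<^sub>m nG nP) (0\<^sub>m nL nI) (0\<^sub>m nL nP))
       (four_block_mat (B_mat D bG bD) (B_mat D bG bR) (jump D) (0\<^sub>m nL nR))
       (0\<^sub>m 0 (nI + nP)) (0\<^sub>m 0 (nD + nR))"
  unfolding B_C_def Let_def by simp

lemma K_carrier: "K \<in> carrier_mat nV nV"
  unfolding K_blocks by (intro four_block_carrier_mat mat_carriers zero_carrier_mat)

lemma C_carrier: "C \<in> carrier_mat (nG + nL) nV"
proof -
  have "C \<in> carrier_mat (nG + nL + 0) nV"
    unfolding C_blocks by (intro four_block_carrier_mat mat_carriers zero_carrier_mat)
  then show ?thesis by simp
qed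

lemma K_symmetric: "transpose_mat K = K"
proof -
  note c = mat_carriers mat_carriers_transpose zero_carrier_mat
  show ?thesis
    unfolding K_blocks
      transpose_four_block_mat[OF four_block_carrier_mat[OF c(1) zero_carrier_mat]
        four_block_carrier_mat[OF c(2) c(12)] four_block_carrier_mat[OF c(4) c(27)]
        four_block_carrier_mat[OF c(5) c(9)]]
      transpose_four_block_mat[OF c(1) c(25) c(10) zero_carrier_mat]
      transpose_four_block_mat[OF c(2) c(3) c(11) c(12)]
      transpose_four_block_mat[OF c(4) c(26) c(7) c(27)]
      transpose_four_block_mat[OF c(5) c(6) c(8) c(9)]
    by (simp add: A_mat_transpose)
qed

lemma scalar_prod_four_block:
  fixes A B C E :: "real mat"
  assumes c: "A \<in> carrier_mat m1 n1" "B \<in> carrier_mat m1 n2" "C \<in> carrier_mat m2 n1" "E \<in> carrier_mat m2 n2"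
    and v: "x \<in> carrier_vec m1" "y \<in> carrier_vec m2" "u \<in> carrier_vec n1" "v \<in> carrier_vec n2"
  shows "scalar_prod (x @\<^sub>v y) (four_block_mat A B C E *\<^sub>v (u @\<^sub>v v)) =
    scalar_prod x (A *\<^sub>v u) + scalar_prod x (B *\<^sub>v v) + scalar_prod y (C *\<^sub>v u) + scalar_prod y (E *\<^sub>v v)"
proof -
  note m = mult_mat_vec_carrier[OF c(1) v(3)] mult_mat_vec_carrier[OF c(2) v(4)]
    mult_mat_vec_carrier[OF c(3) v(3)] mult_mat_vec_carrier[OF c(4) v(4)]
  show ?thesis
    unfolding four_block_mat_mult_vec[OF c v(3,4)]
      scalar_prod_append[OF v(1,2) add_carrier_vec[OF m(1,2)] add_carrier_vec[OF m(3,4)]]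
      scalar_prod_add_distrib[OF v(1) m(1,2)] scalar_prod_add_distrib[OF v(2) m(3,4)]
    by simp
qed

lemma scalar_prod_transpose:
  fixes B :: "real mat"
  assumes "B \<in> carrier_mat m n" "x \<in> carrier_vec n" "y \<in> carrier_vec m"
  shows "scalar_prod x (transpose_mat B *\<^sub>v y) = scalar_prod y (B *\<^sub>v x)"
  unfolding transpose_vec_mult_scalar[OF assms, symmetric]
  using assms by (intro comm_scalar_prod[of _ n]) auto

lemma vcomb_in_V: "vcomb a d r i \<in> V"
proof -
  have add: "(\<lambda>x. u x + v x) \<in> V" if "u \<in> V" "v \<in> V" for u v
    using V_diff[OF that(1) V_diff[OF V_zero that(2)]] by simp
  show ?thesis unfolding vcomb_def by (intro add comb_in_V velocity_family_basis)
qed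

lemma a_sum_vcomb_left:
  assumes "\<And>i. w i \<in> V"
  shows "a_sum (vcomb a d r) w = a_sum (comb bI a) w + a_sum (comb bD d) w + a_sum (comb bR r) w"
proof -
  have add: "(\<lambda>x. comb bI a i x + comb bD d i x) \<in> V" for i
    using V_diff[OF comb_in_V[OF velocity_family_basis(1)] V_diff[OF V_zero comb_in_V[OF velocity_family_basis(2)]]] by simp
  show ?thesis
    unfolding vcomb_def
    using a_sum_add_left[OF add comb_in_V[OF velocity_family_basis(3)] assms]
      a_sum_add_left[OF comb_in_V[OF velocity_family_basis(1)] comb_in_V[OF velocity_family_basis(2)] assms] by simp
qed

lemma b_sum_vcomb:
  assumes "q \<in> P1 (tri D)"
  shows "b_sum (vcomb a d r) q = b_sum (comb bI a) q + b_sum (comb bD d) q + b_sum (comb bR r) q"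
proof -
  have add: "(\<lambda>x. comb bI a i x + comb bD d i x) \<in> V" for i
    using V_diff[OF comb_in_V[OF velocity_family_basis(1)] V_diff[OF V_zero comb_in_V[OF velocity_family_basis(2)]]] by simp
  show ?thesis
    unfolding vcomb_def
    using b_sum_add_left[OF add comb_in_V[OF velocity_family_basis(3)] assms]
      b_sum_add_left[OF comb_in_V[OF velocity_family_basis(1)] comb_in_V[OF velocity_family_basis(2)] assms] by simp
qed

lemma b_sum_pressures:
  assumes "\<And>i. u i \<in> V"
  shows "b_sum u (\<lambda>x. s * pcomb bP p x + t * pcomb bG g x) = s * b_sum u (pcomb bP p) + t * b_sum u (pcomb bG g)"
  by (rule b_sum_lincomb_right[OF assms pcomb_P1[OF pressure_family_basis(1)] pcomb_P1[OF pressure_family_basis(2)]])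

lemma comb_zero: "length us \<le> n \<Longrightarrow> comb us (0\<^sub>v n) = (\<lambda>_ _. 0)"
  unfolding comb_def by (intro ext sum.neutral) auto

lemma pcomb_zero: "length qs \<le> n \<Longrightarrow> pcomb qs (0\<^sub>v n) = (\<lambda>_. 0)"
  unfolding pcomb_def by (intro ext sum.neutral) auto

lemma vcomb_zero: "vcomb (0\<^sub>v nI) (0\<^sub>v nD) (0\<^sub>v nR) = (\<lambda>_ _. 0)"
  by (simp add: vcomb_def comb_zero)

lemma grad_zero: "grad (\<lambda>_. 0) x = 0"
  unfolding grad_def Finite_Cartesian_Product.vec_eq_iff by (simp add: matrix_def)

lemma form_sums_zero:
  "a_sum (\<lambda>_ _. 0) v = 0" "b_sum (\<lambda>_ _. 0) q = 0" "b_sum u (\<lambda>_. 0) = 0"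
  by (simp_all add: a_sum_def b_sum_def a_form_def b_form_def grad_zero trace_def)

text \<open>The Stokes saddle point form with the interior pressures as multipliers. The argument
  below uses \<open>A_tilde\<close> through this form, its symmetry and its invertibility.\<close>

lemma K_form:
  assumes v: "a \<in> carrier_vec nI" "t \<in> carrier_vec nP" "d \<in> carrier_vec nD" "r \<in> carrier_vec nR"
    and v': "a' \<in> carrier_vec nI" "t' \<in> carrier_vec nP" "d' \<in> carrier_vec nD" "r' \<in> carrier_vec nR"
  shows "scalar_prod ((a' @\<^sub>v t') @\<^sub>v (d' @\<^sub>v r')) (K *\<^sub>v ((a @\<^sub>v t) @\<^sub>v (d @\<^sub>v r))) =
    a_sum (vcomb a' d' r') (vcomb a d r) + b_sum (vcomb a' d' r') (pcomb bP t) + b_sum (vcomb a d r) (pcomb bP t')"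
proof -
  note c = mat_carriers mat_carriers_transpose zero_carrier_mat
  have 1: "scalar_prod (a' @\<^sub>v t') (four_block_mat (A_mat D bI bI) (transpose_mat (B_mat D bP bI)) (B_mat D bP bI) (0\<^sub>m nP nP) *\<^sub>v (a @\<^sub>v t))
    = a_sum (comb bI a') (comb bI a) + b_sum (comb bI a') (pcomb bP t) + b_sum (comb bI a) (pcomb bP t')"
    by (subst scalar_prod_four_block[OF _ _ _ _ v'(1,2) v(1,2)], (rule c)+)
      (simp add: scalar_prod_transpose[OF mat_carriers(10) v'(1) v(2)] zero_mat_mult_vec[OF v(2)]
        A_mat_bilinear[OF velocity_family_basis(1) velocity_family_basis(1)] B_mat_bilinear[OF velocity_family_basis(1) pressure_family_basis(1)] v v')
  have 2: "scalar_prod (a' @\<^sub>v t') (four_block_mat (A_mat D bI bD) (A_mat D bI bR) (B_mat D bP bD) (B_mat D bP bR) *\<^sub>v (d @\<^sub>v r))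
    = a_sum (comb bI a') (comb bD d) + a_sum (comb bI a') (comb bR r) + b_sum (comb bD d) (pcomb bP t') + b_sum (comb bR r) (pcomb bP t')"
    by (subst scalar_prod_four_block[OF _ _ _ _ v'(1,2) v(3,4)], (rule c)+)
      (simp add: A_mat_bilinear[OF velocity_family_basis(1) velocity_family_basis(2)] A_mat_bilinear[OF velocity_family_basis(1) velocity_family_basis(3)]
        B_mat_bilinear[OF velocity_family_basis(2) pressure_family_basis(1)] B_mat_bilinear[OF velocity_family_basis(3) pressure_family_basis(1)] v v')
  have 3: "scalar_prod (d' @\<^sub>v r') (four_block_mat (A_mat D bD bI) (transpose_mat (B_mat D bP bD)) (A_mat D bR bI) (transpose_mat (B_mat D bP bR)) *\<^sub>v (a @\<^sub>v t))
    = a_sum (comb bD d') (comb bI a) + b_sum (comb bD d') (pcomb bP t) + a_sum (comb bR r') (comb bI a) + b_sum (comb bR r') (pcomb bP t)"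
    by (subst scalar_prod_four_block[OF _ _ _ _ v'(3,4) v(1,2)], (rule c)+)
      (simp add: scalar_prod_transpose[OF mat_carriers(11) v'(3) v(2)] scalar_prod_transpose[OF mat_carriers(12) v'(4) v(2)]
        A_mat_bilinear[OF velocity_family_basis(2) velocity_family_basis(1)] A_mat_bilinear[OF velocity_family_basis(3) velocity_family_basis(1)]
        B_mat_bilinear[OF velocity_family_basis(2) pressure_family_basis(1)] B_mat_bilinear[OF velocity_family_basis(3) pressure_family_basis(1)] v v')
  have 4: "scalar_prod (d' @\<^sub>v r') (four_block_mat (A_mat D bD bD) (A_mat D bD bR) (A_mat D bR bD) (A_mat D bR bR) *\<^sub>v (d @\<^sub>v r))
    = a_sum (comb bD d') (comb bD d) + a_sum (comb bD d') (comb bR r) + a_sum (comb bR r') (comb bD d) + a_sum (comb bR r') (comb bR r)"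
    by (subst scalar_prod_four_block[OF _ _ _ _ v'(3,4) v(3,4)], (rule c)+)
      (simp add: A_mat_bilinear[OF velocity_family_basis(2) velocity_family_basis(2)] A_mat_bilinear[OF velocity_family_basis(2) velocity_family_basis(3)]
        A_mat_bilinear[OF velocity_family_basis(3) velocity_family_basis(2)] A_mat_bilinear[OF velocity_family_basis(3) velocity_family_basis(3)] v v')
  have "scalar_prod ((a' @\<^sub>v t') @\<^sub>v (d' @\<^sub>v r')) (K *\<^sub>v ((a @\<^sub>v t) @\<^sub>v (d @\<^sub>v r))) =
    scalar_prod (a' @\<^sub>v t') (four_block_mat (A_mat D bI bI) (transpose_mat (B_mat D bP bI)) (B_mat D bP bI) (0\<^sub>m nP nP) *\<^sub>v (a @\<^sub>v t))
    + scalar_prod (a' @\<^sub>v t') (four_block_mat (A_mat D bI bD) (A_mat D bI bR) (B_mat D bP bD) (B_mat D bP bR) *\<^sub>v (d @\<^sub>v r))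
    + scalar_prod (d' @\<^sub>v r') (four_block_mat (A_mat D bD bI) (transpose_mat (B_mat D bP bD)) (A_mat D bR bI) (transpose_mat (B_mat D bP bR)) *\<^sub>v (a @\<^sub>v t))
    + scalar_prod (d' @\<^sub>v r') (four_block_mat (A_mat D bD bD) (A_mat D bD bR) (A_mat D bR bD) (A_mat D bR bR) *\<^sub>v (d @\<^sub>v r))"
    unfolding K_blocks
    by (rule scalar_prod_four_block[of _ "nI + nP" "nI + nP" _ "nD + nR" _ "nD + nR"])
      (intro four_block_carrier_mat append_carrier_vec c v v')+
  moreover have "a_sum (vcomb a' d' r') (vcomb a d r) =
      a_sum (comb bI a') (comb bI a) + a_sum (comb bI a') (comb bD d) + a_sum (comb bI a') (comb bR r)
    + a_sum (comb bD d') (comb bI a) + a_sum (comb bD d') (comb bD d) + a_sum (comb bD d') (comb bR r)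
    + a_sum (comb bR r') (comb bI a) + a_sum (comb bR r') (comb bD d) + a_sum (comb bR r') (comb bR r)"
  proof -
    have right: "a_sum w (vcomb a d r) = a_sum w (comb bI a) + a_sum w (comb bD d) + a_sum w (comb bR r)"
      if "\<And>i. w i \<in> V" for w
      unfolding a_sum_commute[of w] by (rule a_sum_vcomb_left[OF that])
    show ?thesis
      unfolding a_sum_vcomb_left[of "vcomb a d r", OF vcomb_in_V]
        right[of "comb bI a'", OF comb_in_V[OF velocity_family_basis(1)]] right[of "comb bD d'", OF comb_in_V[OF velocity_family_basis(2)]]
        right[of "comb bR r'", OF comb_in_V[OF velocity_family_basis(3)]] by simp
  qed
  ultimately show ?thesis
    unfolding 1 2 3 4 b_sum_vcomb[OF pcomb_P1[OF pressure_family_basis(1)]] by simp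
qed

lemma C_form:
  assumes v: "a \<in> carrier_vec nI" "t \<in> carrier_vec nP" "d \<in> carrier_vec nD" "r \<in> carrier_vec nR"
    and x: "g \<in> carrier_vec nG" "l \<in> carrier_vec nL"
  shows "scalar_prod (g @\<^sub>v l) (C *\<^sub>v ((a @\<^sub>v t) @\<^sub>v (d @\<^sub>v r))) =
    b_sum (vcomb a d r) (pcomb bG g) + scalar_prod l (jump D *\<^sub>v d)"
proof -
  note c = mat_carriers zero_carrier_mat J_carrier
  have 1: "scalar_prod (g @\<^sub>v l) (four_block_mat (B_mat D bG bI) (0\<^sub>m nG nP) (0\<^sub>m nL nI) (0\<^sub>m nL nP) *\<^sub>v (a @\<^sub>v t))
    = b_sum (comb bI a) (pcomb bG g)"
    by (subst scalar_prod_four_block[OF _ _ _ _ x v(1,2)], (rule c)+)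
      (simp add: zero_mat_mult_vec[OF v(1)] zero_mat_mult_vec[OF v(2)]
        B_mat_bilinear[OF velocity_family_basis(1) pressure_family_basis(2)] v x)
  have 2: "scalar_prod (g @\<^sub>v l) (four_block_mat (B_mat D bG bD) (B_mat D bG bR) (jump D) (0\<^sub>m nL nR) *\<^sub>v (d @\<^sub>v r))
    = b_sum (comb bD d) (pcomb bG g) + b_sum (comb bR r) (pcomb bG g) + scalar_prod l (jump D *\<^sub>v d)"
    by (subst scalar_prod_four_block[OF _ _ _ _ x v(3,4)], (rule c)+)
      (simp add: zero_mat_mult_vec[OF v(4)]
        B_mat_bilinear[OF velocity_family_basis(2) pressure_family_basis(2)] B_mat_bilinear[OF velocity_family_basis(3) pressure_family_basis(2)] v x)
  \<comment> \<open>The empty vector pairs with the rowless lower blocks of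
    \<open>B_C\<close>.\<close>
  have e: "0\<^sub>v 0 \<in> carrier_vec 0" by simp
  have at: "a @\<^sub>v t \<in> carrier_vec (nI + nP)" and dr: "d @\<^sub>v r \<in> carrier_vec (nD + nR)" and gl: "g @\<^sub>v l \<in> carrier_vec (nG + nL)"
    using v x by simp_all
  have "scalar_prod ((g @\<^sub>v l) @\<^sub>v 0\<^sub>v 0) (C *\<^sub>v ((a @\<^sub>v t) @\<^sub>v (d @\<^sub>v r))) =
     scalar_prod (g @\<^sub>v l) (four_block_mat (B_mat D bG bI) (0\<^sub>m nG nP) (0\<^sub>m nL nI) (0\<^sub>m nL nP) *\<^sub>v (a @\<^sub>v t))
     + scalar_prod (g @\<^sub>v l) (four_block_mat (B_mat D bG bD) (B_mat D bG bR) (jump D) (0\<^sub>m nL nR) *\<^sub>v (d @\<^sub>v r))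
     + scalar_prod (0\<^sub>v 0) (0\<^sub>m 0 (nI + nP) *\<^sub>v (a @\<^sub>v t)) + scalar_prod (0\<^sub>v 0) (0\<^sub>m 0 (nD + nR) *\<^sub>v (d @\<^sub>v r))"
    unfolding C_blocks
    by (rule scalar_prod_four_block[OF _ _ _ _ gl e at dr]) (intro four_block_carrier_mat c)+
  then show ?thesis
    unfolding 1 2 append_vec_empty[OF e] b_sum_vcomb[OF pcomb_P1[OF pressure_family_basis(2)]]
    by (simp add: scalar_prod_def)
qed

section \<open>Systems solved by a pressure vector alone, and the null vector\<close>

lemma carrier_split:
  assumes "y \<in> carrier_vec nV"
  obtains a t d r where "a \<in> carrier_vec nI" "t \<in> carrier_vec nP" "d \<in> carrier_vec nD" "r \<in> carrier_vec nR"
    "y = (a @\<^sub>v t) @\<^sub>v (d @\<^sub>v r)"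
proof -
  let ?u = "vec_first y (nI + nP)" and ?v = "vec_last y (nD + nR)"
  have "(vec_first ?u nI @\<^sub>v vec_last ?u nP) @\<^sub>v (vec_first ?v nD @\<^sub>v vec_last ?v nR) = y"
    unfolding vec_first_last_append[OF vec_first_carrier] vec_first_last_append[OF vec_last_carrier]
    by (rule vec_first_last_append[OF assms])
  then show thesis
    using that[of "vec_first ?u nI" "vec_last ?u nP" "vec_first ?v nD" "vec_last ?v nR"] by simp
qed

text \<open>Tests in the interior pressure slots give 0 on both sides, since the solution has no
  velocity part and the corresponding columns of \<open>C\<close> are zero; only velocity tests
  remain.\<close>

lemma pressure_solution_iff:
  assumes t: "t \<in> carrier_vec nP" and g: "g \<in> carrier_vec nG" and l: "l \<in> carrier_vec nL"
  shows "K *\<^sub>v ((0\<^sub>v nI @\<^sub>v t) @\<^sub>v (0\<^sub>v nD @\<^sub>v 0\<^sub>v nR)) = transpose_mat C *\<^sub>v (g @\<^sub>v l) \<longleftrightarrow>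
    (\<forall>a\<in>carrier_vec nI. \<forall>d\<in>carrier_vec nD. \<forall>r\<in>carrier_vec nR.
      b_sum (vcomb a d r) (pcomb bP t) = b_sum (vcomb a d r) (pcomb bG g) + scalar_prod l (jump D *\<^sub>v d))"
proof -
  let ?y = "(0\<^sub>v nI @\<^sub>v t) @\<^sub>v (0\<^sub>v nD @\<^sub>v 0\<^sub>v nR)"
  have gl: "g @\<^sub>v l \<in> carrier_vec (nG + nL)" using g l by simp
  have y: "?y \<in> carrier_vec nV" by (intro append_carrier_vec t zero_carrier_vec)
  have L: "scalar_prod ((a @\<^sub>v s) @\<^sub>v (d @\<^sub>v r)) (K *\<^sub>v ?y) = b_sum (vcomb a d r) (pcomb bP t)"
    and R: "scalar_prod ((a @\<^sub>v s) @\<^sub>v (d @\<^sub>v r)) (transpose_mat C *\<^sub>v (g @\<^sub>v l)) =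
      b_sum (vcomb a d r) (pcomb bG g) + scalar_prod l (jump D *\<^sub>v d)"
    if v: "a \<in> carrier_vec nI" "s \<in> carrier_vec nP" "d \<in> carrier_vec nD" "r \<in> carrier_vec nR" for a s d r
  proof -
    show "scalar_prod ((a @\<^sub>v s) @\<^sub>v (d @\<^sub>v r)) (K *\<^sub>v ?y) = b_sum (vcomb a d r) (pcomb bP t)"
      using K_form[OF zero_carrier_vec t zero_carrier_vec zero_carrier_vec v]
      unfolding vcomb_zero a_sum_commute[of _ "\<lambda>_ _. 0"] form_sums_zero by simp
    have "(a @\<^sub>v s) @\<^sub>v (d @\<^sub>v r) \<in> carrier_vec nV" by (intro append_carrier_vec v)
    from scalar_prod_transpose[OF C_carrier this gl]
    show "scalar_prod ((a @\<^sub>v s) @\<^sub>v (d @\<^sub>v r)) (transpose_mat C *\<^sub>v (g @\<^sub>v l)) =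
      b_sum (vcomb a d r) (pcomb bG g) + scalar_prod l (jump D *\<^sub>v d)"
      unfolding C_form[OF v g l] .
  qed
  show ?thesis
  proof
    assume eq: "K *\<^sub>v ?y = transpose_mat C *\<^sub>v (g @\<^sub>v l)"
    show "\<forall>a\<in>carrier_vec nI. \<forall>d\<in>carrier_vec nD. \<forall>r\<in>carrier_vec nR.
      b_sum (vcomb a d r) (pcomb bP t) = b_sum (vcomb a d r) (pcomb bG g) + scalar_prod l (jump D *\<^sub>v d)"
      using L[OF _ t] R[OF _ t] unfolding eq by simp
  next
    assume form: "\<forall>a\<in>carrier_vec nI. \<forall>d\<in>carrier_vec nD. \<forall>r\<in>carrier_vec nR.
      b_sum (vcomb a d r) (pcomb bP t) = b_sum (vcomb a d r) (pcomb bG g) + scalar_prod l (jump D *\<^sub>v d)"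
    show "K *\<^sub>v ?y = transpose_mat C *\<^sub>v (g @\<^sub>v l)"
    proof (rule vec_eqI_scalar_prod)
      show "K *\<^sub>v ?y \<in> carrier_vec nV" by (rule mult_mat_vec_carrier[OF K_carrier y])
      show "transpose_mat C *\<^sub>v (g @\<^sub>v l) \<in> carrier_vec nV"
        using C_carrier gl by (intro mult_mat_vec_carrier[of _ nV "nG + nL"]) simp_all
      fix u :: "real vec" assume "u \<in> carrier_vec nV"
      then obtain a s d r where v: "a \<in> carrier_vec nI" "s \<in> carrier_vec nP" "d \<in> carrier_vec nD" "r \<in> carrier_vec nR"
        and u: "u = (a @\<^sub>v s) @\<^sub>v (d @\<^sub>v r)" by (rule carrier_split)
      show "scalar_prod u (K *\<^sub>v ?y) = scalar_prod u (transpose_mat C *\<^sub>v (g @\<^sub>v l))"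
        unfolding u L[OF v] R[OF v] using form v by blast
    qed
  qed
qed

text \<open>The coefficient vector of the functional b(., 1) on the dual velocities; the second
  component of \<open>null_vector\<close> is minus its image under
  \<open>jump_scaled D\<close>.\<close>

definition jump_load :: "real vec" where
  "jump_load = transpose_mat (B_mat D bP bD @\<^sub>r B_mat D bG bD) *\<^sub>v (ones nP @\<^sub>v ones nG)"

lemma ones_carrier: "ones n \<in> carrier_vec n"
  by (simp add: ones_def)

lemma jump_load_carrier: "jump_load \<in> carrier_vec nD"
  and jump_load: "d \<in> carrier_vec nD \<Longrightarrow> scalar_prod jump_load d = b_sum (comb bD d) one_pressure"
proof -
  have c: "B_mat D bP bD @\<^sub>r B_mat D bG bD \<in> carrier_mat (nP + nG) nD"
    by (intro carrier_append_rows mat_carriers)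
  have o: "ones nP @\<^sub>v ones nG \<in> carrier_vec (nP + nG)" by (intro append_carrier_vec ones_carrier)
  show "jump_load \<in> carrier_vec nD"
    unfolding jump_load_def using c by (intro mult_mat_vec_carrier[OF _ o]) simp
  assume d: "d \<in> carrier_vec nD"
  have "scalar_prod jump_load d = scalar_prod (ones nP @\<^sub>v ones nG) ((B_mat D bP bD @\<^sub>r B_mat D bG bD) *\<^sub>v d)"
    unfolding jump_load_def by (rule transpose_vec_mult_scalar[OF c d o])
  also have "\<dots> = scalar_prod (ones nP) (B_mat D bP bD *\<^sub>v d) + scalar_prod (ones nG) (B_mat D bG bD *\<^sub>v d)"
    unfolding mat_mult_append[OF mat_carriers(11) mat_carriers(14) d]
    by (rule scalar_prod_append[OF ones_carrier ones_carrier]) (rule mult_mat_vec_carrier[OF _ d], rule mat_carriers)+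
  also have "\<dots> = b_sum (comb bD d) (pcomb bP (ones nP)) + b_sum (comb bD d) (pcomb bG (ones nG))"
    using d by (simp add: B_mat_bilinear[OF velocity_family_basis(2)] pressure_family_basis ones_carrier)
  also have "\<dots> = b_sum (comb bD d) one_pressure"
    unfolding one_pressure_def b_sum_pressures[OF comb_in_V[OF velocity_family_basis(2)]] by simp
  finally show "scalar_prod jump_load d = b_sum (comb bD d) one_pressure" .
qed

lemma null_vector_eq: "null_vector D = ones nG @\<^sub>v - (jump_scaled D *\<^sub>v jump_load)"
  unfolding null_vector_def jump_load_def ..

lemma scaled_load_carrier: "jump_scaled D *\<^sub>v jump_load \<in> carrier_vec nL"
  by (rule mult_mat_vec_carrier[OF Js_carrier jump_load_carrier])

lemma null_vector_carrier: "null_vector D \<in> carrier_vec (nG + nL)"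
  unfolding null_vector_eq using scaled_load_carrier by (intro append_carrier_vec ones_carrier) simp

text \<open>Interior and primal velocities are single-valued, so the pressure 1 annihilates them. On
  the dual part the functional vanishes on the kernel of the jump matrix and hence depends on the
  jump alone.\<close>

lemma b_sum_one_pressure:
  assumes d: "d \<in> carrier_vec nD"
  shows "b_sum (vcomb a d r) one_pressure = scalar_prod (jump_scaled D *\<^sub>v jump_load) (jump D *\<^sub>v d)"
proof -
  have cont: "continuous_broken D (comb bI a)" "continuous_broken D (comb bR r)"
    unfolding continuous_broken_def comb_I_eq comb_Pi_eq by simp_all
  have "b_sum (vcomb a d r) one_pressure = b_sum (comb bD d) one_pressure"
    unfolding b_sum_vcomb[OF one_pressure_P1]
    using b_sum_one_pressure_continuous[OF comb_in_V[OF velocity_family_basis(1)] cont(1)]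
      b_sum_one_pressure_continuous[OF comb_in_V[OF velocity_family_basis(3)] cont(2)] by simp
  also have "\<dots> = scalar_prod jump_load d" by (rule jump_load[OF d, symmetric])
  also have "\<dots> = scalar_prod (jump_scaled D *\<^sub>v jump_load) (jump D *\<^sub>v d)"
  proof (rule functional_vanishing_on_kernel[OF J_carrier Js_carrier JJ jump_load_carrier _ d])
    fix e assume e: "e \<in> carrier_vec nD" "jump D *\<^sub>v e = 0\<^sub>v nL"
    then have "continuous_broken D (comb bD e)"
      using jumps unfolding jump_constraints_def Dlt_function_eq by blast
    then show "scalar_prod jump_load e = 0"
      unfolding jump_load[OF e(1)] by (rule b_sum_one_pressure_continuous[OF comb_in_V[OF velocity_family_basis(2)]])
  qed
  finally show ?thesis .
qed

text \<open>Split b(., 1) into its interior and interface parts: moving the interior part to the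
  left gives the coefficient -1, and expressing b(., 1) by the jump gives the second
  component.\<close>

lemma null_vector_solution:
  "K *\<^sub>v ((0\<^sub>v nI @\<^sub>v - ones nP) @\<^sub>v (0\<^sub>v nD @\<^sub>v 0\<^sub>v nR)) = transpose_mat C *\<^sub>v null_vector D"
proof -
  have p: "pcomb bP (- ones nP) = (\<lambda>x. (-1) * pcomb bP (ones nP) x + 0 * pcomb bG (ones nG) x)"
    unfolding pcomb_def ones_def by (intro ext) (simp add: sum_negf)
  have "b_sum (vcomb a d r) (pcomb bP (- ones nP)) = b_sum (vcomb a d r) (pcomb bG (ones nG))
      + scalar_prod (- (jump_scaled D *\<^sub>v jump_load)) (jump D *\<^sub>v d)" if d: "d \<in> carrier_vec nD" for a d r
  proof -
    have "b_sum (vcomb a d r) (pcomb bP (- ones nP)) = - b_sum (vcomb a d r) (pcomb bP (ones nP))"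
      unfolding p b_sum_pressures[OF vcomb_in_V] by simp
    moreover have "b_sum (vcomb a d r) one_pressure =
        b_sum (vcomb a d r) (pcomb bP (ones nP)) + b_sum (vcomb a d r) (pcomb bG (ones nG))"
      unfolding one_pressure_def b_sum_pressures[OF vcomb_in_V] by simp
    moreover have "scalar_prod (- (jump_scaled D *\<^sub>v jump_load)) (jump D *\<^sub>v d) =
        - scalar_prod (jump_scaled D *\<^sub>v jump_load) (jump D *\<^sub>v d)"
      by (rule scalar_prod_uminus[OF scaled_load_carrier mult_mat_vec_carrier[OF J_carrier d]])
    ultimately show ?thesis using b_sum_one_pressure[OF d, of a r] by simp
  qed
  then show ?thesis
    unfolding null_vector_eq
    using scaled_load_carrier by (subst pressure_solution_iff) (auto simp: ones_carrier)
qed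

text \<open>Continuous test velocities have no jump term and show that the interface pressure minus
  the interior one is constant; tests with prescribed jumps then determine \<open>l\<close>.\<close>

lemma pressure_solution_unique:
  assumes t: "t \<in> carrier_vec nP" and g: "g \<in> carrier_vec nG" and l: "l \<in> carrier_vec nL"
    and eq: "K *\<^sub>v ((0\<^sub>v nI @\<^sub>v t) @\<^sub>v (0\<^sub>v nD @\<^sub>v 0\<^sub>v nR)) = transpose_mat C *\<^sub>v (g @\<^sub>v l)"
  shows "\<exists>c. g @\<^sub>v l = c \<cdot>\<^sub>v null_vector D"
proof -
  have form: "b_sum (vcomb a d r) (pcomb bP t) = b_sum (vcomb a d r) (pcomb bG g) + scalar_prod l (jump D *\<^sub>v d)"
    if "a \<in> carrier_vec nI" "d \<in> carrier_vec nD" "r \<in> carrier_vec nR" for a d r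
    using eq that unfolding pressure_solution_iff[OF t g l] by blast
  let ?q = "\<lambda>x. (-1) * pcomb bP t x + 1 * pcomb bG g x"
  have q_eq: "?q = (\<lambda>x. pcomb bG g x - 1 *\<^sub>R pcomb bP t x)" by simp
  have qP: "?q \<in> P1 (tri D)" unfolding q_eq by (intro P1_diff P1_scaleR pcomb_P1 pressure_family_basis)
  have b_q: "b_sum w ?q = b_sum w (pcomb bG g) - b_sum w (pcomb bP t)" if "\<And>i. w i \<in> V" for w
    unfolding b_sum_pressures[OF that] by simp
  have "b_sum (\<lambda>_. u) ?q = 0" if "u \<in> V" for u
  proof -
    from that obtain a d r where v: "a \<in> carrier_vec nI" "d \<in> carrier_vec nD" "r \<in> carrier_vec nR"
      and Jd: "jump D *\<^sub>v d = 0\<^sub>v nL"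
      and u: "\<And>i x. i < nsub D \<Longrightarrow> x \<in> region (subd D i) \<Longrightarrow> u x = comb bI a i x + comb bD d i x + comb bR r i x"
      by (rule velocity_decomposition) blast
    have "b_sum (\<lambda>_. u) ?q = b_sum (vcomb a d r) ?q"
      by (rule b_sum_cong) (simp add: u vcomb_def)
    also have "\<dots> = 0" using b_q[OF vcomb_in_V] form[OF v] Jd l by simp
    finally show ?thesis .
  qed
  then obtain c where "\<forall>x\<in>region (tri D). ?q x = c" using kernel_iff[OF qP] by blast
  then have cc: "t = (- c) \<cdot>\<^sub>v ones nP" "g = c \<cdot>\<^sub>v ones nG"
    using constant_pressure_coefficients[OF t g, of c] by simp_all
  have "l = c \<cdot>\<^sub>v (- (jump_scaled D *\<^sub>v jump_load))"
  proof (rule vec_eqI_scalar_prod[OF l])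
    show "c \<cdot>\<^sub>v (- (jump_scaled D *\<^sub>v jump_load)) \<in> carrier_vec nL" using scaled_load_carrier by simp
    fix u :: "real vec" assume u: "u \<in> carrier_vec nL"
    \<comment> \<open>This dual velocity has the jump \<open>u\<close>, by the identity
      \<open>JJ\<close>.\<close>
    let ?d = "transpose_mat (jump_scaled D) *\<^sub>v u"
    have Jt: "transpose_mat (jump_scaled D) \<in> carrier_mat nD nL" using Js_carrier by simp
    have d: "?d \<in> carrier_vec nD" by (rule mult_mat_vec_carrier[OF Jt u])
    have Jd: "jump D *\<^sub>v ?d = u"
      unfolding assoc_mult_mat_vec[OF J_carrier Jt u, symmetric] JJ using u by simp
    let ?w = "vcomb (0\<^sub>v nI) ?d (0\<^sub>v nR)"
    have qc: "?q = (\<lambda>x. c * pcomb bP (ones nP) x + c * pcomb bG (ones nG) x)"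
      unfolding cc pcomb_def ones_def by (intro ext) (simp add: sum_distrib_left sum_negf mult.assoc)
    have "b_sum ?w ?q = c * b_sum ?w one_pressure"
      unfolding qc one_pressure_def b_sum_pressures[OF vcomb_in_V] by (simp add: distrib_left)
    then have "- scalar_prod l u = c * scalar_prod (jump_scaled D *\<^sub>v jump_load) u"
      using b_q[OF vcomb_in_V] form[OF zero_carrier_vec d zero_carrier_vec] b_sum_one_pressure[OF d]
      unfolding Jd by simp
    moreover have "scalar_prod u l = scalar_prod l u" by (rule comm_scalar_prod[OF u l])
    moreover have "scalar_prod u (c \<cdot>\<^sub>v (- (jump_scaled D *\<^sub>v jump_load))) =
        - (c * scalar_prod (jump_scaled D *\<^sub>v jump_load) u)"
    proof -
      have "scalar_prod u (c \<cdot>\<^sub>v (- (jump_scaled D *\<^sub>v jump_load)))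
          = c * scalar_prod (- (jump_scaled D *\<^sub>v jump_load)) u"
        using scalar_prod_smult_distrib[of u nL "- (jump_scaled D *\<^sub>v jump_load)" c]
          comm_scalar_prod[of u nL "- (jump_scaled D *\<^sub>v jump_load)"] u scaled_load_carrier by simp
      then show ?thesis unfolding scalar_prod_uminus[OF scaled_load_carrier u] by simp
    qed
    ultimately show "scalar_prod u l = scalar_prod u (c \<cdot>\<^sub>v (- (jump_scaled D *\<^sub>v jump_load)))" by simp
  qed
  then have "g @\<^sub>v l = c \<cdot>\<^sub>v null_vector D"
    unfolding null_vector_eq smult_append_vec cc(2) by simp
  then show ?thesis by blast
qed

text \<open>\<open>mat_inverse\<close> yields an option; the result \<open>None\<close> would
  contradict that a two-sided inverse makes \<open>A_tilde\<close> a unit of the matrix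
  ring.\<close>

lemma K_inverse:
  obtains Ki where "mat_inverse K = Some Ki" "Ki \<in> carrier_mat nV nV" "K * Ki = 1\<^sub>m nV" "Ki * K = 1\<^sub>m nV"
proof -
  obtain B where "inverts_mat K B" "inverts_mat B K" using inv unfolding invertible_mat_def by blast
  then have B: "K * B = 1\<^sub>m nV" "B * K = 1\<^sub>m (dim_row B)"
    using K_carrier unfolding inverts_mat_def by auto
  have "dim_col B = nV" using arg_cong[OF B(1), of dim_col] by simp
  moreover have "dim_row B = nV" using arg_cong[OF B(2), of dim_col] K_carrier by simp
  ultimately have Bc: "B \<in> carrier_mat nV nV" by auto
  show thesis
  proof (cases "mat_inverse K")
    case None
    have "K \<in> Units (ring_mat TYPE(real) nV ())"
      unfolding Units_def ring_mat_def using B Bc K_carrier by auto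
    with mat_inverse(1)[OF K_carrier None, where b = "()"] show thesis by blast
  next
    case (Some Ki)
    with mat_inverse(2)[OF K_carrier Some] that show thesis by blast
  qed
qed

lemma null_vector_nonzero: "null_vector D \<noteq> 0\<^sub>v (nG + nL)"
proof
  assume N: "null_vector D = 0\<^sub>v (nG + nL)"
  show False
  proof (cases "nG = 0")
    case False
    then have "vec_index (null_vector D) 0 = 1"
      unfolding null_vector_eq by (simp add: ones_def)
    with N False show False by simp
  next
    \<comment> \<open>Without interface pressures the first component is empty. A zero null vector
      would then make \<open>A_tilde\<close> annihilate the nonzero constant interior
      pressure.\<close>
    case True
    then have "nP > 0" using nodes_tri_nonempty nodes_tri_dofs by auto
    let ?y = "(0\<^sub>v nI @\<^sub>v - ones nP) @\<^sub>v (0\<^sub>v nD @\<^sub>v 0\<^sub>v nR)"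
    have y: "?y \<in> carrier_vec nV"
      using ones_carrier by (intro append_carrier_vec zero_carrier_vec) simp
    have "K *\<^sub>v ?y = 0\<^sub>v nV"
      unfolding null_vector_solution N
      using mult_mat_zero_vec[of "transpose_mat C" nV "nG + nL"] C_carrier by simp
    obtain Ki where Ki: "Ki \<in> carrier_mat nV nV" "Ki * K = 1\<^sub>m nV" using K_inverse by blast
    have "?y = (Ki * K) *\<^sub>v ?y" using y unfolding Ki(2) by simp
    also have "\<dots> = Ki *\<^sub>v (K *\<^sub>v ?y)" by (rule assoc_mult_mat_vec[OF Ki(1) K_carrier y])
    also have "\<dots> = 0\<^sub>v nV" unfolding \<open>K *\<^sub>v ?y = 0\<^sub>v nV\<close> by (rule mult_mat_zero_vec[OF Ki(1)])
    \<comment> \<open>Position \<open>nI\<close> holds the first interior pressure entry, right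
      after the interior velocities.\<close>
    finally have "vec_index ?y nI = 0" using \<open>nP > 0\<close> by simp
    moreover have "vec_index ?y nI = -1" using \<open>nP > 0\<close> by (simp add: ones_def)
    ultimately show False by simp
  qed
qed

text \<open>This set and the next are \<open>W\<close> and \<open>P\<close> of the abstract result;
  interior, dual and primal velocities stay together because only the interior pressures act as
  multipliers.\<close>

definition velocity_vectors :: "real vec set" where
  "velocity_vectors = {(a @\<^sub>v 0\<^sub>v nP) @\<^sub>v (d @\<^sub>v r) | a d r.
    a \<in> carrier_vec nI \<and> d \<in> carrier_vec nD \<and> r \<in> carrier_vec nR}"

definition pressure_vectors :: "real vec set" where
  "pressure_vectors = {(0\<^sub>v nI @\<^sub>v t) @\<^sub>v (0\<^sub>v nD @\<^sub>v 0\<^sub>v nR) | t. t \<in> carrier_vec nP}"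

lemma velocity_vectorsE:
  assumes "w \<in> velocity_vectors"
  obtains a d r where "a \<in> carrier_vec nI" "d \<in> carrier_vec nD" "r \<in> carrier_vec nR"
    "w = (a @\<^sub>v 0\<^sub>v nP) @\<^sub>v (d @\<^sub>v r)"
  using assms unfolding velocity_vectors_def by blast

lemma pressure_vectorsE:
  assumes "p \<in> pressure_vectors"
  obtains t where "t \<in> carrier_vec nP" "p = (0\<^sub>v nI @\<^sub>v t) @\<^sub>v (0\<^sub>v nD @\<^sub>v 0\<^sub>v nR)"
  using assms unfolding pressure_vectors_def by blast

lemma append_add4:
  assumes "a \<in> carrier_vec nI" "t \<in> carrier_vec nP" "d \<in> carrier_vec nD" "r \<in> carrier_vec nR"
    and "a' \<in> carrier_vec nI" "t' \<in> carrier_vec nP" "d' \<in> carrier_vec nD" "r' \<in> carrier_vec nR"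
  shows "((a @\<^sub>v t) @\<^sub>v (d @\<^sub>v r)) + ((a' @\<^sub>v t') @\<^sub>v (d' @\<^sub>v r'))
    = ((a + a') @\<^sub>v (t + t')) @\<^sub>v ((d + d') @\<^sub>v (r + r'))"
  unfolding append_vec_add[OF append_carrier_vec[OF assms(1,2)] append_carrier_vec[OF assms(5,6)]
      append_carrier_vec[OF assms(3,4)] append_carrier_vec[OF assms(7,8)]]
    append_vec_add[OF assms(1,5,2,6)] append_vec_add[OF assms(3,7,4,8)] ..

theorem G_mat_properties:
  shows "G_mat D \<in> carrier_mat (nG + nL) (nG + nL)" "transpose_mat (G_mat D) = G_mat D"
    "\<forall>x\<in>carrier_vec (nG + nL). 0 \<le> scalar_prod x (G_mat D *\<^sub>v x)"
    "eigenvalue (G_mat D) 0" "Polynomial.order 0 (char_poly (G_mat D)) = 1"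
    "\<forall>ev. eigenvalue (G_mat D) ev \<and> ev \<noteq> 0 \<longrightarrow> ev > 0"
    "mat_kernel (G_mat D) = {c \<cdot>\<^sub>v null_vector D | c. True}"
proof -
  obtain Ki where Ki: "mat_inverse K = Some Ki" "Ki \<in> carrier_mat nV nV" "K * Ki = 1\<^sub>m nV" "Ki * K = 1\<^sub>m nV"
    by (rule K_inverse)
  have G: "G_mat D = C * Ki * transpose_mat C" unfolding G_mat_def Ki(1) by simp
  have W: "velocity_vectors \<subseteq> carrier_vec nV" and P: "pressure_vectors \<subseteq> carrier_vec nV"
    unfolding velocity_vectors_def pressure_vectors_def by (auto intro!: append_carrier_vec)
  have split: "\<exists>w\<in>velocity_vectors. \<exists>p\<in>pressure_vectors. y = w + p" if "y \<in> carrier_vec nV" for y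
  proof -
    from that obtain a t d r where v: "a \<in> carrier_vec nI" "t \<in> carrier_vec nP" "d \<in> carrier_vec nD" "r \<in> carrier_vec nR"
      and y: "y = (a @\<^sub>v t) @\<^sub>v (d @\<^sub>v r)" by (rule carrier_split)
    have "y = ((a @\<^sub>v 0\<^sub>v nP) @\<^sub>v (d @\<^sub>v r)) + ((0\<^sub>v nI @\<^sub>v t) @\<^sub>v (0\<^sub>v nD @\<^sub>v 0\<^sub>v nR))"
      unfolding y append_add4[OF v(1) zero_carrier_vec v(3,4) zero_carrier_vec v(2) zero_carrier_vec zero_carrier_vec]
      using v by simp
    then show ?thesis using v unfolding velocity_vectors_def pressure_vectors_def by blast
  qed
  have add: "u + v \<in> velocity_vectors" if "u \<in> velocity_vectors" "v \<in> velocity_vectors" for u v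
  proof -
    from that(1) obtain a d r where u: "a \<in> carrier_vec nI" "d \<in> carrier_vec nD" "r \<in> carrier_vec nR"
      "u = (a @\<^sub>v 0\<^sub>v nP) @\<^sub>v (d @\<^sub>v r)" by (rule velocity_vectorsE)
    from that(2) obtain a' d' r' where v: "a' \<in> carrier_vec nI" "d' \<in> carrier_vec nD" "r' \<in> carrier_vec nR"
      "v = (a' @\<^sub>v 0\<^sub>v nP) @\<^sub>v (d' @\<^sub>v r')" by (rule velocity_vectorsE)
    have "u + v = ((a + a') @\<^sub>v 0\<^sub>v nP) @\<^sub>v ((d + d') @\<^sub>v (r + r'))"
      unfolding u(4) v(4) append_add4[OF u(1) zero_carrier_vec u(2,3) v(1) zero_carrier_vec v(2,3)] by simp
    moreover have "a + a' \<in> carrier_vec nI" "d + d' \<in> carrier_vec nD" "r + r' \<in> carrier_vec nR"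
      using u(1-3) v(1-3) by simp_all
    ultimately show ?thesis unfolding velocity_vectors_def by blast
  qed
  have smult: "c \<cdot>\<^sub>v u \<in> velocity_vectors" if "u \<in> velocity_vectors" for c u
  proof -
    from that obtain a d r where u: "a \<in> carrier_vec nI" "d \<in> carrier_vec nD" "r \<in> carrier_vec nR"
      "u = (a @\<^sub>v 0\<^sub>v nP) @\<^sub>v (d @\<^sub>v r)" by (rule velocity_vectorsE)
    have "c \<cdot>\<^sub>v u = ((c \<cdot>\<^sub>v a) @\<^sub>v 0\<^sub>v nP) @\<^sub>v ((c \<cdot>\<^sub>v d) @\<^sub>v (c \<cdot>\<^sub>v r))"
      unfolding u(4) smult_append_vec by (simp add: smult_vec_zero_right)
    moreover have "c \<cdot>\<^sub>v a \<in> carrier_vec nI" "c \<cdot>\<^sub>v d \<in> carrier_vec nD" "c \<cdot>\<^sub>v r \<in> carrier_vec nR"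
      using u by simp_all
    ultimately show ?thesis unfolding velocity_vectors_def by blast
  qed
  have psd: "0 \<le> scalar_prod u (K *\<^sub>v u)" if "u \<in> velocity_vectors" for u
  proof -
    from that obtain a d r where u: "a \<in> carrier_vec nI" "d \<in> carrier_vec nD" "r \<in> carrier_vec nR"
      "u = (a @\<^sub>v 0\<^sub>v nP) @\<^sub>v (d @\<^sub>v r)" by (rule velocity_vectorsE)
    have "scalar_prod u (K *\<^sub>v u) = a_sum (vcomb a d r) (vcomb a d r)"
      unfolding u(4) K_form[OF u(1) zero_carrier_vec u(2,3) u(1) zero_carrier_vec u(2,3)]
      by (simp add: pcomb_zero form_sums_zero)
    then show ?thesis using a_sum_nonneg vcomb_in_V by simp
  qed
  have iso: "scalar_prod p (K *\<^sub>v p') = 0" if "p \<in> pressure_vectors" "p' \<in> pressure_vectors" for p p'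
  proof -
    from that(1) obtain t where t: "t \<in> carrier_vec nP" "p = (0\<^sub>v nI @\<^sub>v t) @\<^sub>v (0\<^sub>v nD @\<^sub>v 0\<^sub>v nR)"
      by (rule pressure_vectorsE)
    from that(2) obtain t' where t': "t' \<in> carrier_vec nP" "p' = (0\<^sub>v nI @\<^sub>v t') @\<^sub>v (0\<^sub>v nD @\<^sub>v 0\<^sub>v nR)"
      by (rule pressure_vectorsE)
    show ?thesis
      unfolding t(2) t'(2)
        K_form[OF zero_carrier_vec t'(1) zero_carrier_vec zero_carrier_vec zero_carrier_vec t(1) zero_carrier_vec zero_carrier_vec]
        vcomb_zero form_sums_zero by simp
  qed
  have CP: "C *\<^sub>v p = 0\<^sub>v (nG + nL)" if "p \<in> pressure_vectors" for p
  proof (rule vec_eqI_scalar_prod)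
    from that obtain t where t: "t \<in> carrier_vec nP" "p = (0\<^sub>v nI @\<^sub>v t) @\<^sub>v (0\<^sub>v nD @\<^sub>v 0\<^sub>v nR)"
      by (rule pressure_vectorsE)
    show "C *\<^sub>v p \<in> carrier_vec (nG + nL)" using P that by (intro mult_mat_vec_carrier[OF C_carrier]) blast
    fix u :: "real vec" assume "u \<in> carrier_vec (nG + nL)"
    then have u: "u = vec_first u nG @\<^sub>v vec_last u nL" by simp
    have "scalar_prod u (C *\<^sub>v p) = 0"
      by (subst u, subst t(2), subst C_form[OF zero_carrier_vec t(1) zero_carrier_vec zero_carrier_vec
            vec_first_carrier vec_last_carrier])
        (simp add: vcomb_zero form_sums_zero mult_mat_zero_vec[OF J_carrier])
    then show "scalar_prod u (C *\<^sub>v p) = scalar_prod u (0\<^sub>v (nG + nL))"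
      using \<open>u \<in> carrier_vec (nG + nL)\<close> by simp
  qed simp
  have N: "(0\<^sub>v nI @\<^sub>v - ones nP) @\<^sub>v (0\<^sub>v nD @\<^sub>v 0\<^sub>v nR) \<in> pressure_vectors"
    unfolding pressure_vectors_def using ones_carrier[of nP] by auto
  have ker: "\<exists>c. x = c \<cdot>\<^sub>v null_vector D"
    if x: "x \<in> carrier_vec (nG + nL)" "p \<in> pressure_vectors" "K *\<^sub>v p = transpose_mat C *\<^sub>v x" for x p
  proof -
    from x(2) obtain t where t: "t \<in> carrier_vec nP" "p = (0\<^sub>v nI @\<^sub>v t) @\<^sub>v (0\<^sub>v nD @\<^sub>v 0\<^sub>v nR)"
      by (rule pressure_vectorsE)
    have u: "vec_first x nG @\<^sub>v vec_last x nL = x" using x(1) by simp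
    show ?thesis
      using pressure_solution_unique[OF t(1) vec_first_carrier vec_last_carrier, of x x] x(3)
      unfolding t(2) u by blast
  qed
  note result = saddle_point_schur_complement[OF K_carrier K_symmetric C_carrier Ki(2-4) W P split add smult psd iso CP
      null_vector_carrier null_vector_nonzero N null_vector_solution ker, folded G]
  show "G_mat D \<in> carrier_mat (nG + nL) (nG + nL)" "transpose_mat (G_mat D) = G_mat D"
    "\<forall>x\<in>carrier_vec (nG + nL). 0 \<le> scalar_prod x (G_mat D *\<^sub>v x)"
    "eigenvalue (G_mat D) 0" "Polynomial.order 0 (char_poly (G_mat D)) = 1"
    "\<forall>ev. eigenvalue (G_mat D) ev \<and> ev \<noteq> 0 \<longrightarrow> ev > 0"
    "mat_kernel (G_mat D) = {c \<cdot>\<^sub>v null_vector D | c. True}"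
    by (rule result; assumption)+
qed

end

theorem mainTheorem2:
  fixes D :: setting and h H \<sigma> :: real
  assumes "h > 0" "H > 0" "\<sigma> > 0"
    and "decomposed_domain D"
    and "shape_regular \<sigma> h (tri D)"
    and "subdomain_size \<sigma> H D"
    and "ker_BT_constants D"
    and "numbered_dofs D"
    and "primal_dual_split D"
    and "jump_constraints D"
    and "jump D * transpose_mat (jump_scaled D) = 1\<^sub>m (dim_row (jump D))"
    and "invertible_mat (A_tilde D)"
  shows "let n = dim_X D in
    G_mat D \<in> carrier_mat n n \<and> transpose_mat (G_mat D) = G_mat D \<and>
    (\<forall>x\<in>carrier_vec n. 0 \<le> scalar_prod x (G_mat D *\<^sub>v x)) \<and>
    eigenvalue (G_mat D) 0 \<and> Polynomial.order 0 (char_poly (G_mat D)) = 1 \<and>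
    (\<forall>ev. eigenvalue (G_mat D) ev \<and> ev \<noteq> 0 \<longrightarrow> ev > 0) \<and>
    null_vector D \<in> carrier_vec n \<and> null_vector D \<noteq> 0\<^sub>v n \<and>
    mat_kernel (G_mat D) = {c \<cdot>\<^sub>v null_vector D | c. True}"
proof -
  have "decomposition D" by (rule decomposition.intro[OF assms(4,7-10)])
  then have *: "scaled_decomposition D"
    by (rule scaled_decomposition.intro) (rule scaled_decomposition_axioms.intro[OF assms(11,12)])
  note props = scaled_decomposition.G_mat_properties[OF *] scaled_decomposition.null_vector_carrier[OF *]
    scaled_decomposition.null_vector_nonzero[OF *]
  show ?thesis
    unfolding Let_def dim_X_def by (intro conjI; rule props)
qed

end
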